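(* Let $\pi_1:V_1\to X_1$ and $\pi_2:V_2\to X_2$ be finite-dimensional diffeological vector pseudo-bundles, let $(\tilde f,f)$ be a gluing between them with $f:X_1\supseteq Y\to f(Y)\subseteq X_2$, and let $g_1,g_2$ be pseudo-metrics on $V_1,V_2$ compatible with this gluing. Let $\chi_1:E_1\to X_1$ and $\chi_2:E_2\to X_2$ be pseudo-bundles of Clifford modules, with smooth actions $c_i:C\ell(V_i,g_i)\to\mathcal L(E_i,E_i)$, $i=1,2$, and let $\tilde f':\chi_1^{-1}(Y)\to\chi_2^{-1}(f(Y))$ be a smooth fibrewise linear map covering $f$. Suppose that $c_1$ and $c_2$ are compatible, i.e. for all $y\in Y$, $v\in(\pi_1^{C\ell})^{-1}(y)$ and $e_1\in\chi_1^{-1}(y)$, $$\tilde f'(c_1(v)(e_1))=c_2(\tilde F^{C\ell}(v))(\tilde f'(e_1)).$$ Then the induced action $c$, given for $v\in C\ell(V_1,g_1)\cup_{\tilde F^{C\ell}}C\ell(V_2,g_2)$ and $e\in E_1\cup_{\tilde f'}E_2$ lying over the same point of $X_1\cup_fX_2$ by $$c(v)(e)=\begin{cases}j_1^{E_1}\left(c_1((j_1^{C\ell})^{-1}(v))((j_1^{E_1})^{-1}(e))\right)&\text{if }v\in\mathrm{Im}(j_1^{C\ell})\ (\text{so that }e\in\mathrm{Im}(j_1^{E_1})),\\ j_2^{E_2}\left(c_2((j_2^{C\ell})^{-1}(v))((j_2^{E_2})^{-1}(e))\right)&\text{if }v\in\mathrm{Im}(j_2^{C\ell})\ (\text{so that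 }e\in\mathrm{Im}(j_2^{E_2})),\end{cases}$$ is smooth as a map $$C\ell(V_1,g_1)\cup_{\tilde F^{C\ell}}C\ell(V_2,g_2)\to\mathcal L(E_1\cup_{\tilde f'}E_2,\,E_1\cup_{\tilde f'}E_2).$$
   Context: **Diffeology.** A diffeology on a set $X$ is a collection of maps $U\to X$ (plots), $U$ open in $\mathbb R^n$, $n\in\mathbb N$, containing all constant maps, closed under precomposition with smooth maps between domains, and such that any map that is locally a plot is a plot. A map is smooth if its composition with every plot is a plot; a diffeomorphism is a smooth bijection with smooth inverse. Subset diffeology: plots with range in the subset. Product diffeology: componentwise plots. Disjoint union diffeology: maps locally given by plots of one component. Quotient (pushforward) diffeology along a surjection $\pi$: maps locally of the form $\pi\circ p$, $p$ a plot. A diffeological vector space is a real vector space with a diffeology for which addition and scalar multiplication are smooth ($\mathbb R$ having the standard diffeology, i.e. all usual smooth maps). Its diffeological dual is the space of smooth linear functionals. **Pseudo-bundles.** A diffeological vector pseudo-bundle is a smooth surjection $\pi:V\to X$ of diffeological spaces with a real vector space structure on each fibre $\pi^{-1}(x)$ such that fibrewise addition $V\times_XV\to V$, fibrewise scalar multiplication $\mathbb R\times V\to V$ and the zero section $X\to V$ are smooth. It is finite-dimensional if all fibres are (fibre dimensions may vary). The dual pseudo-bundle $V^*=\bigcup_x(\pi^{-1}(x))^*$ (diffeological duals) has as plots those $p:U\to V^*$ such that for every plot $q:U'\to V$ the map $(u,u')\mapsto p(u)(q(u'))$ is smooth on $\{(u,u'):\ p(u)\text{ and }q(u')\text{ lie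 over the same point of }X\}\subseteq U\times U'$ with the subset diffeology. The tensor product of pseudo-bundles over $X$ is the union of the tensor products of the fibres; its plots are the maps that locally, over a plot of $X$, are finite sums of pointwise tensor products of plots of the factors covering that same plot of $X$ (the zero section over the plot being the empty sum). For a finite-dimensional pseudo-bundle $E\to X$ with fibres $E_x$, $\mathcal L(E,E)=\bigcup_xL^\infty(E_x,E_x)$ is the union of the spaces of smooth linear endomorphisms of the fibres, with the pseudo-bundle functional diffeology: the smallest diffeology containing all maps $p:U\to\mathcal L(E,E)$ such that for every plot $q:U'\to E$ the map $(u,u')\mapsto p(u)(q(u'))\in E$, defined on $\{(u,u'):\ p(u)\text{ and }q(u')\text{ lie over the same point of }X\}\subseteq U\times U'$, is smooth for the subset diffeology on its domain. **Pseudo-metrics.** A pseudo-metric on $\pi:V\to X$ is a smooth section $g:X\to V^*\otimes V^*$ such that each $g(x)$ is a positive semi-definite symmetric bilinear form on $\pi^{-1}(x)$ of rank $\dim((\pi^{-1}(x))^* )$. **Clifford algebras and modules.** $T(V)=\bigcup_xT(\pi^{-1}(x))=\bigcup_x\bigoplus_{r\ge0}(\pi^{-1}(x))^{\otimes r}$ (degree-0 part $X\times\mathbb R$) carries the diffeology whose plots are the maps that locally take values in a finite partial sum, with all components plots of the tensor power pseudo-bundles over the same plot of $X$. For a vector space $W$ with symmetric bilinear form $q$, $C\ell(W,q)=T(W)/I$, where $I$ is the two-sided ideal generated by the elements $v\otimes w+w\otimes v+4q(v,w)$. The pseudo-bundle of Clifford algebras $\pi^{C\ell}:C\ell(V,g)\to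 X$ is $\bigcup_xC\ell(\pi^{-1}(x),g(x))$ with the quotient diffeology from $T(V)$. A pseudo-bundle of Clifford modules over $C\ell(V,g)$ is a finite-dimensional diffeological vector pseudo-bundle $\chi:E\to X$ with a smooth map $c:C\ell(V,g)\to\mathcal L(E,E)$ covering the identity of $X$ and restricting on each fibre to a unital algebra homomorphism. **Gluing.** For diffeological spaces $X_1,X_2$ and a smooth map $f:X_1\supseteq Y\to X_2$ ($Y$ with the subset diffeology), $X_1\cup_fX_2$ is the quotient of $X_1\sqcup X_2$ by the equivalence relation generated by $y\sim f(y)$, $y\in Y$, with the quotient of the disjoint union diffeology. A gluing $(\tilde f,f)$ between pseudo-bundles $\pi_1:V_1\to X_1$ and $\pi_2:V_2\to X_2$ consists of a diffeomorphism $f:Y\to f(Y)$, $Y\subseteq X_1$, $f(Y)\subseteq X_2$ (subset diffeologies), and a smooth map $\tilde f:\pi_1^{-1}(Y)\to\pi_2^{-1}(f(Y))$, linear on each fibre, with $\pi_2\circ\tilde f=f\circ\pi_1$. It yields the pseudo-bundle $V_1\cup_{\tilde f}V_2\to X_1\cup_fX_2$, whose fibre over the class of $x\in X_1\setminus Y$ is that of $V_1$ and over the class of $x\in X_2$ is that of $V_2$. Likewise $(\tilde f',f)$ glues $E_1$ to $E_2$. Pseudo-metrics $g_1,g_2$ are compatible with the gluing if $g_1(y)(v,w)=g_2(f(y))(\tilde f(v),\tilde f(w))$ for all $y\in Y$, $v,w\in\pi_1^{-1}(y)$. In this case $\tilde F^{C\ell}:(\pi_1^{C\ell})^{-1}(Y)\to(\pi_2^{C\ell})^{-1}(f(Y))$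 is the map whose restriction to each fibre $C\ell(\pi_1^{-1}(y),g_1(y))$ is the unital algebra homomorphism to $C\ell(\pi_2^{-1}(f(y)),g_2(f(y)))$ extending $\tilde f|_{\pi_1^{-1}(y)}$; $(\tilde F^{C\ell},f)$ is a gluing between $C\ell(V_1,g_1)$ and $C\ell(V_2,g_2)$. **Notation.** $j_1^{C\ell}:C\ell(V_1,g_1)\setminus(\pi_1^{C\ell})^{-1}(Y)\to C\ell(V_1,g_1)\cup_{\tilde F^{C\ell}}C\ell(V_2,g_2)$, $j_2^{C\ell}:C\ell(V_2,g_2)\to C\ell(V_1,g_1)\cup_{\tilde F^{C\ell}}C\ell(V_2,g_2)$, $j_1^{E_1}:E_1\setminus\chi_1^{-1}(Y)\to E_1\cup_{\tilde f'}E_2$ and $j_2^{E_2}:E_2\to E_1\cup_{\tilde f'}E_2$ are the natural injections; in each glued space the images of the two injections are disjoint and cover it. *)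

theory Defs
  imports
    "HOL-Analysis.Analysis"
    "HOL-Algebra.QuotRing"
    "HOL-Algebra.Module"
    "HOL-Library.Poly_Mapping"
    "HOL-Library.FuncSet"
begin

section \<open>Smooth maps between open subsets of Euclidean spaces\<close>

text \<open>\<open>\<real>\<^sup>n\<close> is \<^const>\<open>Euclidean_space\<close> \<open>n\<close>: the sequences vanishing from index \<open>n\<close> on.
  This lets one diffeology contain plots of every dimension.\<close>

type_synonym point = "nat \<Rightarrow> real"

definition partial_deriv :: "nat \<Rightarrow> (point \<Rightarrow> real) \<Rightarrow> point \<Rightarrow> real" where
  "partial_deriv i f x = deriv (\<lambda>t. f (x(i := t))) (x i)"

primrec C_k :: "nat \<Rightarrow> nat \<Rightarrow> point set \<Rightarrow> (point \<Rightarrow> real) \<Rightarrow> bool" where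
  "C_k 0 n U f \<longleftrightarrow> continuous_map (subtopology (Euclidean_space n) U) euclideanreal f"
| "C_k (Suc k) n U f \<longleftrightarrow>
     continuous_map (subtopology (Euclidean_space n) U) euclideanreal f \<and>
     (\<forall>i<n. (\<forall>x\<in>U. (\<lambda>t. f (x(i := t))) differentiable (at (x i))) \<and>
            C_k k n U (partial_deriv i f))"

definition smooth_real :: "nat \<Rightarrow> point set \<Rightarrow> (point \<Rightarrow> real) \<Rightarrow> bool" where
  "smooth_real n U f \<longleftrightarrow> (\<forall>k. C_k k n U f)"

definition smooth_into :: "nat \<Rightarrow> point set \<Rightarrow> nat \<Rightarrow> point set \<Rightarrow> (point \<Rightarrow> point) \<Rightarrow> bool" where
  "smooth_into m W n U h \<longleftrightarrow>
     h ` W \<subseteq> U \<inter> topspace (Euclidean_space n) \<and> (\<forall>i<n. smooth_real m W (\<lambda>w. h w i))"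

section \<open>Diffeological spaces\<close>

text \<open>\<open>plots D n U p\<close> says that the restriction of \<open>p\<close> to the open set \<open>U \<subseteq> \<real>\<^sup>n\<close> is a plot. The
  values of \<open>p\<close> outside \<open>U\<close> are irrelevant; this is part of the locality axiom below, where
  \<open>local_plot\<close> compares \<open>p\<close> with a plot only on a neighbourhood of each point of \<open>U\<close>.\<close>

type_synonym 'a plot_pred = "nat \<Rightarrow> point set \<Rightarrow> (point \<Rightarrow> 'a) \<Rightarrow> bool"

record 'a dspace =
  points :: "'a set"
  plots :: "'a plot_pred"

definition local_plot :: "'a plot_pred \<Rightarrow> 'a plot_pred" where
  "local_plot P n U p \<longleftrightarrow>
     openin (Euclidean_space n) U \<and>
     (\<forall>u\<in>U. \<exists>W q. openin (Euclidean_space n) W \<and> u \<in> W \<and> W \<subseteq> U \<and>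
        P n W q \<and> (\<forall>w\<in>W. p w = q w))"

locale diffeology =
  fixes D :: "'a dspace"
  assumes plot_range: "plots D n U p \<Longrightarrow> openin (Euclidean_space n) U \<and> p ` U \<subseteq> points D"
    and plot_const: "\<lbrakk>openin (Euclidean_space n) U; x \<in> points D\<rbrakk> \<Longrightarrow> plots D n U (\<lambda>_. x)"
    and plot_compose: "\<lbrakk>plots D n U p; openin (Euclidean_space m) W; smooth_into m W n U h\<rbrakk>
          \<Longrightarrow> plots D m W (p \<circ> h)"
    and plot_local: "local_plot (plots D) n U p \<Longrightarrow> plots D n U p"

definition smooth_map :: "'a dspace \<Rightarrow> 'b dspace \<Rightarrow> ('a \<Rightarrow> 'b) \<Rightarrow> bool" where
  "smooth_map A B f \<longleftrightarrow>
     f ` points A \<subseteq> points B \<and> (\<forall>n U p. plots A n U p \<longrightarrow> plots B n U (f \<circ> p))"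

definition diffeomorphism :: "'a dspace \<Rightarrow> 'b dspace \<Rightarrow> ('a \<Rightarrow> 'b) \<Rightarrow> bool" where
  "diffeomorphism A B f \<longleftrightarrow>
     bij_betw f (points A) (points B) \<and> smooth_map A B f \<and>
     smooth_map B A (inv_into (points A) f)"

definition euclid_dspace :: "nat \<Rightarrow> point dspace" where
  "euclid_dspace n =
     \<lparr>points = topspace (Euclidean_space n),
      plots = (\<lambda>m W h. openin (Euclidean_space m) W \<and>
                 smooth_into m W n (topspace (Euclidean_space n)) h)\<rparr>"

definition real_dspace :: "real dspace" where
  "real_dspace =
     \<lparr>points = UNIV, plots = (\<lambda>m W h. openin (Euclidean_space m) W \<and> smooth_real m W h)\<rparr>"

definition sub_dspace :: "'a dspace \<Rightarrow> 'a set \<Rightarrow> 'a dspace" where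
  "sub_dspace D S =
     \<lparr>points = points D \<inter> S, plots = (\<lambda>n U p. plots D n U p \<and> p ` U \<subseteq> S)\<rparr>"

definition prod_dspace :: "'a dspace \<Rightarrow> 'b dspace \<Rightarrow> ('a \<times> 'b) dspace" where
  "prod_dspace A B =
     \<lparr>points = points A \<times> points B,
      plots = (\<lambda>n U p. plots A n U (fst \<circ> p) \<and> plots B n U (snd \<circ> p))\<rparr>"

definition sum_dspace :: "'a dspace \<Rightarrow> 'b dspace \<Rightarrow> ('a + 'b) dspace" where
  "sum_dspace A B =
     \<lparr>points = points A <+> points B,
      plots = local_plot (\<lambda>n U p. (\<exists>q. plots A n U q \<and> p = Inl \<circ> q) \<or>
                                  (\<exists>q. plots B n U q \<and> p = Inr \<circ> q))\<rparr>"

definition quot_dspace :: "'a dspace \<Rightarrow> ('a \<Rightarrow> 'b) \<Rightarrow> 'b dspace" where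
  "quot_dspace A \<pi> =
     \<lparr>points = \<pi> ` points A,
      plots = local_plot (\<lambda>n U p. \<exists>q. plots A n U q \<and> p = \<pi> \<circ> q)\<rparr>"

text \<open>The smallest diffeology on \<open>X\<close> containing the maps in \<open>G\<close>.\<close>

definition generated_dspace :: "'a set \<Rightarrow> 'a plot_pred \<Rightarrow> 'a dspace" where
  "generated_dspace X G =
     \<lparr>points = X,
      plots = (\<lambda>n U p. \<forall>D. diffeology D \<and> points D = X \<and>
                  (\<forall>m W q. G m W q \<longrightarrow> plots D m W q) \<longrightarrow> plots D n U p)\<rparr>"

section \<open>Real vector spaces and algebras\<close>

text \<open>A real vector space is a module record over \<open>real_alg\<close>. Since such a record extends the ring
  record, it also represents real algebras; for mere vector spaces \<^const>\<open>mult\<close> and \<^const>\<open>one\<close>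
  are meaningless. \<open>real_alg\<close> is the ring of reals and also the reals as a vector space.\<close>

definition real_alg :: "(real, real) module" where
  "real_alg = \<lparr>carrier = UNIV, mult = (*), one = 1, zero = 0, add = (+), smult = (*)\<rparr>"

definition linear_map ::
  "(real, 'a, 'm) module_scheme \<Rightarrow> (real, 'b, 'n) module_scheme \<Rightarrow> ('a \<Rightarrow> 'b) \<Rightarrow> bool" where
  "linear_map M N h \<longleftrightarrow>
     h \<in> carrier M \<rightarrow> carrier N \<and>
     (\<forall>v\<in>carrier M. \<forall>w\<in>carrier M. h (v \<oplus>\<^bsub>M\<^esub> w) = h v \<oplus>\<^bsub>N\<^esub> h w) \<and>
     (\<forall>a. \<forall>v\<in>carrier M. h (a \<odot>\<^bsub>M\<^esub> v) = a \<odot>\<^bsub>N\<^esub> h v)"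

definition alg_hom ::
  "(real, 'a, 'm) module_scheme \<Rightarrow> (real, 'b, 'n) module_scheme \<Rightarrow> ('a \<Rightarrow> 'b) set" where
  "alg_hom A B = {h \<in> ring_hom A B. linear_map A B h}"

definition finite_basis :: "(real, 'a, 'm) module_scheme \<Rightarrow> 'a set \<Rightarrow> bool" where
  "finite_basis M B \<longleftrightarrow>
     finite B \<and> B \<subseteq> carrier M \<and>
     (\<forall>v\<in>carrier M. \<exists>a. v = finsum M (\<lambda>b. a b \<odot>\<^bsub>M\<^esub> b) B) \<and>
     (\<forall>a. finsum M (\<lambda>b. a b \<odot>\<^bsub>M\<^esub> b) B = \<zero>\<^bsub>M\<^esub> \<longrightarrow> (\<forall>b\<in>B. a b = 0))"

definition finite_dim :: "(real, 'a, 'm) module_scheme \<Rightarrow> bool" where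
  "finite_dim M \<longleftrightarrow> (\<exists>B. finite_basis M B)"

definition vdim :: "(real, 'a, 'm) module_scheme \<Rightarrow> nat" where
  "vdim M = (THE n. \<exists>B. finite_basis M B \<and> card B = n)"

text \<open>The quotient by a submodule, respectively two-sided ideal: the quotient ring of the library
  together with scalar multiplication of cosets. For a submodule \<^const>\<open>mult\<close> and \<^const>\<open>one\<close>
  of the result are not used.\<close>

definition quot_alg :: "(real, 'a) module \<Rightarrow> 'a set \<Rightarrow> (real, 'a set) module" where
  "quot_alg A I =
     \<lparr>carrier = carrier (A Quot I), mult = mult (A Quot I), one = one (A Quot I),
      zero = zero (A Quot I), add = add (A Quot I),
      smult = (\<lambda>c C. \<Union>v\<in>C. I +>\<^bsub>A\<^esub> (c \<odot>\<^bsub>A\<^esub> v))\<rparr>"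

text \<open>Functions on a set are represented by their extensions by \<^const>\<open>undefined\<close>.\<close>

definition functional_space :: "'a set \<Rightarrow> ('a \<Rightarrow> real) set \<Rightarrow> (real, 'a \<Rightarrow> real) module" where
  "functional_space A F =
     \<lparr>carrier = F, mult = undefined, one = undefined,
      zero = (\<lambda>v\<in>A. 0), add = (\<lambda>\<phi> \<psi>. \<lambda>v\<in>A. \<phi> v + \<psi> v), smult = (\<lambda>c \<phi>. \<lambda>v\<in>A. c * \<phi> v)\<rparr>"

text \<open>The rank of a bilinear form \<open>q\<close> is the dimension of the image of \<open>v \<mapsto> q(v, \<sqdot>)\<close>.\<close>

definition form_rank :: "(real, 'a, 'm) module_scheme \<Rightarrow> ('a \<Rightarrow> 'a \<Rightarrow> real) \<Rightarrow> nat" where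
  "form_rank M q =
     vdim (functional_space (carrier M) ((\<lambda>v. \<lambda>w\<in>carrier M. q v w) ` carrier M))"

section \<open>Tensor powers, tensor algebras and Clifford algebras of vector spaces\<close>

text \<open>The \<open>r\<close>-th tensor power of \<open>W\<close> is the free vector space on the words of length \<open>r\<close> over \<open>W\<close>
  modulo the relations making a word multilinear in its letters; the word
  \<open>[v\<^sub>1, \<dots>, v\<^sub>r]\<close> stands for \<open>v\<^sub>1 \<otimes> \<dots> \<otimes> v\<^sub>r\<close>.\<close>

type_synonym 'v tensor = "('v list \<Rightarrow>\<^sub>0 real) set"

definition free_module :: "'k set \<Rightarrow> (real, 'k \<Rightarrow>\<^sub>0 real) module" where
  "free_module S =
     \<lparr>carrier = {p. Poly_Mapping.keys p \<subseteq> S}, mult = undefined, one = undefined,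
      zero = 0, add = (+), smult = (\<lambda>c. Poly_Mapping.map ((*) c))\<rparr>"

definition words :: "(real, 'v, 'm) module_scheme \<Rightarrow> nat \<Rightarrow> 'v list set" where
  "words W r = {l. length l = r \<and> set l \<subseteq> carrier W}"

definition multilinear_relators ::
  "(real, 'v, 'm) module_scheme \<Rightarrow> nat \<Rightarrow> ('v list \<Rightarrow>\<^sub>0 real) set" where
  "multilinear_relators W r =
     {Poly_Mapping.single (l[i := v \<oplus>\<^bsub>W\<^esub> w]) 1
        - Poly_Mapping.single (l[i := v]) 1 - Poly_Mapping.single (l[i := w]) 1
      | l i v w. l \<in> words W r \<and> i < r \<and> v \<in> carrier W \<and> w \<in> carrier W}
     \<union> {Poly_Mapping.single (l[i := a \<odot>\<^bsub>W\<^esub> v]) 1 - Poly_Mapping.single (l[i := v]) a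
      | l i a v. l \<in> words W r \<and> i < r \<and> v \<in> carrier W}"

definition tensor_null ::
  "(real, 'v, 'm) module_scheme \<Rightarrow> nat \<Rightarrow> ('v list \<Rightarrow>\<^sub>0 real) set" where
  "tensor_null W r =
     \<Inter>{H. submodule H real_alg (free_module (words W r)) \<and> multilinear_relators W r \<subseteq> H}"

definition tensor_power :: "(real, 'v, 'm) module_scheme \<Rightarrow> nat \<Rightarrow> (real, 'v tensor) module" where
  "tensor_power W r = quot_alg (free_module (words W r)) (tensor_null W r)"

definition tensor_coset ::
  "(real, 'v, 'm) module_scheme \<Rightarrow> nat \<Rightarrow> ('v list \<Rightarrow>\<^sub>0 real) \<Rightarrow> 'v tensor" where
  "tensor_coset W r p = tensor_null W r +>\<^bsub>free_module (words W r)\<^esub> p"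

definition pure_tensor :: "(real, 'v, 'm) module_scheme \<Rightarrow> 'v list \<Rightarrow> 'v tensor" where
  "pure_tensor W l = tensor_coset W (length l) (Poly_Mapping.single l 1)"

definition concat_mult :: "('v list \<Rightarrow>\<^sub>0 real) \<Rightarrow> ('v list \<Rightarrow>\<^sub>0 real) \<Rightarrow> ('v list \<Rightarrow>\<^sub>0 real)" where
  "concat_mult p q =
     (\<Sum>k\<in>Poly_Mapping.keys p. \<Sum>l\<in>Poly_Mapping.keys q.
        Poly_Mapping.single (k @ l) (Poly_Mapping.lookup p k * Poly_Mapping.lookup q l))"

text \<open>The product \<open>W\<^sup>\<otimes>\<^sup>i \<times> W\<^sup>\<otimes>\<^sup>j \<rightarrow> W\<^sup>\<otimes>\<^sup>(\<^sup>i\<^sup>+\<^sup>j\<^sup>)\<close> on cosets, with \<open>r = i + j\<close>.\<close>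

definition tensor_mult ::
  "(real, 'v, 'm) module_scheme \<Rightarrow> nat \<Rightarrow> 'v tensor \<Rightarrow> 'v tensor \<Rightarrow> 'v tensor" where
  "tensor_mult W r s t = (\<Union>p\<in>s. \<Union>q\<in>t. tensor_coset W r (concat_mult p q))"

definition tensor_algebra :: "(real, 'v, 'm) module_scheme \<Rightarrow> (real, nat \<Rightarrow> 'v tensor) module" where
  "tensor_algebra W =
     \<lparr>carrier = {t. (\<forall>r. t r \<in> carrier (tensor_power W r)) \<and>
                    finite {r. t r \<noteq> \<zero>\<^bsub>tensor_power W r\<^esub>}},
      mult = (\<lambda>s t r. finsum (tensor_power W r)
                        (\<lambda>i. tensor_mult W r (s i) (t (r - i))) {..r}),
      one = (\<lambda>r. if r = 0 then pure_tensor W [] else \<zero>\<^bsub>tensor_power W r\<^esub>),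
      zero = (\<lambda>r. \<zero>\<^bsub>tensor_power W r\<^esub>),
      add = (\<lambda>s t r. s r \<oplus>\<^bsub>tensor_power W r\<^esub> t r),
      smult = (\<lambda>c t r. c \<odot>\<^bsub>tensor_power W r\<^esub> t r)\<rparr>"

definition tensor_incl :: "(real, 'v, 'm) module_scheme \<Rightarrow> 'v \<Rightarrow> nat \<Rightarrow> 'v tensor" where
  "tensor_incl W v = (\<lambda>r. if r = 1 then pure_tensor W [v] else \<zero>\<^bsub>tensor_power W r\<^esub>)"

definition clifford_relators ::
  "(real, 'v, 'm) module_scheme \<Rightarrow> ('v \<Rightarrow> 'v \<Rightarrow> real) \<Rightarrow> (nat \<Rightarrow> 'v tensor) set" where
  "clifford_relators W q =
     (let T = tensor_algebra W; \<iota> = tensor_incl W in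
      {\<iota> v \<otimes>\<^bsub>T\<^esub> \<iota> w \<oplus>\<^bsub>T\<^esub> \<iota> w \<otimes>\<^bsub>T\<^esub> \<iota> v \<oplus>\<^bsub>T\<^esub> (4 * q v w) \<odot>\<^bsub>T\<^esub> \<one>\<^bsub>T\<^esub>
       | v w. v \<in> carrier W \<and> w \<in> carrier W})"

definition clifford_ideal ::
  "(real, 'v, 'm) module_scheme \<Rightarrow> ('v \<Rightarrow> 'v \<Rightarrow> real) \<Rightarrow> (nat \<Rightarrow> 'v tensor) set" where
  "clifford_ideal W q = Idl\<^bsub>tensor_algebra W\<^esub> (clifford_relators W q)"

definition clifford_algebra ::
  "(real, 'v, 'm) module_scheme \<Rightarrow> ('v \<Rightarrow> 'v \<Rightarrow> real) \<Rightarrow> (real, (nat \<Rightarrow> 'v tensor) set) module" where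
  "clifford_algebra W q = quot_alg (tensor_algebra W) (clifford_ideal W q)"

definition clifford_coset ::
  "(real, 'v, 'm) module_scheme \<Rightarrow> ('v \<Rightarrow> 'v \<Rightarrow> real) \<Rightarrow> (nat \<Rightarrow> 'v tensor) \<Rightarrow>
   (nat \<Rightarrow> 'v tensor) set" where
  "clifford_coset W q t = clifford_ideal W q +>\<^bsub>tensor_algebra W\<^esub> t"

section \<open>Diffeological vector pseudo-bundles\<close>

text \<open>The fibrewise operations are given as operations on the total space, used only for arguments
  in a common fibre.\<close>

record ('x, 'v) vbundle =
  base :: "'x dspace"
  total :: "'v dspace"
  proj :: "'v \<Rightarrow> 'x"
  vadd :: "'v \<Rightarrow> 'v \<Rightarrow> 'v"
  vscale :: "real \<Rightarrow> 'v \<Rightarrow> 'v"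
  vzero :: "'x \<Rightarrow> 'v"

definition fibre :: "('x, 'v) vbundle \<Rightarrow> 'x \<Rightarrow> (real, 'v) module" where
  "fibre B x =
     \<lparr>carrier = {v \<in> points (total B). proj B v = x}, mult = undefined, one = undefined,
      zero = vzero B x, add = vadd B, smult = vscale B\<rparr>"

definition pseudo_bundle :: "('x, 'v) vbundle \<Rightarrow> bool" where
  "pseudo_bundle B \<longleftrightarrow>
     diffeology (base B) \<and> diffeology (total B) \<and>
     smooth_map (total B) (base B) (proj B) \<and> proj B ` points (total B) = points (base B) \<and>
     (\<forall>x\<in>points (base B). Module.module real_alg (fibre B x)) \<and>
     smooth_map (sub_dspace (prod_dspace (total B) (total B)) {(v, w). proj B v = proj B w})
       (total B) (\<lambda>(v, w). vadd B v w) \<and>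
     smooth_map (prod_dspace real_dspace (total B)) (total B) (\<lambda>(a, v). vscale B a v) \<and>
     smooth_map (base B) (total B) (vzero B)"

definition finite_dim_pseudo_bundle :: "('x, 'v) vbundle \<Rightarrow> bool" where
  "finite_dim_pseudo_bundle B \<longleftrightarrow>
     pseudo_bundle B \<and> (\<forall>x\<in>points (base B). finite_dim (fibre B x))"

definition fibre_dspace :: "('x, 'v) vbundle \<Rightarrow> 'x \<Rightarrow> 'v dspace" where
  "fibre_dspace B x = sub_dspace (total B) (carrier (fibre B x))"

subsection \<open>Dual pseudo-bundle\<close>

definition smooth_dual :: "('x, 'v) vbundle \<Rightarrow> 'x \<Rightarrow> ('v \<Rightarrow> real) set" where
  "smooth_dual B x =
     {\<phi> \<in> extensional (carrier (fibre B x)).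
        linear_map (fibre B x) real_alg \<phi> \<and> smooth_map (fibre_dspace B x) real_dspace \<phi>}"

definition smooth_dual_space :: "('x, 'v) vbundle \<Rightarrow> 'x \<Rightarrow> (real, 'v \<Rightarrow> real) module" where
  "smooth_dual_space B x = functional_space (carrier (fibre B x)) (smooth_dual B x)"

text \<open>The points of a union over \<open>X\<close> of sets attached to the fibres carry their base point as
  first component. The following is the domain of \<open>(u, u') \<mapsto> p(u)(q(u'))\<close>.\<close>

definition same_base ::
  "('x, 'v) vbundle \<Rightarrow> nat \<Rightarrow> point set \<Rightarrow> (point \<Rightarrow> 'x \<times> 'f) \<Rightarrow>
   nat \<Rightarrow> point set \<Rightarrow> (point \<Rightarrow> 'v) \<Rightarrow> (point \<times> point) dspace" where
  "same_base B n U p m W q =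
     sub_dspace (prod_dspace (euclid_dspace n) (euclid_dspace m))
       {(u, w). u \<in> U \<and> w \<in> W \<and> fst (p u) = proj B (q w)}"

definition dual_bundle :: "('x, 'v) vbundle \<Rightarrow> ('x, 'x \<times> ('v \<Rightarrow> real)) vbundle" where
  "dual_bundle B =
     \<lparr>base = base B,
      total =
        \<lparr>points = (SIGMA x : points (base B). smooth_dual B x),
         plots = (\<lambda>n U p. openin (Euclidean_space n) U \<and>
           p ` U \<subseteq> (SIGMA x : points (base B). smooth_dual B x) \<and>
           (\<forall>m W q. plots (total B) m W q \<longrightarrow>
              smooth_map (same_base B n U p m W q) real_dspace (\<lambda>(u, w). snd (p u) (q w))))\<rparr>,
      proj = fst,
      vadd = (\<lambda>(x, \<phi>) (_, \<psi>). (x, \<phi> \<oplus>\<^bsub>smooth_dual_space B x\<^esub> \<psi>)),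
      vscale = (\<lambda>a (x, \<phi>). (x, a \<odot>\<^bsub>smooth_dual_space B x\<^esub> \<phi>)),
      vzero = (\<lambda>x. (x, \<zero>\<^bsub>smooth_dual_space B x\<^esub>))\<rparr>"

subsection \<open>Tensor powers and pseudo-metrics\<close>

text \<open>The case \<open>r = 0\<close> is \<open>X \<times> \<real>\<close> with the product diffeology. For \<open>r > 0\<close>, the map
  \<open>\<xi>\<close> is the plot of \<open>X\<close> covered and \<open>s i j\<close> is the \<open>j\<close>-th factor of the \<open>i\<close>-th summand.\<close>

definition tensor_power_dspace :: "('x, 'v) vbundle \<Rightarrow> nat \<Rightarrow> ('x \<times> 'v tensor) dspace" where
  "tensor_power_dspace B r =
     \<lparr>points = (SIGMA x : points (base B). carrier (tensor_power (fibre B x) r)),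
      plots =
       (if r = 0 then
         (\<lambda>n U p. plots (base B) n U (fst \<circ> p) \<and>
           (\<exists>a. smooth_real n U a \<and>
             (\<forall>u\<in>U. snd (p u) =
               a u \<odot>\<^bsub>tensor_power (fibre B (fst (p u))) 0\<^esub> pure_tensor (fibre B (fst (p u))) [])))
        else local_plot
         (\<lambda>n U p. \<exists>\<xi> k s. plots (base B) n U \<xi> \<and>
           (\<forall>i<k. \<forall>j<r. plots (total B) n U (s i j) \<and> (\<forall>u\<in>U. proj B (s i j u) = \<xi> u)) \<and>
           (\<forall>u\<in>U. p u = (\<xi> u,
              finsum (tensor_power (fibre B (\<xi> u)) r)
                (\<lambda>i. pure_tensor (fibre B (\<xi> u)) (map (\<lambda>j. s i j u) [0..<r]))
                {..<k::nat}))))\<rparr>"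

text \<open>An element of \<open>(\<pi>\<inverse>(x))\<^sup>* \<otimes> (\<pi>\<inverse>(x))\<^sup>*\<close> regarded as a bilinear form, by
  \<open>(\<phi> \<otimes> \<psi>)(v, w) = \<phi>(v) \<psi>(w)\<close>; the value does not depend on the representative \<open>p\<close>.\<close>

definition tensor_form :: "('x \<times> ('v \<Rightarrow> real)) tensor \<Rightarrow> 'v \<Rightarrow> 'v \<Rightarrow> real" where
  "tensor_form t v w =
     the_elem ((\<lambda>p. \<Sum>l\<in>Poly_Mapping.keys p.
                  Poly_Mapping.lookup p l * snd (l ! 0) v * snd (l ! 1) w) ` t)"

type_synonym ('x, 'v) metric = "'x \<Rightarrow> 'x \<times> ('x \<times> ('v \<Rightarrow> real)) tensor"

definition metric_form :: "('x, 'v) metric \<Rightarrow> 'x \<Rightarrow> 'v \<Rightarrow> 'v \<Rightarrow> real" where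
  "metric_form g x = tensor_form (snd (g x))"

definition pseudo_metric :: "('x, 'v) vbundle \<Rightarrow> ('x, 'v) metric \<Rightarrow> bool" where
  "pseudo_metric B g \<longleftrightarrow>
     smooth_map (base B) (tensor_power_dspace (dual_bundle B) 2) g \<and>
     (\<forall>x\<in>points (base B).
        fst (g x) = x \<and>
        (\<forall>v\<in>carrier (fibre B x). \<forall>w\<in>carrier (fibre B x).
           metric_form g x v w = metric_form g x w v) \<and>
        (\<forall>v\<in>carrier (fibre B x). 0 \<le> metric_form g x v v) \<and>
        form_rank (fibre B x) (metric_form g x) = vdim (smooth_dual_space B x))"

subsection \<open>Clifford algebras and Clifford modules\<close>

definition tensor_algebra_dspace :: "('x, 'v) vbundle \<Rightarrow> ('x \<times> (nat \<Rightarrow> 'v tensor)) dspace" where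
  "tensor_algebra_dspace B =
     \<lparr>points = (SIGMA x : points (base B). carrier (tensor_algebra (fibre B x))),
      plots = local_plot (\<lambda>n U p.
        (\<forall>r. plots (tensor_power_dspace B r) n U (\<lambda>u. (fst (p u), snd (p u) r))) \<and>
        (\<exists>N. \<forall>u\<in>U. \<forall>r>N. snd (p u) r = \<zero>\<^bsub>tensor_power (fibre B (fst (p u))) r\<^esub>))\<rparr>"

definition clifford_fibre ::
  "('x, 'v) vbundle \<Rightarrow> ('x, 'v) metric \<Rightarrow> 'x \<Rightarrow> (real, (nat \<Rightarrow> 'v tensor) set) module" where
  "clifford_fibre B g x = clifford_algebra (fibre B x) (metric_form g x)"

definition clifford_dspace ::
  "('x, 'v) vbundle \<Rightarrow> ('x, 'v) metric \<Rightarrow> ('x \<times> (nat \<Rightarrow> 'v tensor) set) dspace" where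
  "clifford_dspace B g =
     quot_dspace (tensor_algebra_dspace B)
       (\<lambda>(x, t). (x, clifford_coset (fibre B x) (metric_form g x) t))"

definition clifford_incl ::
  "('x, 'v) vbundle \<Rightarrow> ('x, 'v) metric \<Rightarrow> 'x \<Rightarrow> 'v \<Rightarrow> (nat \<Rightarrow> 'v tensor) set" where
  "clifford_incl B g x v =
     clifford_coset (fibre B x) (metric_form g x) (tensor_incl (fibre B x) v)"

definition smooth_end :: "('x, 'e) vbundle \<Rightarrow> 'x \<Rightarrow> ('e \<Rightarrow> 'e) set" where
  "smooth_end E x =
     {A \<in> extensional (carrier (fibre E x)).
        linear_map (fibre E x) (fibre E x) A \<and>
        smooth_map (fibre_dspace E x) (fibre_dspace E x) A}"

definition end_algebra :: "('x, 'e) vbundle \<Rightarrow> 'x \<Rightarrow> (real, 'e \<Rightarrow> 'e) module" where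
  "end_algebra E x =
     \<lparr>carrier = smooth_end E x,
      mult = (\<lambda>A A'. \<lambda>e\<in>carrier (fibre E x). A (A' e)),
      one = (\<lambda>e\<in>carrier (fibre E x). e),
      zero = (\<lambda>e\<in>carrier (fibre E x). vzero E x),
      add = (\<lambda>A A'. \<lambda>e\<in>carrier (fibre E x). vadd E (A e) (A' e)),
      smult = (\<lambda>a A. \<lambda>e\<in>carrier (fibre E x). vscale E a (A e))\<rparr>"

definition end_dspace :: "('x, 'e) vbundle \<Rightarrow> ('x \<times> ('e \<Rightarrow> 'e)) dspace" where
  "end_dspace E =
     generated_dspace (SIGMA x : points (base E). smooth_end E x)
       (\<lambda>n U p. openin (Euclidean_space n) U \<and>
          p ` U \<subseteq> (SIGMA x : points (base E). smooth_end E x) \<and>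
          (\<forall>m W q. plots (total E) m W q \<longrightarrow>
             smooth_map (same_base E n U p m W q) (total E) (\<lambda>(u, w). snd (p u) (q w))))"

definition clifford_module ::
  "('x, 'v) vbundle \<Rightarrow> ('x, 'v) metric \<Rightarrow> ('x, 'e) vbundle \<Rightarrow>
   ('x \<times> (nat \<Rightarrow> 'v tensor) set \<Rightarrow> 'x \<times> ('e \<Rightarrow> 'e)) \<Rightarrow> bool" where
  "clifford_module V g E c \<longleftrightarrow>
     finite_dim_pseudo_bundle E \<and> base E = base V \<and>
     smooth_map (clifford_dspace V g) (end_dspace E) c \<and>
     (\<forall>x\<in>points (base V).
        (\<forall>a\<in>carrier (clifford_fibre V g x). fst (c (x, a)) = x) \<and>
        (\<lambda>a. snd (c (x, a))) \<in> alg_hom (clifford_fibre V g x) (end_algebra E x))"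

section \<open>Gluing\<close>

definition glue_step :: "'a set \<Rightarrow> ('a \<Rightarrow> 'b) \<Rightarrow> 'a + 'b \<Rightarrow> 'a + 'b \<Rightarrow> bool" where
  "glue_step Y f z z' \<longleftrightarrow> (\<exists>y\<in>Y. z = Inl y \<and> z' = Inr (f y))"

definition glue_class :: "'a set \<Rightarrow> ('a \<Rightarrow> 'b) \<Rightarrow> 'a + 'b \<Rightarrow> ('a + 'b) set" where
  "glue_class Y f z = {z'. equivclp (glue_step Y f) z z'}"

definition glue_dspace :: "'a dspace \<Rightarrow> 'a set \<Rightarrow> ('a \<Rightarrow> 'b) \<Rightarrow> 'b dspace \<Rightarrow> ('a + 'b) set dspace" where
  "glue_dspace A Y f B = quot_dspace (sum_dspace A B) (glue_class Y f)"

text \<open>\<open>glue_inj1\<close> is the injection \<open>j\<^sub>1\<close> when restricted to \<open>points A - Y\<close>.\<close>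

definition glue_inj1 :: "'a set \<Rightarrow> ('a \<Rightarrow> 'b) \<Rightarrow> 'a \<Rightarrow> ('a + 'b) set" where
  "glue_inj1 Y f a = glue_class Y f (Inl a)"

definition glue_inj2 :: "'a set \<Rightarrow> ('a \<Rightarrow> 'b) \<Rightarrow> 'b \<Rightarrow> ('a + 'b) set" where
  "glue_inj2 Y f b = glue_class Y f (Inr b)"

text \<open>The map between glued spaces induced by \<open>\<pi>\<^sub>1\<close> and \<open>\<pi>\<^sub>2\<close>; \<open>Y, f\<close> are the gluing data of the
  target.\<close>

definition glue_proj ::
  "'x set \<Rightarrow> ('x \<Rightarrow> 'y) \<Rightarrow> ('a \<Rightarrow> 'x) \<Rightarrow> ('b \<Rightarrow> 'y) \<Rightarrow> ('a + 'b) set \<Rightarrow> ('x + 'y) set" where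
  "glue_proj Y f \<pi>1 \<pi>2 C = the_elem ((\<lambda>z. glue_class Y f (map_sum \<pi>1 \<pi>2 z)) ` C)"

definition over :: "'a dspace \<Rightarrow> ('a \<Rightarrow> 'x) \<Rightarrow> 'x set \<Rightarrow> 'a set" where
  "over A \<pi> Y = {v \<in> points A. \<pi> v \<in> Y}"

definition bundle_gluing ::
  "('x, 'v) vbundle \<Rightarrow> ('y, 'w) vbundle \<Rightarrow> 'x set \<Rightarrow> ('x \<Rightarrow> 'y) \<Rightarrow> ('v \<Rightarrow> 'w) \<Rightarrow> bool" where
  "bundle_gluing B1 B2 Y f ft \<longleftrightarrow>
     Y \<subseteq> points (base B1) \<and> f ` Y \<subseteq> points (base B2) \<and>
     diffeomorphism (sub_dspace (base B1) Y) (sub_dspace (base B2) (f ` Y)) f \<and>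
     smooth_map (sub_dspace (total B1) (over (total B1) (proj B1) Y))
       (sub_dspace (total B2) (over (total B2) (proj B2) (f ` Y))) ft \<and>
     (\<forall>v\<in>over (total B1) (proj B1) Y. proj B2 (ft v) = f (proj B1 v)) \<and>
     (\<forall>y\<in>Y. linear_map (fibre B1 y) (fibre B2 (f y)) ft)"

definition glue_bundle ::
  "('x, 'v) vbundle \<Rightarrow> 'x set \<Rightarrow> ('x \<Rightarrow> 'y) \<Rightarrow> ('v \<Rightarrow> 'w) \<Rightarrow> ('y, 'w) vbundle \<Rightarrow>
   (('x + 'y) set, ('v + 'w) set) vbundle" where
  "glue_bundle B1 Y f ft B2 =
     (let S = over (total B1) (proj B1) Y;
          P1 = points (total B1) - S; P2 = points (total B2);
          j1 = glue_inj1 S ft; j2 = glue_inj2 S ft;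
          k1 = inv_into P1 j1; k2 = inv_into P2 j2
      in \<lparr>base = glue_dspace (base B1) Y f (base B2),
          total = glue_dspace (total B1) S ft (total B2),
          proj = glue_proj Y f (proj B1) (proj B2),
          vadd = (\<lambda>C D. if C \<in> j1 ` P1 then j1 (vadd B1 (k1 C) (k1 D))
                        else j2 (vadd B2 (k2 C) (k2 D))),
          vscale = (\<lambda>a C. if C \<in> j1 ` P1 then j1 (vscale B1 a (k1 C))
                          else j2 (vscale B2 a (k2 C))),
          vzero = (\<lambda>X. if X \<in> glue_inj1 Y f ` (points (base B1) - Y)
                       then j1 (vzero B1 (inv_into (points (base B1) - Y) (glue_inj1 Y f) X))
                       else j2 (vzero B2 (inv_into (points (base B2)) (glue_inj2 Y f) X)))\<rparr>)"

subsection \<open>Compatible data and the induced Clifford action\<close>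

definition compatible_metrics ::
  "('x, 'v) vbundle \<Rightarrow> 'x set \<Rightarrow> ('x \<Rightarrow> 'y) \<Rightarrow> ('v \<Rightarrow> 'w) \<Rightarrow>
   ('x, 'v) metric \<Rightarrow> ('y, 'w) metric \<Rightarrow> bool" where
  "compatible_metrics V1 Y f ft g1 g2 \<longleftrightarrow>
     (\<forall>y\<in>Y. \<forall>v\<in>carrier (fibre V1 y). \<forall>w\<in>carrier (fibre V1 y).
        metric_form g1 y v w = metric_form g2 (f y) (ft v) (ft w))"

text \<open>The map \<open>F\<^sup>C\<^sup>l\<close> between Clifford algebras, meaningful over \<open>Y\<close> when the metrics are
  compatible.\<close>

definition clifford_map ::
  "('x, 'v) vbundle \<Rightarrow> ('x, 'v) metric \<Rightarrow> ('y, 'w) vbundle \<Rightarrow> ('y, 'w) metric \<Rightarrow>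
   ('x \<Rightarrow> 'y) \<Rightarrow> ('v \<Rightarrow> 'w) \<Rightarrow>
   'x \<times> (nat \<Rightarrow> 'v tensor) set \<Rightarrow> 'y \<times> (nat \<Rightarrow> 'w tensor) set" where
  "clifford_map V1 g1 V2 g2 f ft = (\<lambda>(y, a). (f y,
     (THE h. h \<in> extensional (carrier (clifford_fibre V1 g1 y)) \<and>
             h \<in> alg_hom (clifford_fibre V1 g1 y) (clifford_fibre V2 g2 (f y)) \<and>
             (\<forall>v\<in>carrier (fibre V1 y). h (clifford_incl V1 g1 y v) = clifford_incl V2 g2 (f y) (ft v)))
       a))"

text \<open>\<open>C1, C2\<close> are the Clifford algebra pseudo-bundles (projection \<^const>\<open>fst\<close>), glued along \<open>F\<close>;
  \<open>E1, E2\<close> are glued along \<open>ft'\<close>. The arguments \<open>e\<close> of the endomorphism \<open>c(v)\<close> range over the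
  fibre of the glued bundle at the point over which \<open>v\<close> lies.\<close>

definition induced_action ::
  "('x \<times> 'c) dspace \<Rightarrow> ('x, 'e) vbundle \<Rightarrow> ('x \<times> 'c \<Rightarrow> 'x \<times> ('e \<Rightarrow> 'e)) \<Rightarrow>
   ('y \<times> 'd) dspace \<Rightarrow> ('y, 'h) vbundle \<Rightarrow> ('y \<times> 'd \<Rightarrow> 'y \<times> ('h \<Rightarrow> 'h)) \<Rightarrow>
   'x set \<Rightarrow> ('x \<Rightarrow> 'y) \<Rightarrow> ('x \<times> 'c \<Rightarrow> 'y \<times> 'd) \<Rightarrow> ('e \<Rightarrow> 'h) \<Rightarrow>
   ('x \<times> 'c + 'y \<times> 'd) set \<Rightarrow> ('x + 'y) set \<times> (('e + 'h) set \<Rightarrow> ('e + 'h) set)" where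
  "induced_action C1 E1 c1 C2 E2 c2 Y f F ft' v =
     (let SC = over C1 fst Y; SE = over (total E1) (proj E1) Y;
          PC1 = points C1 - SC; PE1 = points (total E1) - SE;
          PC2 = points C2; PE2 = points (total E2);
          j1C = glue_inj1 SC F; j2C = glue_inj2 SC F;
          j1E = glue_inj1 SE ft'; j2E = glue_inj2 SE ft';
          x = glue_proj Y f fst fst v
      in (x, \<lambda>e\<in>carrier (fibre (glue_bundle E1 Y f ft' E2) x).
             if v \<in> j1C ` PC1
             then j1E (snd (c1 (inv_into PC1 j1C v)) (inv_into PE1 j1E e))
             else j2E (snd (c2 (inv_into PC2 j2C v)) (inv_into PE2 j2E e))))"

end

theory Submission
  imports Defs
begin

text \<open>The main point is that evaluation is smooth: if \<open>P\<close> is a plot of endomorphisms and \<open>e\<close> a plot of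
  \<open>E\<close> over the same points, then \<open>u \<mapsto> P(u)(e(u))\<close> is a plot of \<open>E\<close> (\<open>end_dspace_plot_eval\<close>). This
  holds because the maps generating the functional diffeology already form a diffeology
  (\<open>diffeology_end_generator\<close>). The only analysis behind it is that smooth maps between open subsets
  of Euclidean spaces are closed under composition, i.e. the chain rule (\<open>C_k_compose\<close>).

  A plot of a glued space is locally \<open>j\<^sub>1 \<circ> q\<close> or \<open>j\<^sub>2 \<circ> q\<close> with \<open>q\<close> a plot of one of the pieces. To see
  that the induced action \<open>c\<close> is smooth, let \<open>P\<close> be a plot of the glued Clifford bundle and \<open>e\<close> one
  of the glued module bundle over the same points (\<open>eval_chart\<close>). If both come from the same piece,
  \<open>c(P)(e)\<close> is the image of \<open>c\<^sub>i(q)(r)\<close>; for the first piece this is where compatibility of the two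
  actions enters. If they come from different pieces, both lie over the glued part \<open>Y\<close> of the base,
  and the one from the first piece can be moved to the second along the gluing map. Each
  \<open>c(v)\<close> is a smooth endomorphism because plots of a glued fibre lift in the same way to the piece
  that \<open>v\<close> comes from (\<open>smooth_end_j1\<close>, \<open>smooth_end_j2\<close>).

  Moving a plot of \<open>C\<ell>(V\<^sub>1, g\<^sub>1)\<close> to the second piece requires that the map \<open>F\<close> between the Clifford
  bundles be smooth over \<open>Y\<close>. A form-preserving linear map \<open>\<phi>\<close> induces a homomorphism of tensor
  algebras which respects the Clifford ideals, hence a homomorphism of Clifford algebras
  (\<open>clifford_extension\<close>), and this is the only one extending \<open>\<phi>\<close> (\<open>alg_hom_clifford_unique\<close>). So on
  classes of tensors \<open>F\<close> acts by applying the gluing map to each tensor factor, and thus preserves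
  the plots, which locally are classes of finite sums of tensor products of plots
  (\<open>tensor_chart_map\<close>).\<close>

section \<open>Smooth maps between open subsets of Euclidean spaces\<close>

abbreviation open_dom :: "nat \<Rightarrow> point set \<Rightarrow> bool" where
  "open_dom n \<equiv> openin (Euclidean_space n)"

abbreviation continuous_dom :: "nat \<Rightarrow> point set \<Rightarrow> (point \<Rightarrow> real) \<Rightarrow> bool" where
  "continuous_dom n U \<equiv> continuous_map (subtopology (Euclidean_space n) U) euclideanreal"

text \<open>Open subsets of \<open>\<real>\<^sup>n\<close> contain coordinate boxes around their points; continuity and partial
  derivatives are handled through such boxes, since the topology is that of an infinite product.\<close>

lemma Euclidean_space_box:
  assumes "open_dom n U" "x \<in> U"
  obtains \<delta> where "\<delta> > 0" "\<And>y. y \<in> topspace (Euclidean_space n) \<Longrightarrow> (\<And>i. i < n \<Longrightarrow> \<bar>y i - x i\<bar> < \<delta>) \<Longrightarrow> y \<in> U"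
proof -
  obtain T where T: "openin (powertop_real UNIV) T" "U = T \<inter> topspace (Euclidean_space n)"
    using assms(1) unfolding Euclidean_space_def by (auto simp: openin_subtopology)
  then obtain V where V: "x \<in> PiE UNIV V" "\<And>i. open (V i)" "PiE UNIV V \<subseteq> T"
    using product_topology_open_contains_basis[OF T(1), of x] assms(2) by auto
  have "\<forall>i. \<exists>e>0. \<forall>t. \<bar>t - x i\<bar> < e \<longrightarrow> t \<in> V i"
    using V(1,2) unfolding open_dist by (simp add: PiE_iff dist_real_def)
  then obtain e where e: "\<And>i. e i > 0" "\<And>i t. \<bar>t - x i\<bar> < e i \<Longrightarrow> t \<in> V i" by metis
  define \<delta> where "\<delta> = Min (insert 1 (e ` {..<n}))"
  have "\<delta> > 0" unfolding \<delta>_def using e(1) by (subst Min_gr_iff) auto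
  moreover have "y \<in> U" if y: "y \<in> topspace (Euclidean_space n)" "\<And>i. i < n \<Longrightarrow> \<bar>y i - x i\<bar> < \<delta>" for y
  proof -
    have "y i \<in> V i" for i
    proof (cases "i < n")
      case True
      then have "\<delta> \<le> e i" unfolding \<delta>_def by (intro Min_le) auto
      then show ?thesis using e(2) y(2)[OF True] by force
    next
      case False
      moreover have "x \<in> topspace (Euclidean_space n)" using assms T by auto
      ultimately have "y i = x i" using y(1) by (simp add: topspace_Euclidean_space)
      then show ?thesis using e by simp
    qed
    then show ?thesis using V(3) T(2) y(1) by auto
  qed
  ultimately show thesis using that by blast
qed

lemma continuous_map_box:
  assumes U: "open_dom n U" and x: "x \<in> U"
    and f: "continuous_dom n U f" and "e > 0"
  obtains \<delta> where "\<delta> > 0" "\<And>y. y \<in> topspace (Euclidean_space n) \<Longrightarrow> (\<And>i. i < n \<Longrightarrow> \<bar>y i - x i\<bar> < \<delta>)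
    \<Longrightarrow> y \<in> U \<and> \<bar>f y - f x\<bar> < e"
proof -
  let ?S = "subtopology (Euclidean_space n) U"
  have "openin ?S {y \<in> topspace ?S. f y \<in> ball (f x) e}"
    by (rule openin_continuous_map_preimage[OF f]) (simp flip: open_openin)
  then have "open_dom n {y \<in> topspace ?S. f y \<in> ball (f x) e}"
    using U by (rule openin_trans_full)
  moreover have "x \<in> {y \<in> topspace ?S. f y \<in> ball (f x) e}"
    using x U assms(4) openin_subset[OF U] by auto
  ultimately obtain \<delta> where "\<delta> > 0" "\<And>y. y \<in> topspace (Euclidean_space n) \<Longrightarrow> (\<And>i. i < n \<Longrightarrow> \<bar>y i - x i\<bar> < \<delta>)
      \<Longrightarrow> y \<in> {y \<in> topspace ?S. f y \<in> ball (f x) e}"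
    by (rule Euclidean_space_box) blast
  then show thesis
    by (intro that[of \<delta>]) (auto simp: dist_real_def abs_minus_commute)
qed

text \<open>The chain rule along a curve \<open>\<gamma>\<close>, for a function with continuous partial derivatives: passing from
  \<open>\<gamma> t0\<close> to \<open>\<gamma> t\<close> by changing one coordinate at a time, each step is controlled by the mean value
  theorem.\<close>

lemma has_derivative_along_curve:
  assumes U: "open_dom n U" and x: "\<gamma> t0 \<in> U"
    and diff: "\<And>j y. j < n \<Longrightarrow> y \<in> U \<Longrightarrow> (\<lambda>t. f (y(j := t))) differentiable (at (y j))"
    and cont: "\<And>j. j < n \<Longrightarrow> continuous_dom n U (partial_deriv j f)"
    and \<gamma>: "\<forall>\<^sub>F t in nhds t0. \<gamma> t \<in> topspace (Euclidean_space n)"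
    and d: "\<And>j. j < n \<Longrightarrow> ((\<lambda>t. \<gamma> t j) has_real_derivative d j) (at t0)"
  shows "((\<lambda>t. f (\<gamma> t)) has_real_derivative (\<Sum>j<n. partial_deriv j f (\<gamma> t0) * d j)) (at t0)"
proof -
  define x where "x = \<gamma> t0"
  \<comment> \<open>the intermediate points: the first \<open>k\<close> coordinates are those of \<open>\<gamma> t\<close>, the others those of \<open>\<gamma> t0\<close>\<close>
  define z where "z k t = (\<lambda>i. if i < k then \<gamma> t i else x i)" for k t
  have x_top: "x \<in> topspace (Euclidean_space n)" using x openin_subset[OF U] by (auto simp: x_def)
  have x_out: "x i = 0" if "i \<ge> n" for i using x_top that by (simp add: topspace_Euclidean_space)
  have z_top: "z k t \<in> topspace (Euclidean_space n)" if "k \<le> n" for k t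
    using x_out that by (auto simp: z_def topspace_Euclidean_space)
  have z0: "z k t0 = x" for k by (auto simp: z_def x_def)
  have zstep: "z (Suc k) t = (z k t)(k := \<gamma> t k)" for k t by (auto simp: z_def fun_eq_iff)
  have zk: "z k t k = x k" for k t by (simp add: z_def)
  have \<gamma>_near: "\<forall>\<^sub>F t in at t0. \<forall>i<n. \<bar>\<gamma> t i - x i\<bar> < \<delta>" if "\<delta> > 0" for \<delta>
  proof -
    have "\<forall>\<^sub>F t in at t0. \<bar>\<gamma> t i - x i\<bar> < \<delta>" if "i < n" for i
    proof -
      have "((\<lambda>t. \<gamma> t i) \<longlongrightarrow> x i) (at t0)"
        using DERIV_isCont[OF d[OF that]] by (simp add: isCont_def x_def)
      then show ?thesis using \<open>\<delta> > 0\<close> by (auto simp: tendsto_iff dist_real_def)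
    qed
    then have "\<forall>\<^sub>F t in at t0. \<forall>i\<in>{..<n}. \<bar>\<gamma> t i - x i\<bar> < \<delta>"
      by (intro eventually_ball_finite) auto
    then show ?thesis by (simp add: Ball_def)
  qed
  have step: "((\<lambda>t. f (z (Suc k) t) - f (z k t)) has_real_derivative partial_deriv k f x * d k) (at t0)"
    if k: "k < n" for k
  proof -
    \<comment> \<open>the difference quotient of \<open>f\<close> in the \<open>k\<close>-th coordinate, with its limit as default where it is undefined\<close>
    define S where "S t = (if \<gamma> t k = x k then partial_deriv k f x
      else (f (z (Suc k) t) - f (z k t)) / (\<gamma> t k - x k))" for t
    have quot: "(f (z (Suc k) t) - f (z k t) - (f (z (Suc k) t0) - f (z k t0))) / (t - t0)
        = S t * ((\<gamma> t k - \<gamma> t0 k) / (t - t0))" for t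
    proof (cases "\<gamma> t k = x k")
      case True
      then have "z (Suc k) t = z k t" using zk[of k t] by (metis zstep fun_upd_triv)
      then show ?thesis using True by (simp add: z0 x_def)
    qed (simp add: S_def z0 flip: x_def)
    have "(S \<longlongrightarrow> partial_deriv k f x) (at t0)"
    proof (rule tendstoI)
      fix e :: real assume "e > 0"
      obtain \<delta> where \<delta>: "\<delta> > 0" "\<And>y. y \<in> topspace (Euclidean_space n) \<Longrightarrow> (\<And>i. i < n \<Longrightarrow> \<bar>y i - x i\<bar> < \<delta>)
          \<Longrightarrow> y \<in> U \<and> \<bar>partial_deriv k f y - partial_deriv k f x\<bar> < e"
        using continuous_map_box[OF U x[folded x_def] cont[OF k] \<open>e > 0\<close>] by blast
      have "dist (S t) (partial_deriv k f x) < e" if t: "\<forall>i<n. \<bar>\<gamma> t i - x i\<bar> < \<delta>" for t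
      proof (cases "\<gamma> t k = x k")
        case True
        then show ?thesis using \<open>e > 0\<close> by (simp add: S_def)
      next
        case False
        have seg: "(z k t)(k := s) \<in> U \<and> \<bar>partial_deriv k f ((z k t)(k := s)) - partial_deriv k f x\<bar> < e"
          if s: "\<bar>s - x k\<bar> \<le> \<bar>\<gamma> t k - x k\<bar>" for s
        proof (rule \<delta>(2))
          show "(z k t)(k := s) \<in> topspace (Euclidean_space n)"
            using z_top[of k t] k by (auto simp: topspace_Euclidean_space)
          show "\<bar>((z k t)(k := s)) i - x i\<bar> < \<delta>" if "i < n" for i
            using t that s k \<delta>(1) by (fastforce simp: z_def)
        qed
        have der: "((\<lambda>s. f ((z k t)(k := s))) has_real_derivative partial_deriv k f ((z k t)(k := s))) (at s)"
          if s: "\<bar>s - x k\<bar> \<le> \<bar>\<gamma> t k - x k\<bar>" for s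
          using diff[OF k conjunct1[OF seg[OF s]]]
          by (simp add: partial_deriv_def DERIV_deriv_iff_real_differentiable)
        define a where "a = min (x k) (\<gamma> t k)"
        define b where "b = max (x k) (\<gamma> t k)"
        have "a < b" using False by (auto simp: a_def b_def)
        moreover have "\<bar>s - x k\<bar> \<le> \<bar>\<gamma> t k - x k\<bar>" if "a \<le> s" "s \<le> b" for s
          using that by (auto simp: a_def b_def)
        ultimately obtain s where s: "\<bar>s - x k\<bar> \<le> \<bar>\<gamma> t k - x k\<bar>"
          "f ((z k t)(k := b)) - f ((z k t)(k := a)) = (b - a) * partial_deriv k f ((z k t)(k := s))"
          using MVT2[of a b "\<lambda>s. f ((z k t)(k := s))" "\<lambda>s. partial_deriv k f ((z k t)(k := s))"] der
          by (metis less_imp_le)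
        have "f (z (Suc k) t) - f (z k t) = (\<gamma> t k - x k) * partial_deriv k f ((z k t)(k := s))"
        proof -
          have "z k t = (z k t)(k := x k)" using zk[of k t] by (metis fun_upd_triv)
          then show ?thesis
            using s(2) unfolding zstep a_def b_def
            by (cases "x k \<le> \<gamma> t k") (simp_all add: min_def max_def algebra_simps)
        qed
        then have "S t = partial_deriv k f ((z k t)(k := s))" using False by (simp add: S_def)
        then show ?thesis using seg[OF s(1)] by (simp add: dist_real_def)
      qed
      then show "\<forall>\<^sub>F t in at t0. dist (S t) (partial_deriv k f x) < e"
        using \<gamma>_near[OF \<delta>(1)] by (rule eventually_mono[rotated])
    qed
    moreover have "((\<lambda>t. (\<gamma> t k - \<gamma> t0 k) / (t - t0)) \<longlongrightarrow> d k) (at t0)"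
      using d[OF k] by (simp add: has_field_derivative_iff)
    ultimately show ?thesis
      unfolding has_field_derivative_iff quot by (rule tendsto_mult)
  qed
  have "((\<lambda>t. f x + (\<Sum>k<n. f (z (Suc k) t) - f (z k t))) has_real_derivative
      (\<Sum>k<n. partial_deriv k f x * d k)) (at t0)"
    by (rule DERIV_cong[OF DERIV_add[OF DERIV_const DERIV_sum]]) (use step in auto)
  moreover have "f x + (\<Sum>k<n. f (z (Suc k) t) - f (z k t)) = f (z n t)" for t
    using sum_lessThan_telescope[of "\<lambda>k. f (z k t)" n] by (simp add: z_def)
  ultimately have "((\<lambda>t. f (z n t)) has_real_derivative (\<Sum>k<n. partial_deriv k f x * d k)) (at t0)"
    by simp
  moreover have "\<forall>\<^sub>F t in nhds t0. f (z n t) = f (\<gamma> t)"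
    using \<gamma>
  proof (rule eventually_mono)
    fix t assume "\<gamma> t \<in> topspace (Euclidean_space n)"
    then have "z n t = \<gamma> t" using x_out by (auto simp: z_def topspace_Euclidean_space fun_eq_iff)
    then show "f (z n t) = f (\<gamma> t)" by simp
  qed
  ultimately show ?thesis
    by (subst (asm) DERIV_cong_ev[OF refl _ refl]) (simp_all add: x_def)
qed

subsection \<open>Calculus of the classes \<open>C_k\<close>\<close>

lemma eventually_fun_upd_in:
  assumes "open_dom n U" "x \<in> U" "i < n"
  shows "\<forall>\<^sub>F t in nhds (x i). x(i := t) \<in> U"
proof -
  obtain \<delta> where \<delta>: "\<delta> > 0" "\<And>y. y \<in> topspace (Euclidean_space n) \<Longrightarrow> (\<And>i. i < n \<Longrightarrow> \<bar>y i - x i\<bar> < \<delta>) \<Longrightarrow> y \<in> U"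
    using Euclidean_space_box[OF assms(1,2)] by blast
  have "x \<in> topspace (Euclidean_space n)" using assms openin_subset by blast
  then have "x(i := t) \<in> U" if "\<bar>t - x i\<bar> < \<delta>" for t
    using that \<delta>(1) assms(3) by (intro \<delta>(2)) (auto simp: topspace_Euclidean_space)
  then show ?thesis
    unfolding eventually_nhds_metric using \<delta>(1) by (auto simp: dist_real_def)
qed

lemma partial_deriv_cong:
  assumes "open_dom n U" "i < n" "\<And>x. x \<in> U \<Longrightarrow> f x = g x" "x \<in> U"
  shows "partial_deriv i f x = partial_deriv i g x"
    and "(\<lambda>t. f (x(i := t))) differentiable (at (x i)) \<longleftrightarrow> (\<lambda>t. g (x(i := t))) differentiable (at (x i))"
proof -
  have ev: "\<forall>\<^sub>F t in nhds (x i). f (x(i := t)) = g (x(i := t))"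
    using eventually_fun_upd_in[OF assms(1,4,2)] by (rule eventually_mono) (rule assms(3))
  show "partial_deriv i f x = partial_deriv i g x"
    unfolding partial_deriv_def by (rule deriv_cong_ev[OF ev refl])
  show "(\<lambda>t. f (x(i := t))) differentiable (at (x i)) \<longleftrightarrow> (\<lambda>t. g (x(i := t))) differentiable (at (x i))"
    using DERIV_cong_ev[OF refl ev refl] unfolding real_differentiable_def by simp
qed

lemma C_k_cong:
  assumes "open_dom n U" "\<And>x. x \<in> U \<Longrightarrow> f x = g x"
  shows "C_k k n U f \<longleftrightarrow> C_k k n U g"
  using assms(2)
proof (induction k arbitrary: f g)
  case 0
  have "topspace (subtopology (Euclidean_space n) U) \<subseteq> U" by auto
  with 0 show ?case
    by (auto elim!: continuous_map_eq)
next
  case (Suc k)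
  have "continuous_dom n U f
    \<longleftrightarrow> continuous_dom n U g"
    by (rule iffI; erule continuous_map_eq) (auto simp: Suc.prems)
  moreover have "C_k k n U (partial_deriv i f) \<longleftrightarrow> C_k k n U (partial_deriv i g)" if "i < n" for i
    by (rule Suc.IH) (rule partial_deriv_cong(1)[OF assms(1) that Suc.prems])
  moreover have "(\<lambda>t. f (x(i := t))) differentiable (at (x i)) \<longleftrightarrow> (\<lambda>t. g (x(i := t))) differentiable (at (x i))"
    if "i < n" "x \<in> U" for i x
    by (rule partial_deriv_cong(2)[OF assms(1) that(1) Suc.prems that(2)])
  ultimately show ?case unfolding C_k.simps by blast
qed

lemma C_k_continuous: "C_k k n U f \<Longrightarrow> continuous_dom n U f"
  by (cases k) (simp_all only: C_k.simps)

lemma C_k_Suc_imp: "C_k (Suc k) n U f \<Longrightarrow> C_k k n U f"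
proof (induction k arbitrary: f)
  case (Suc k)
  note f = Suc.prems[unfolded C_k.simps(2)[of "Suc k"]]
  have "C_k k n U (partial_deriv i f)" if "i < n" for i
    using f that by (intro Suc.IH) blast
  with f show ?case unfolding C_k.simps(2)[of k] by blast
qed (simp only: C_k.simps)

lemma C_k_subset:
  assumes "C_k k n U f" "W \<subseteq> U" shows "C_k k n W f"
  using assms(1)
proof (induction k arbitrary: f)
  case 0
  then show ?case using assms(2) by (simp add: continuous_map_from_subtopology_mono)
next
  case (Suc k)
  then show ?case using assms(2)
    by (auto simp: continuous_map_from_subtopology_mono)
qed

lemma C_k_const: "C_k k n U (\<lambda>_. c)"
proof (induction k arbitrary: c)
  case (Suc k)
  have "partial_deriv i (\<lambda>_. c) = (\<lambda>_. 0)" for i by (simp add: partial_deriv_def fun_eq_iff)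
  then show ?case using Suc by simp
qed simp

lemma C_k_SucI:
  assumes U: "open_dom n U"
    and cont: "continuous_dom n U f"
    and der: "\<And>i x. i < n \<Longrightarrow> x \<in> U \<Longrightarrow> ((\<lambda>t. f (x(i := t))) has_real_derivative f' i x) (at (x i))"
    and C: "\<And>i. i < n \<Longrightarrow> C_k k n U (f' i)"
  shows "C_k (Suc k) n U f"
proof -
  have "C_k k n U (partial_deriv i f)" if "i < n" for i
  proof -
    have "partial_deriv i f x = f' i x" if "x \<in> U" for x
      unfolding partial_deriv_def by (rule DERIV_imp_deriv[OF der[OF \<open>i < n\<close> that]])
    then show ?thesis using C_k_cong[OF U, of "partial_deriv i f" "f' i" k] C[OF that] by simp
  qed
  then show ?thesis
    using cont der unfolding C_k.simps real_differentiable_def by blast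
qed

lemma C_k_SucD:
  assumes "C_k (Suc k) n U f" "i < n" "x \<in> U"
  shows "((\<lambda>t. f (x(i := t))) has_real_derivative partial_deriv i f x) (at (x i))"
  using assms by (simp add: partial_deriv_def DERIV_deriv_iff_real_differentiable)

lemma C_k_add:
  assumes "open_dom n U" "C_k k n U f" "C_k k n U g"
  shows "C_k k n U (\<lambda>x. f x + g x)"
  using assms(2,3)
proof (induction k arbitrary: f g)
  case 0
  then show ?case by (simp add: continuous_map_add)
next
  case (Suc k)
  show ?case
  proof (rule C_k_SucI[OF assms(1)])
    show "((\<lambda>t. f (x(i := t)) + g (x(i := t))) has_real_derivative partial_deriv i f x + partial_deriv i g x) (at (x i))"
      if "i < n" "x \<in> U" for i x
      by (rule DERIV_add[OF C_k_SucD[OF Suc.prems(1) that] C_k_SucD[OF Suc.prems(2) that]])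
  qed (use Suc in \<open>auto intro: continuous_map_add\<close>)
qed

lemma C_k_mult:
  assumes "open_dom n U" "C_k k n U f" "C_k k n U g"
  shows "C_k k n U (\<lambda>x. f x * g x)"
  using assms(2,3)
proof (induction k arbitrary: f g)
  case 0
  then show ?case by (simp add: continuous_map_real_mult)
next
  case (Suc k)
  show ?case
  proof (rule C_k_SucI[OF assms(1)])
    show "((\<lambda>t. f (x(i := t)) * g (x(i := t))) has_real_derivative
        partial_deriv i f x * g x + partial_deriv i g x * f x) (at (x i))"
      if "i < n" "x \<in> U" for i x
      by (rule DERIV_cong[OF DERIV_mult[OF C_k_SucD[OF Suc.prems(1) that] C_k_SucD[OF Suc.prems(2) that]]])
        simp
    show "C_k k n U (\<lambda>x. partial_deriv i f x * g x + partial_deriv i g x * f x)" if "i < n" for i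
      using Suc.prems C_k_Suc_imp[OF Suc.prems(1)] C_k_Suc_imp[OF Suc.prems(2)] that
      by (intro C_k_add[OF assms(1)] Suc.IH) auto
  qed (use Suc.prems in \<open>auto intro: continuous_map_real_mult\<close>)
qed

lemma C_k_sum:
  assumes "open_dom n U" "\<And>j. j \<in> A \<Longrightarrow> C_k k n U (f j)"
  shows "C_k k n U (\<lambda>x. \<Sum>j\<in>A. f j x)"
  using assms(2)
  by (induction A rule: infinite_finite_induct) (simp_all add: C_k_const C_k_add[OF assms(1)] del: C_k.simps)

lemma continuous_map_into_Euclidean_space:
  assumes "h ` topspace X \<subseteq> topspace (Euclidean_space n)"
    and "\<And>i. i < n \<Longrightarrow> continuous_map X euclideanreal (\<lambda>w. h w i)"
  shows "continuous_map X (Euclidean_space n) h"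
proof -
  have "continuous_map X euclideanreal (\<lambda>w. h w i)" for i
  proof (cases "i < n")
    case False
    then have "\<And>w. w \<in> topspace X \<Longrightarrow> h w i = 0"
      using assms(1) by (force simp: topspace_Euclidean_space)
    then show ?thesis using continuous_map_eq[of X euclideanreal "\<lambda>_. 0" "\<lambda>w. h w i"] by simp
  qed (rule assms(2))
  then show ?thesis
    using assms(1) unfolding Euclidean_space_def
    by (auto simp: continuous_map_in_subtopology continuous_map_componentwise_UNIV)
qed

text \<open>The chain rule writes the partial derivatives of \<open>f \<circ> h\<close> as sums of products
  \<open>(\<partial>\<^sub>j f \<circ> h) \<cdot> \<partial>\<^sub>i h\<^sub>j\<close>, to which induction on the order of differentiability applies.\<close>

lemma C_k_compose:
  assumes U: "open_dom n U" and W: "open_dom m W"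
    and h: "h ` W \<subseteq> U" and hk: "\<And>i. i < n \<Longrightarrow> C_k k m W (\<lambda>w. h w i)" and f: "C_k k n U f"
  shows "C_k k m W (\<lambda>w. f (h w))"
  using hk f
proof (induction k arbitrary: f)
  case 0
  have "continuous_map (subtopology (Euclidean_space m) W) (Euclidean_space n) h"
    using h 0 openin_subset[OF U] by (intro continuous_map_into_Euclidean_space) auto
  then have "continuous_map (subtopology (Euclidean_space m) W) (subtopology (Euclidean_space n) U) h"
    using h by (auto simp: continuous_map_in_subtopology)
  then show ?case
    using 0 continuous_map_compose[of _ _ h _ f] by (simp add: o_def)
next
  case (Suc k)
  have hk: "\<And>i. i < n \<Longrightarrow> C_k k m W (\<lambda>w. h w i)" using Suc.prems(1) C_k_Suc_imp by blast
  have cont: "C_k k m W (\<lambda>w. f (h w))"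
    by (rule Suc.IH[OF hk C_k_Suc_imp[OF Suc.prems(2)]])
  show ?case
  proof (rule C_k_SucI[OF W C_k_continuous[OF cont]])
    fix i w assume i: "i < m" and w: "w \<in> W"
    have upd: "\<forall>\<^sub>F t in nhds (w i). w(i := t) \<in> W" by (rule eventually_fun_upd_in[OF W w i])
    show "((\<lambda>t. f (h (w(i := t)))) has_real_derivative
        (\<Sum>j<n. partial_deriv j f (h w) * partial_deriv i (\<lambda>w. h w j) w)) (at (w i))"
    proof -
      have "((\<lambda>t. f (h (w(i := t)))) has_real_derivative
          (\<Sum>j<n. partial_deriv j f (h (w(i := w i))) * partial_deriv i (\<lambda>w. h w j) w)) (at (w i))"
      proof (rule has_derivative_along_curve[OF U])
        show "h (w(i := w i)) \<in> U" using h w by auto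
        show "\<forall>\<^sub>F t in nhds (w i). h (w(i := t)) \<in> topspace (Euclidean_space n)"
          using upd by (rule eventually_mono) (use h openin_subset[OF U] in auto)
        show "((\<lambda>t. h (w(i := t)) j) has_real_derivative partial_deriv i (\<lambda>w. h w j) w) (at (w i))"
          if "j < n" for j
          by (rule C_k_SucD[OF Suc.prems(1)[OF that] i w])
        show "(\<lambda>t. f (y(j := t))) differentiable (at (y j))" if "j < n" "y \<in> U" for j y
          using Suc.prems(2) that unfolding C_k.simps by blast
        show "continuous_dom n U (partial_deriv j f)"
          if "j < n" for j
          using Suc.prems(2) that C_k_continuous unfolding C_k.simps by blast
      qed
      then show ?thesis by simp
    qed
  next
    fix i assume i: "i < m"
    show "C_k k m W (\<lambda>w. \<Sum>j<n. partial_deriv j f (h w) * partial_deriv i (\<lambda>w. h w j) w)"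
    proof (intro C_k_sum[OF W] C_k_mult[OF W])
      fix j assume "j \<in> {..<n}"
      then have j: "j < n" by simp
      show "C_k k m W (\<lambda>w. partial_deriv j f (h w))"
        by (rule Suc.IH[OF hk]) (use Suc.prems(2) j in auto)
      show "C_k k m W (partial_deriv i (\<lambda>w. h w j))"
        using Suc.prems(1)[OF j] i by simp
    qed
  qed
qed

lemma C_k_coordinate:
  assumes "open_dom n U"
  shows "C_k k n U (\<lambda>x. x i)"
proof -
  have cont: "continuous_dom n U (\<lambda>x. x i)"
    unfolding Euclidean_space_def
    by (intro continuous_map_from_subtopology continuous_map_product_coordinates) simp
  show ?thesis
  proof (cases k)
    case (Suc k')
    have "C_k (Suc k') n U (\<lambda>x. x i)"
    proof (rule C_k_SucI[OF assms cont])
      show "((\<lambda>t. (x(j := t)) i) has_real_derivative (if j = i then 1 else 0)) (at (x j))" for j x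
        by auto
    qed (rule C_k_const)
    then show ?thesis using Suc by simp
  qed (use cont in simp)
qed

lemma smooth_real_subset: "smooth_real n U f \<Longrightarrow> W \<subseteq> U \<Longrightarrow> smooth_real n W f"
  unfolding smooth_real_def using C_k_subset by blast

lemma smooth_real_compose:
  assumes "open_dom n U" "open_dom m W"
    "smooth_into m W n U h" "smooth_real n U f"
  shows "smooth_real m W (f \<circ> h)"
  unfolding smooth_real_def o_def
proof
  fix k
  show "C_k k m W (\<lambda>w. f (h w))"
    by (rule C_k_compose[OF assms(1,2)]) (use assms(3,4) in \<open>auto simp: smooth_into_def smooth_real_def\<close>)
qed

lemma smooth_into_compose:
  assumes "open_dom m W" "open_dom l Z"
    "smooth_into m W n U h" "smooth_into l Z m W k"
  shows "smooth_into l Z n U (h \<circ> k)"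
proof -
  have "smooth_real l Z (\<lambda>z. h (k z) i)" if "i < n" for i
    using smooth_real_compose[OF assms(1,2,4), of "\<lambda>w. h w i"] assms(3) that
    by (auto simp: smooth_into_def o_def)
  then show ?thesis
    using assms(3,4) by (auto simp: smooth_into_def image_subset_iff)
qed

lemma smooth_into_id:
  assumes "open_dom n U" "W \<subseteq> U" "open_dom n W"
  shows "smooth_into n W n U (\<lambda>x. x)"
  using assms openin_subset[OF assms(1)] C_k_coordinate[OF assms(3)]
  by (auto simp: smooth_into_def smooth_real_def)

lemma smooth_into_mono:
  assumes "smooth_into m W n U h" "W' \<subseteq> W" "h ` W' \<subseteq> U'"
  shows "smooth_into m W' n U' h"
proof -
  have "h ` W' \<subseteq> topspace (Euclidean_space n)" using assms(1,2) by (auto simp: smooth_into_def)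
  then show ?thesis
    using assms(1,3) smooth_real_subset[OF _ assms(2)] by (simp add: smooth_into_def)
qed

lemma smooth_into_preimage_open:
  assumes W: "open_dom m W" and h: "smooth_into m W n U h"
    and V: "open_dom n V"
  shows "open_dom m {w \<in> W. h w \<in> V}"
proof -
  let ?S = "subtopology (Euclidean_space m) W"
  have "continuous_map ?S (Euclidean_space n) h"
  proof (rule continuous_map_into_Euclidean_space)
    show "continuous_map ?S euclideanreal (\<lambda>w. h w i)" if "i < n" for i
    proof -
      have "smooth_real m W (\<lambda>w. h w i)" using h that by (simp add: smooth_into_def)
      then have "C_k 0 m W (\<lambda>w. h w i)" unfolding smooth_real_def by (rule spec)
      then show ?thesis by (rule C_k_continuous)
    qed
  qed (use h in \<open>auto simp: smooth_into_def\<close>)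
  then have "openin ?S {w \<in> topspace ?S. h w \<in> V}" using V by (rule openin_continuous_map_preimage)
  then have "open_dom m {w \<in> topspace ?S. h w \<in> V}" using W by (rule openin_trans_full)
  moreover have "{w \<in> topspace ?S. h w \<in> V} = {w \<in> W. h w \<in> V}" using openin_subset[OF W] by auto
  ultimately show ?thesis by simp
qed

section \<open>Stability of plots under smooth reparametrization\<close>

text \<open>The part of the axioms of a diffeology that is inherited by plots of quotients and disjoint
  unions without further conditions.\<close>

definition stable_plots :: "'a plot_pred \<Rightarrow> bool" where
  "stable_plots P \<longleftrightarrow> (\<forall>n U p. P n U p \<longrightarrow> open_dom n U \<and>
     (\<forall>m W h. open_dom m W \<longrightarrow> smooth_into m W n U h \<longrightarrow> P m W (p \<circ> h)))"

lemma stable_plots_open: "stable_plots P \<Longrightarrow> P n U p \<Longrightarrow> open_dom n U"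
  and stable_plots_compose: "stable_plots P \<Longrightarrow> P n U p \<Longrightarrow> open_dom m W \<Longrightarrow>
    smooth_into m W n U h \<Longrightarrow> P m W (p \<circ> h)"
  unfolding stable_plots_def by blast+

lemma stable_plots_restrict:
  assumes "stable_plots P" "P n U p" "open_dom n W" "W \<subseteq> U"
  shows "P n W p"
  using stable_plots_compose[OF assms(1,2,3)
      smooth_into_id[OF stable_plots_open[OF assms(1,2)] assms(4,3)]]
  by (simp add: o_def)

lemma stable_plots_diffeology: "diffeology D \<Longrightarrow> stable_plots (plots D)"
  unfolding stable_plots_def diffeology_def by blast

lemma stable_local_plot:
  assumes "stable_plots P" shows "stable_plots (local_plot P)"
  unfolding stable_plots_def
proof (intro allI impI conjI)
  fix n U p assume p: "local_plot P n U p"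
  show "open_dom n U" using p by (simp add: local_plot_def)
  fix m W h assume W: "open_dom m W" and h: "smooth_into m W n U h"
  show "local_plot P m W (p \<circ> h)"
    unfolding local_plot_def
  proof (intro conjI W ballI)
    fix w assume w: "w \<in> W"
    then have "h w \<in> U" using h by (auto simp: smooth_into_def)
    then obtain V q where V: "open_dom n V" "h w \<in> V" "V \<subseteq> U" "P n V q" "\<And>v. v \<in> V \<Longrightarrow> p v = q v"
      using p unfolding local_plot_def by blast
    define W' where "W' = {w \<in> W. h w \<in> V}"
    have W': "open_dom m W'"
      unfolding W'_def by (rule smooth_into_preimage_open[OF W h V(1)])
    have "smooth_into m W' n V h"
      by (rule smooth_into_mono[OF h]) (auto simp: W'_def)
    then have "P m W' (q \<circ> h)" by (rule stable_plots_compose[OF assms V(4) W'])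
    moreover have "w \<in> W'" "W' \<subseteq> W" "\<And>w. w \<in> W' \<Longrightarrow> (p \<circ> h) w = (q \<circ> h) w"
      using w V by (auto simp: W'_def)
    ultimately show "\<exists>W' q. open_dom m W' \<and> w \<in> W' \<and> W' \<subseteq> W \<and> P m W' q \<and> (\<forall>w\<in>W'. (p \<circ> h) w = q w)"
      using W' by blast
  qed
qed

lemma local_plotI: "P n U p \<Longrightarrow> open_dom n U \<Longrightarrow> local_plot P n U p"
  unfolding local_plot_def by blast

lemma local_plot_idem:
  assumes "local_plot (local_plot P) n U p" shows "local_plot P n U p"
proof -
  have "\<exists>W q. open_dom n W \<and> u \<in> W \<and> W \<subseteq> U \<and> P n W q \<and> (\<forall>w\<in>W. p w = q w)"
    if u: "u \<in> U" for u
  proof -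
    obtain W q where W: "u \<in> W" "W \<subseteq> U" "local_plot P n W q" "\<forall>w\<in>W. p w = q w"
      using assms u unfolding local_plot_def[of "local_plot P"] by blast
    then obtain V r where "open_dom n V" "u \<in> V" "V \<subseteq> W" "P n V r" "\<forall>w\<in>V. q w = r w"
      unfolding local_plot_def by blast
    then show ?thesis
      using W(2,4) by (intro exI[of _ V] exI[of _ r]) auto
  qed
  moreover have "open_dom n U"
    using assms unfolding local_plot_def[of "local_plot P"] by blast
  ultimately show ?thesis
    unfolding local_plot_def[of P] by blast
qed

lemma stable_plots_image:
  assumes "stable_plots P" shows "stable_plots (\<lambda>n U p. \<exists>q. P n U q \<and> p = \<pi> \<circ> q)"
  unfolding stable_plots_def
proof (intro allI impI conjI)
  fix n U p assume "\<exists>q. P n U q \<and> p = \<pi> \<circ> q"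
  then obtain q where q: "P n U q" "p = \<pi> \<circ> q" by blast
  show "open_dom n U" by (rule stable_plots_open[OF assms q(1)])
  fix m W h assume "open_dom m W" "smooth_into m W n U h"
  then have "P m W (q \<circ> h)" by (rule stable_plots_compose[OF assms q(1)])
  then show "\<exists>q. P m W q \<and> p \<circ> h = \<pi> \<circ> q" using q(2) by (auto simp: comp_assoc)
qed

lemma stable_plots_disj:
  assumes "stable_plots P" "stable_plots Q" shows "stable_plots (\<lambda>n U p. P n U p \<or> Q n U p)"
  using assms unfolding stable_plots_def by blast

lemma stable_quot_dspace:
  "stable_plots (plots A) \<Longrightarrow> stable_plots (plots (quot_dspace A \<pi>))"
  by (simp add: quot_dspace_def stable_local_plot stable_plots_image)

lemma stable_sum_dspace:
  "stable_plots (plots A) \<Longrightarrow> stable_plots (plots B) \<Longrightarrow> stable_plots (plots (sum_dspace A B))"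
  by (simp add: sum_dspace_def stable_local_plot stable_plots_image stable_plots_disj)

lemma stable_glue_dspace:
  "stable_plots (plots A) \<Longrightarrow> stable_plots (plots B) \<Longrightarrow> stable_plots (plots (glue_dspace A Y f B))"
  unfolding glue_dspace_def by (intro stable_quot_dspace stable_sum_dspace)

section \<open>Points and plots of glued spaces\<close>

text \<open>A canonical representative of each class: glued points of the first space are moved to the
  second one. Two points are identified iff their representatives agree, also when \<open>f\<close> is not
  injective.\<close>

definition glue_rep :: "'a set \<Rightarrow> ('a \<Rightarrow> 'b) \<Rightarrow> 'a + 'b \<Rightarrow> 'a + 'b" where
  "glue_rep Y f z = (case z of Inl a \<Rightarrow> if a \<in> Y then Inr (f a) else Inl a | Inr b \<Rightarrow> Inr b)"

lemma equivclp_glue_step_iff: "equivclp (glue_step Y f) z z' \<longleftrightarrow> glue_rep Y f z = glue_rep Y f z'"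
proof
  assume "equivclp (glue_step Y f) z z'"
  then show "glue_rep Y f z = glue_rep Y f z'"
    by (induction rule: equivclp_induct) (auto simp: glue_step_def glue_rep_def)
next
  have rep: "equivclp (glue_step Y f) z (glue_rep Y f z)" for z
  proof (cases "\<exists>y\<in>Y. z = Inl y")
    case True
    then have "glue_step Y f z (glue_rep Y f z)" by (auto simp: glue_step_def glue_rep_def)
    then show ?thesis by blast
  next
    case False
    then have "glue_rep Y f z = z" by (auto simp: glue_rep_def split: sum.split)
    then show ?thesis by simp
  qed
  assume "glue_rep Y f z = glue_rep Y f z'"
  then show "equivclp (glue_step Y f) z z'"
    using rep[of z] rep[of z'] by (metis equivclp_sym equivclp_trans)
qed

lemma glue_class_eq_iff: "glue_class Y f z = glue_class Y f z' \<longleftrightarrow> glue_rep Y f z = glue_rep Y f z'"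
  unfolding glue_class_def equivclp_glue_step_iff by (auto simp: set_eq_iff)

lemma mem_glue_class_iff: "z' \<in> glue_class Y f z \<longleftrightarrow> glue_rep Y f z = glue_rep Y f z'"
  by (simp add: glue_class_def equivclp_glue_step_iff)

lemma glue_inj1_eq_inj1: "a \<notin> Y \<Longrightarrow> glue_inj1 Y f a = glue_inj1 Y f a' \<longleftrightarrow> a = a'"
  and glue_inj1_eq_inj2: "glue_inj1 Y f a = glue_inj2 Y f b \<longleftrightarrow> a \<in> Y \<and> f a = b"
  and glue_inj2_eq_inj2: "glue_inj2 Y f b = glue_inj2 Y f b' \<longleftrightarrow> b = b'"
  by (auto simp: glue_inj1_def glue_inj2_def glue_class_eq_iff glue_rep_def)

lemma glue_inj1_glued: "a \<in> Y \<Longrightarrow> glue_inj1 Y f a = glue_inj2 Y f (f a)"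
  by (simp add: glue_inj1_eq_inj2)

lemma glue_inj1_eq_inj1_inj: "inj_on f Y \<Longrightarrow> glue_inj1 Y f a = glue_inj1 Y f a' \<longleftrightarrow> a = a'"
  by (auto simp: glue_inj1_def glue_class_eq_iff glue_rep_def inj_on_def split: if_splits)

lemma glue_inj2_notin_image: "glue_inj2 Y f b \<notin> glue_inj1 Y f ` (A - Y)"
  by (metis DiffD2 glue_inj1_eq_inj2 imageE)

lemma inv_glue_inj1: "a \<in> A - Y \<Longrightarrow> inv_into (A - Y) (glue_inj1 Y f) (glue_inj1 Y f a) = a"
  by (rule inv_into_f_f) (auto simp: inj_on_def glue_inj1_eq_inj1)

lemma inv_glue_inj2: "b \<in> B \<Longrightarrow> inv_into B (glue_inj2 Y f) (glue_inj2 Y f b) = b"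
  by (rule inv_into_f_f) (auto simp: inj_on_def glue_inj2_eq_inj2)

lemma points_glue_dspace:
  "points (glue_dspace A Y f B) = glue_inj1 Y f ` points A \<union> glue_inj2 Y f ` points B"
  by (auto simp: glue_dspace_def quot_dspace_def sum_dspace_def glue_inj1_def glue_inj2_def)

lemma glue_proj_class:
  assumes "\<And>a. a \<in> S \<Longrightarrow> \<pi>1 a \<in> Y \<and> \<pi>2 (F a) = f (\<pi>1 a)"
  shows "glue_proj Y f \<pi>1 \<pi>2 (glue_class S F z) = glue_class Y f (map_sum \<pi>1 \<pi>2 z)"
proof -
  have rep: "glue_rep Y f (map_sum \<pi>1 \<pi>2 z) = glue_rep Y f (map_sum \<pi>1 \<pi>2 (glue_rep S F z))" for z
    using assms by (auto simp: glue_rep_def split: sum.split)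
  have "(\<lambda>z. glue_class Y f (map_sum \<pi>1 \<pi>2 z)) ` glue_class S F z = {glue_class Y f (map_sum \<pi>1 \<pi>2 z)}"
  proof (intro equalityI subsetI)
    fix c assume "c \<in> (\<lambda>z. glue_class Y f (map_sum \<pi>1 \<pi>2 z)) ` glue_class S F z"
    then obtain z' where "c = glue_class Y f (map_sum \<pi>1 \<pi>2 z')" "glue_rep S F z = glue_rep S F z'"
      by (auto simp: mem_glue_class_iff)
    then show "c \<in> {glue_class Y f (map_sum \<pi>1 \<pi>2 z)}"
      using rep[of z] rep[of z'] by (simp add: glue_class_eq_iff)
  qed (auto simp: mem_glue_class_iff)
  then show ?thesis by (simp add: glue_proj_def)
qed

text \<open>\<open>glue_chart A Y f B n W p\<close>: on all of \<open>W\<close>, the map \<open>p\<close> comes from a plot of one of the two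
  pieces. The plots of a glued space are the maps that are locally of this form.\<close>

definition glue_chart :: "'a dspace \<Rightarrow> 'a set \<Rightarrow> ('a \<Rightarrow> 'b) \<Rightarrow> 'b dspace \<Rightarrow> ('a + 'b) set plot_pred" where
  "glue_chart A Y f B n W p \<longleftrightarrow>
     (\<exists>q. plots A n W q \<and> (\<forall>w\<in>W. p w = glue_inj1 Y f (q w))) \<or>
     (\<exists>q. plots B n W q \<and> (\<forall>w\<in>W. p w = glue_inj2 Y f (q w)))"

lemma plots_glue_dspace_iff:
  assumes A: "stable_plots (plots A)" and B: "stable_plots (plots B)"
  shows "plots (glue_dspace A Y f B) n U p \<longleftrightarrow> open_dom n U \<and>
    (\<forall>u\<in>U. \<exists>W. open_dom n W \<and> u \<in> W \<and> W \<subseteq> U \<and> glue_chart A Y f B n W p)"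
proof
  assume p: "plots (glue_dspace A Y f B) n U p"
  then have loc: "local_plot (\<lambda>n U p. \<exists>q. plots (sum_dspace A B) n U q \<and> p = glue_class Y f \<circ> q) n U p"
    by (simp add: glue_dspace_def quot_dspace_def)
  show "open_dom n U \<and>
    (\<forall>u\<in>U. \<exists>W. open_dom n W \<and> u \<in> W \<and> W \<subseteq> U \<and> glue_chart A Y f B n W p)"
  proof (intro conjI ballI)
    show "open_dom n U" using loc by (simp add: local_plot_def)
    fix u assume u: "u \<in> U"
    obtain V p' where V': "u \<in> V" "V \<subseteq> U" "\<forall>v\<in>V. p v = p' v"
      "\<exists>q. plots (sum_dspace A B) n V q \<and> p' = glue_class Y f \<circ> q"
      using loc u unfolding local_plot_def by blast
    then obtain q where V: "u \<in> V" "V \<subseteq> U" "plots (sum_dspace A B) n V q"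
      "\<And>v. v \<in> V \<Longrightarrow> p v = glue_class Y f (q v)"
      by auto
    have "local_plot (\<lambda>n U p. (\<exists>q. plots A n U q \<and> p = Inl \<circ> q) \<or> (\<exists>q. plots B n U q \<and> p = Inr \<circ> q)) n V q"
      using V(3) by (simp add: sum_dspace_def)
    then obtain W r where W: "open_dom n W" "u \<in> W" "W \<subseteq> V" "\<And>w. w \<in> W \<Longrightarrow> q w = r w"
      and r: "(\<exists>s. plots A n W s \<and> r = Inl \<circ> s) \<or> (\<exists>s. plots B n W s \<and> r = Inr \<circ> s)"
      using V(1) unfolding local_plot_def by blast
    have pr: "p w = glue_class Y f (r w)" if "w \<in> W" for w
      using that V(4) W(3,4) by auto
    from r have "glue_chart A Y f B n W p"
    proof
      assume "\<exists>s. plots A n W s \<and> r = Inl \<circ> s"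
      then obtain s where "plots A n W s" "r = Inl \<circ> s" by blast
      then show ?thesis
        unfolding glue_chart_def using pr by (intro disjI1 exI[of _ s]) (simp add: glue_inj1_def)
    next
      assume "\<exists>s. plots B n W s \<and> r = Inr \<circ> s"
      then obtain s where "plots B n W s" "r = Inr \<circ> s" by blast
      then show ?thesis
        unfolding glue_chart_def using pr by (intro disjI2 exI[of _ s]) (simp add: glue_inj2_def)
    qed
    then show "\<exists>W. open_dom n W \<and> u \<in> W \<and> W \<subseteq> U \<and> glue_chart A Y f B n W p"
      using W V(2) by blast
  qed
next
  assume p: "open_dom n U \<and>
    (\<forall>u\<in>U. \<exists>W. open_dom n W \<and> u \<in> W \<and> W \<subseteq> U \<and> glue_chart A Y f B n W p)"
  have "\<exists>W q. open_dom n W \<and> u \<in> W \<and> W \<subseteq> U \<and>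
      (\<exists>r. plots (sum_dspace A B) n W r \<and> q = glue_class Y f \<circ> r) \<and> (\<forall>w\<in>W. p w = q w)"
    if u: "u \<in> U" for u
  proof -
    obtain W where W: "open_dom n W" "u \<in> W" "W \<subseteq> U" "glue_chart A Y f B n W p"
      using p u by blast
    from W(4) have "\<exists>r. plots (sum_dspace A B) n W r \<and> (\<forall>w\<in>W. p w = (glue_class Y f \<circ> r) w)"
      unfolding glue_chart_def
    proof (elim disjE exE conjE)
      fix q assume q: "plots A n W q" "\<forall>w\<in>W. p w = glue_inj1 Y f (q w)"
      have "plots (sum_dspace A B) n W (Inl \<circ> q)"
        using q(1) by (auto simp: sum_dspace_def intro: local_plotI[OF _ W(1)])
      then show ?thesis using q(2) by (intro exI[of _ "Inl \<circ> q"]) (simp add: glue_inj1_def)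
    next
      fix q assume q: "plots B n W q" "\<forall>w\<in>W. p w = glue_inj2 Y f (q w)"
      have "plots (sum_dspace A B) n W (Inr \<circ> q)"
        using q(1) by (auto simp: sum_dspace_def intro: local_plotI[OF _ W(1)])
      then show ?thesis using q(2) by (intro exI[of _ "Inr \<circ> q"]) (simp add: glue_inj2_def)
    qed
    then show ?thesis using W by blast
  qed
  then show "plots (glue_dspace A Y f B) n U p"
    using p unfolding glue_dspace_def quot_dspace_def local_plot_def by simp
qed

section \<open>Evaluating plots of endomorphisms\<close>

text \<open>The maps generating the diffeology of \<^const>\<open>end_dspace\<close>.\<close>

definition end_generator :: "('x, 'e) vbundle \<Rightarrow> ('x \<times> ('e \<Rightarrow> 'e)) plot_pred" where
  "end_generator E n U p \<longleftrightarrow> open_dom n U \<and>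
     p ` U \<subseteq> (SIGMA x : points (base E). smooth_end E x) \<and>
     (\<forall>m W q. plots (total E) m W q \<longrightarrow>
        smooth_map (same_base E n U p m W q) (total E) (\<lambda>(u, w). snd (p u) (q w)))"

lemma end_dspace_eq:
  "end_dspace E = generated_dspace (SIGMA x : points (base E). smooth_end E x) (end_generator E)"
  unfolding end_dspace_def end_generator_def ..

lemma plots_same_baseD:
  assumes "plots (same_base E n U p m W q) k Z r"
  shows "open_dom k Z" "smooth_into k Z n U (fst \<circ> r)" "smooth_into k Z m W (snd \<circ> r)"
    "\<And>z. z \<in> Z \<Longrightarrow> fst (p (fst (r z))) = proj E (q (snd (r z)))"
proof -
  have 1: "open_dom k Z" "smooth_into k Z n (topspace (Euclidean_space n)) (fst \<circ> r)"
    "smooth_into k Z m (topspace (Euclidean_space m)) (snd \<circ> r)"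
    and 2: "r ` Z \<subseteq> {(u, w). u \<in> U \<and> w \<in> W \<and> fst (p u) = proj E (q w)}"
    using assms by (simp_all add: same_base_def sub_dspace_def prod_dspace_def euclid_dspace_def)
  have 3: "fst (r z) \<in> U \<and> snd (r z) \<in> W \<and> fst (p (fst (r z))) = proj E (q (snd (r z)))" if "z \<in> Z" for z
    using 2 that by fastforce
  show "open_dom k Z" by (rule 1)
  show "smooth_into k Z n U (fst \<circ> r)" "smooth_into k Z m W (snd \<circ> r)"
    using 3 by (auto intro: smooth_into_mono[OF 1(2)] smooth_into_mono[OF 1(3)])
  show "fst (p (fst (r z))) = proj E (q (snd (r z)))" if "z \<in> Z" for z using 3[OF that] by blast
qed

lemma plots_same_baseI:
  assumes "open_dom k Z" "smooth_into k Z n U (fst \<circ> r)" "smooth_into k Z m W (snd \<circ> r)"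
    "\<And>z. z \<in> Z \<Longrightarrow> fst (p (fst (r z))) = proj E (q (snd (r z)))"
  shows "plots (same_base E n U p m W q) k Z r"
proof -
  have "fst (r z) \<in> U" "snd (r z) \<in> W" if "z \<in> Z" for z
    using assms(2,3) that by (auto simp: smooth_into_def)
  then have "r z \<in> {(u, w). u \<in> U \<and> w \<in> W \<and> fst (p u) = proj E (q w)}" if "z \<in> Z" for z
    using that assms(4) by (simp add: split_beta)
  moreover have "smooth_into k Z n (topspace (Euclidean_space n)) (fst \<circ> r)"
    "smooth_into k Z m (topspace (Euclidean_space m)) (snd \<circ> r)"
    using assms(2,3) by (simp_all add: smooth_into_def)
  ultimately show ?thesis
    using assms(1) by (simp add: same_base_def sub_dspace_def prod_dspace_def euclid_dspace_def image_subset_iff)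
qed

text \<open>The generators already form a diffeology, so that no further plots arise; closure under
  reparametrization rests on the chain rule. Hence every plot of endomorphisms can be evaluated on
  plots of \<open>E\<close>.\<close>

lemma diffeology_end_generator:
  assumes E: "pseudo_bundle E"
  shows "diffeology \<lparr>points = (SIGMA x : points (base E). smooth_end E x), plots = end_generator E\<rparr>"
    (is "diffeology ?D")
proof
  interpret T: diffeology "total E" using E by (simp add: pseudo_bundle_def)
  have stable: "stable_plots (plots (total E))"
    by (rule stable_plots_diffeology) (rule T.diffeology_axioms)
  have carr: "snd (p u) v \<in> points (total E)"
    if "p ` U \<subseteq> (SIGMA x : points (base E). smooth_end E x)" "u \<in> U" "v \<in> points (total E)" "fst (p u) = proj E v"
    for p U u v
  proof -
    have "linear_map (fibre E (fst (p u))) (fibre E (fst (p u))) (snd (p u))"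
      using that by (force simp: smooth_end_def)
    then show ?thesis using that by (auto simp: linear_map_def fibre_def)
  qed
  show "open_dom n U \<and> p ` U \<subseteq> points ?D" if "plots ?D n U p" for n U p
    using that by (simp add: end_generator_def)
  show "plots ?D n U (\<lambda>_. x)" if U: "open_dom n U" and x: "x \<in> points ?D" for n U x
  proof -
    obtain b A where xb: "x = (b, A)" "A \<in> smooth_end E b" "b \<in> points (base E)" using x by auto
    have "smooth_map (same_base E n U (\<lambda>_. x) m W q) (total E) (\<lambda>(u, w). snd x (q w))"
      if q: "plots (total E) m W q" for m W q
      unfolding smooth_map_def
    proof (intro conjI allI impI)
      show "(\<lambda>(u, w). snd x (q w)) ` points (same_base E n U (\<lambda>_. x) m W q) \<subseteq> points (total E)"
        using T.plot_range[OF q] carr[of "\<lambda>_. x" U] x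
        by (auto simp: same_base_def sub_dspace_def image_subset_iff)
      fix k Z r assume "plots (same_base E n U (\<lambda>_. x) m W q) k Z r"
      note r = plots_same_baseD[OF this]
      have qr: "plots (total E) k Z (q \<circ> (snd \<circ> r))" by (rule T.plot_compose[OF q r(1,3)])
      have "(q \<circ> (snd \<circ> r)) ` Z \<subseteq> carrier (fibre E b)"
        using T.plot_range[OF qr] r(4) xb by (auto simp: fibre_def)
      then have "plots (fibre_dspace E b) k Z (q \<circ> (snd \<circ> r))"
        using qr by (simp add: fibre_dspace_def sub_dspace_def)
      then have "plots (fibre_dspace E b) k Z (A \<circ> (q \<circ> (snd \<circ> r)))"
        using xb(2) by (simp add: smooth_end_def smooth_map_def)
      then show "plots (total E) k Z ((\<lambda>(u, w). snd x (q w)) \<circ> r)"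
        by (simp add: fibre_dspace_def sub_dspace_def xb(1) o_def split_beta)
    qed
    then show ?thesis using U x by (auto simp: end_generator_def)
  qed
  show "plots ?D m W (p \<circ> h)"
    if p: "plots ?D n U p" and W: "open_dom m W" and h: "smooth_into m W n U h" for n U p m W h
  proof -
    have p': "open_dom n U" "p ` U \<subseteq> (SIGMA x : points (base E). smooth_end E x)"
      "\<And>m W q. plots (total E) m W q \<Longrightarrow>
        smooth_map (same_base E n U p m W q) (total E) (\<lambda>(u, w). snd (p u) (q w))"
      using p by (simp_all add: end_generator_def)
    have hU: "h ` W \<subseteq> U" using h by (auto simp: smooth_into_def)
    have rng: "(p \<circ> h) ` W \<subseteq> (SIGMA x : points (base E). smooth_end E x)"
      using hU p'(2) by fastforce
    have "smooth_map (same_base E m W (p \<circ> h) l V q) (total E) (\<lambda>(u, w). snd ((p \<circ> h) u) (q w))"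
      if q: "plots (total E) l V q" for l V q
      unfolding smooth_map_def
    proof (intro conjI allI impI)
      show "(\<lambda>(u, w). snd ((p \<circ> h) u) (q w)) ` points (same_base E m W (p \<circ> h) l V q) \<subseteq> points (total E)"
        using T.plot_range[OF q] carr[OF rng]
        by (auto simp: same_base_def sub_dspace_def image_subset_iff)
      fix k Z r assume "plots (same_base E m W (p \<circ> h) l V q) k Z r"
      note r = plots_same_baseD[OF this]
      have "plots (same_base E n U p l V q) k Z (\<lambda>z. (h (fst (r z)), snd (r z)))"
      proof (rule plots_same_baseI[OF r(1)])
        show "smooth_into k Z n U (fst \<circ> (\<lambda>z. (h (fst (r z)), snd (r z))))"
          using smooth_into_compose[OF W r(1) h r(2)] by (simp add: o_def)
        show "smooth_into k Z l V (snd \<circ> (\<lambda>z. (h (fst (r z)), snd (r z))))"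
          using r(3) by (simp add: o_def)
      qed (use r(4) in simp)
      then have "plots (total E) k Z ((\<lambda>(u, w). snd (p u) (q w)) \<circ> (\<lambda>z. (h (fst (r z)), snd (r z))))"
        using p'(3)[OF q] unfolding smooth_map_def by blast
      then show "plots (total E) k Z ((\<lambda>(u, w). snd ((p \<circ> h) u) (q w)) \<circ> r)"
        by (simp add: o_def split_beta)
    qed
    then show ?thesis using W rng by (simp add: end_generator_def)
  qed
  show "plots ?D n U p" if loc: "local_plot (plots ?D) n U p" for n U p
  proof -
    have U: "open_dom n U" using loc by (simp add: local_plot_def)
    have ex: "\<exists>W q. open_dom n W \<and> u \<in> W \<and> W \<subseteq> U \<and> end_generator E n W q \<and> (\<forall>w\<in>W. p w = q w)"
      if "u \<in> U" for u
      using loc that by (simp add: local_plot_def)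
    have rng: "p ` U \<subseteq> (SIGMA x : points (base E). smooth_end E x)"
    proof
      fix y assume "y \<in> p ` U"
      then obtain u where "u \<in> U" "y = p u" by blast
      with ex[of u] show "y \<in> (SIGMA x : points (base E). smooth_end E x)"
        unfolding end_generator_def by (metis image_subset_iff)
    qed
    have "smooth_map (same_base E n U p m W q) (total E) (\<lambda>(u, w). snd (p u) (q w))"
      if q: "plots (total E) m W q" for m W q
      unfolding smooth_map_def
    proof (intro conjI allI impI)
      show "(\<lambda>(u, w). snd (p u) (q w)) ` points (same_base E n U p m W q) \<subseteq> points (total E)"
        using T.plot_range[OF q] carr[OF rng]
        by (auto simp: same_base_def sub_dspace_def image_subset_iff)
      fix k Z r assume "plots (same_base E n U p m W q) k Z r"
      note r = plots_same_baseD[OF this]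
      show "plots (total E) k Z ((\<lambda>(u, w). snd (p u) (q w)) \<circ> r)"
      proof (rule T.plot_local, unfold local_plot_def, intro conjI r(1) ballI)
        fix z assume z: "z \<in> Z"
        then have rz: "fst (r z) \<in> U" using r(2) by (auto simp: smooth_into_def)
        obtain V p' where V: "open_dom n V" "fst (r z) \<in> V" "V \<subseteq> U"
          "end_generator E n V p'" "\<And>v. v \<in> V \<Longrightarrow> p v = p' v"
          using ex[OF rz] by blast
        define Z' where "Z' = {z \<in> Z. (fst \<circ> r) z \<in> V}"
        have Z': "open_dom k Z'"
          unfolding Z'_def by (rule smooth_into_preimage_open[OF r(1,2) V(1)])
        have sub: "Z' \<subseteq> Z" "z \<in> Z'" using z V(2) by (auto simp: Z'_def)
        have "plots (same_base E n V p' m W q) k Z' r"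
        proof (rule plots_same_baseI[OF Z'])
          show "smooth_into k Z' n V (fst \<circ> r)"
            by (rule smooth_into_mono[OF r(2) sub(1)]) (auto simp: Z'_def)
          show "smooth_into k Z' m W (snd \<circ> r)"
            by (rule smooth_into_mono[OF r(3) sub(1)]) (use r(3) sub in \<open>auto simp: smooth_into_def\<close>)
          show "fst (p' (fst (r z))) = proj E (q (snd (r z)))" if "z \<in> Z'" for z
            using r(4)[of z] that V(5)[of "fst (r z)"] by (auto simp: Z'_def)
        qed
        moreover have "smooth_map (same_base E n V p' m W q) (total E) (\<lambda>(u, w). snd (p' u) (q w))"
          using V(4) q by (simp add: end_generator_def)
        ultimately have "plots (total E) k Z' ((\<lambda>(u, w). snd (p' u) (q w)) \<circ> r)"
          unfolding smooth_map_def by blast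
        moreover have "((\<lambda>(u, w). snd (p u) (q w)) \<circ> r) w = ((\<lambda>(u, w). snd (p' u) (q w)) \<circ> r) w" if "w \<in> Z'" for w
          using that V(5) by (auto simp: Z'_def split_beta)
        ultimately show "\<exists>Z' g. open_dom k Z' \<and> z \<in> Z' \<and> Z' \<subseteq> Z \<and> plots (total E) k Z' g \<and>
            (\<forall>w\<in>Z'. ((\<lambda>(u, w). snd (p u) (q w)) \<circ> r) w = g w)"
          using Z' sub by blast
      qed
    qed
    then show ?thesis using U rng by (simp add: end_generator_def)
  qed
qed

lemma end_dspace_plot_eval:
  assumes E: "pseudo_bundle E" and P: "plots (end_dspace E) n U P" and e: "plots (total E) n U e"
    and base: "\<And>u. u \<in> U \<Longrightarrow> fst (P u) = proj E (e u)"
  shows "plots (total E) n U (\<lambda>u. snd (P u) (e u))"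
proof -
  have U: "open_dom n U"
    using stable_plots_open[OF stable_plots_diffeology e] E by (simp add: pseudo_bundle_def)
  have "end_generator E n U P"
    using P diffeology_end_generator[OF E] unfolding end_dspace_eq generated_dspace_def by fastforce
  then have sm: "smooth_map (same_base E n U P n U e) (total E) (\<lambda>(u, w). snd (P u) (e w))"
    using e by (simp add: end_generator_def)
  have "plots (same_base E n U P n U e) n U (\<lambda>u. (u, u))"
    by (rule plots_same_baseI[OF U])
      (use base smooth_into_id[OF U subset_refl U] in \<open>simp_all add: o_def\<close>)
  then have "plots (total E) n U ((\<lambda>(u, w). snd (P u) (e w)) \<circ> (\<lambda>u. (u, u)))"
    using sm unfolding smooth_map_def by blast
  then show ?thesis by (simp add: o_def)
qed

lemma end_dspace_plotI: "end_generator E n U p \<Longrightarrow> plots (end_dspace E) n U p"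
  by (simp add: end_dspace_eq generated_dspace_def)

lemma points_end_dspace: "points (end_dspace E) = (SIGMA x : points (base E). smooth_end E x)"
  by (simp add: end_dspace_eq generated_dspace_def)

section \<open>The induced action on glued bundles\<close>

lemma pseudo_bundleD:
  assumes "pseudo_bundle B"
  shows "diffeology (base B)" "diffeology (total B)" "stable_plots (plots (base B))" "stable_plots (plots (total B))"
    "v \<in> points (total B) \<Longrightarrow> proj B v \<in> points (base B)"
    "plots (total B) n U p \<Longrightarrow> u \<in> U \<Longrightarrow> p u \<in> points (total B)"
    "x \<in> points (base B) \<Longrightarrow> module real_alg (fibre B x)"
proof -
  show d: "diffeology (base B)" "diffeology (total B)" using assms by (simp_all add: pseudo_bundle_def)
  show "stable_plots (plots (base B))" "stable_plots (plots (total B))"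
    using d by (simp_all add: stable_plots_diffeology)
  show "v \<in> points (total B) \<Longrightarrow> proj B v \<in> points (base B)"
    using assms by (auto simp: pseudo_bundle_def)
  show "plots (total B) n U p \<Longrightarrow> u \<in> U \<Longrightarrow> p u \<in> points (total B)"
    using diffeology.plot_range[OF d(2)] by blast
  show "x \<in> points (base B) \<Longrightarrow> module real_alg (fibre B x)"
    using assms by (simp add: pseudo_bundle_def)
qed

lemma carrier_fibre: "v \<in> carrier (fibre B x) \<longleftrightarrow> v \<in> points (total B) \<and> proj B v = x"
  by (simp add: fibre_def)

lemma smooth_end_apply:
  assumes "A \<in> smooth_end E x" "e \<in> points (total E)" "proj E e = x"
  shows "A e \<in> points (total E)" "proj E (A e) = x"
  using assms by (auto simp: smooth_end_def linear_map_def fibre_def)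

text \<open>A smooth endomorphism \<open>A\<close> of a fibre of \<open>E'\<close> is carried to a smooth endomorphism \<open>B\<close> of a
  fibre of \<open>E\<close> by a linear surjection \<open>j\<close> intertwining the two, provided that \<open>j\<close> maps plots
  to plots and plots of the fibre of \<open>E\<close> lift locally along \<open>j\<close>.\<close>

lemma smooth_end_transport:
  assumes A: "A \<in> smooth_end E' x'" and M: "module real_alg (fibre E' x')"
    and carr: "carrier (fibre E x) = j ` carrier (fibre E' x')"
    and ext: "B \<in> extensional (carrier (fibre E x))"
    and B: "\<And>e. e \<in> carrier (fibre E' x') \<Longrightarrow> B (j e) = j (A e)"
    and add: "\<And>e e'. e \<in> carrier (fibre E' x') \<Longrightarrow> e' \<in> carrier (fibre E' x') \<Longrightarrow>
      vadd E (j e) (j e') = j (vadd E' e e')"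
    and scale: "\<And>a e. e \<in> carrier (fibre E' x') \<Longrightarrow> vscale E a (j e) = j (vscale E' a e)"
    and local: "\<And>n U p. local_plot (plots (total E)) n U p \<Longrightarrow> plots (total E) n U p"
    and j: "\<And>n U r. plots (total E') n U r \<Longrightarrow> plots (total E) n U (j \<circ> r)"
    and lift: "\<And>n U p u. plots (total E) n U p \<Longrightarrow> p ` U \<subseteq> carrier (fibre E x) \<Longrightarrow> u \<in> U \<Longrightarrow>
      \<exists>W r. open_dom n W \<and> u \<in> W \<and> W \<subseteq> U \<and> plots (total E') n W r \<and>
        r ` W \<subseteq> carrier (fibre E' x') \<and> (\<forall>w\<in>W. p w = j (r w))"
    and "\<And>n U p. plots (total E) n U p \<Longrightarrow> open_dom n U"
  shows "B \<in> smooth_end E x"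
proof -
  have A_lin: "linear_map (fibre E' x') (fibre E' x') A"
    and A_smooth: "smooth_map (fibre_dspace E' x') (fibre_dspace E' x') A"
    using A by (simp_all add: smooth_end_def)
  interpret M: module real_alg "fibre E' x'" by (rule M)
  have A_closed: "A e \<in> carrier (fibre E' x')" if "e \<in> carrier (fibre E' x')" for e
    using A_lin that by (auto simp: linear_map_def)
  have B_closed: "B D \<in> carrier (fibre E x)" if "D \<in> carrier (fibre E x)" for D
    using that A_closed B unfolding carr by auto
  have fibre_ops: "add (fibre E' x') = vadd E'" "smult (fibre E' x') = vscale E'"
    "add (fibre E x) = vadd E" "smult (fibre E x) = vscale E"
    by (simp_all add: fibre_def)
  have "linear_map (fibre E x) (fibre E x) B"
    unfolding linear_map_def fibre_ops
  proof (intro conjI ballI allI)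
    fix D D' assume "D \<in> carrier (fibre E x)" "D' \<in> carrier (fibre E x)"
    then obtain e e' where e: "e \<in> carrier (fibre E' x')" "D = j e"
      and e': "e' \<in> carrier (fibre E' x')" "D' = j e'"
      unfolding carr by blast
    have "vadd E' e e' \<in> carrier (fibre E' x')"
      using M.M.add.m_closed[OF e(1) e'(1)] by (simp add: fibre_ops)
    moreover have "A (vadd E' e e') = vadd E' (A e) (A e')"
      using A_lin e(1) e'(1) unfolding linear_map_def fibre_ops by blast
    ultimately show "B (vadd E D D') = vadd E (B D) (B D')"
      using e e' by (simp add: add B A_closed)
  next
    fix a D assume "D \<in> carrier (fibre E x)"
    then obtain e where e: "e \<in> carrier (fibre E' x')" "D = j e"
      unfolding carr by blast
    have "vscale E' a e \<in> carrier (fibre E' x')"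
      using M.smult_closed[of a e] e(1) by (simp add: fibre_ops real_alg_def)
    moreover have "A (vscale E' a e) = vscale E' a (A e)"
      using A_lin e(1) unfolding linear_map_def fibre_ops by blast
    ultimately show "B (vscale E a D) = vscale E a (B D)"
      using e by (simp add: scale B A_closed)
  qed (use B_closed in blast)
  moreover have "smooth_map (fibre_dspace E x) (fibre_dspace E x) B"
    unfolding smooth_map_def
  proof (intro conjI allI impI)
    show "B ` points (fibre_dspace E x) \<subseteq> points (fibre_dspace E x)"
      using B_closed by (auto simp: fibre_dspace_def sub_dspace_def carrier_fibre)
    fix n U p assume "plots (fibre_dspace E x) n U p"
    then have p: "plots (total E) n U p" "p ` U \<subseteq> carrier (fibre E x)"
      by (simp_all add: fibre_dspace_def sub_dspace_def)
    have "plots (total E) n U (B \<circ> p)"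
    proof (rule local, unfold local_plot_def, intro conjI ballI)
      show "open_dom n U" by (rule assms(11)[OF p(1)])
      fix u assume u: "u \<in> U"
      obtain W r where W: "open_dom n W" "u \<in> W" "W \<subseteq> U"
        and r: "plots (total E') n W r" "r ` W \<subseteq> carrier (fibre E' x')" "\<forall>w\<in>W. p w = j (r w)"
        using lift[OF p u] by blast
      have "plots (fibre_dspace E' x') n W r"
        using r by (simp add: fibre_dspace_def sub_dspace_def)
      then have "plots (total E') n W (A \<circ> r)"
        using A_smooth by (simp add: smooth_map_def fibre_dspace_def sub_dspace_def)
      then have "plots (total E) n W (j \<circ> (A \<circ> r))" by (rule j)
      moreover have "\<forall>w\<in>W. (B \<circ> p) w = (j \<circ> (A \<circ> r)) w"
        using r(2,3) by (auto simp: B)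
      ultimately show "\<exists>W q. open_dom n W \<and> u \<in> W \<and> W \<subseteq> U \<and>
          plots (total E) n W q \<and> (\<forall>w\<in>W. (B \<circ> p) w = q w)"
        using W by blast
    qed
    moreover have "(B \<circ> p) ` U \<subseteq> carrier (fibre E x)" using p(2) B_closed by auto
    ultimately show "plots (fibre_dspace E x) n U (B \<circ> p)"
      by (simp add: fibre_dspace_def sub_dspace_def)
  qed
  ultimately show ?thesis using ext by (simp add: smooth_end_def)
qed

lemma action_values:
  assumes "smooth_map C (end_dspace E) c" "fst (c v) = fst v" "v \<in> points C"
  shows "snd (c v) \<in> smooth_end E (fst v) \<and> fst v \<in> points (base E)"
proof -
  have "c v \<in> (SIGMA x : points (base E). smooth_end E x)"
    using assms(1,3) unfolding smooth_map_def points_end_dspace by blast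
  then show ?thesis using assms(2) by (cases "c v") simp
qed

lemma action_plot_eval:
  assumes E: "pseudo_bundle E" and c: "smooth_map C (end_dspace E) c"
    and fst_c: "\<And>u. u \<in> U \<Longrightarrow> fst (c (q u)) = fst (q u)"
    and q: "plots C n U q" and r: "plots (total E) n U r" and base: "\<And>u. u \<in> U \<Longrightarrow> fst (q u) = proj E (r u)"
  shows "plots (total E) n U (\<lambda>u. snd (c (q u)) (r u))"
proof -
  have "plots (end_dspace E) n U (c \<circ> q)" using c q by (simp add: smooth_map_def)
  from end_dspace_plot_eval[OF E this r] show ?thesis by (simp add: fst_c base)
qed

text \<open>Of the Clifford algebra bundles only the following is used: they are families \<open>C1\<close>, \<open>C2\<close> over the
  base spaces of \<open>E1\<close>, \<open>E2\<close>, acting smoothly by endomorphisms, and \<open>F\<close> maps plots of \<open>C1\<close> lying over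
  \<open>Y\<close> to plots of \<open>C2\<close>. The operations on the fibres of \<open>C1\<close> and \<open>C2\<close> play no role.\<close>

locale action_gluing =
  fixes C1 :: "('x \<times> 'c) dspace" and E1 :: "('x, 'e) vbundle" and c1 :: "'x \<times> 'c \<Rightarrow> 'x \<times> ('e \<Rightarrow> 'e)"
    and C2 :: "('y \<times> 'd) dspace" and E2 :: "('y, 'h) vbundle" and c2 :: "'y \<times> 'd \<Rightarrow> 'y \<times> ('h \<Rightarrow> 'h)"
    and Y :: "'x set" and f :: "'x \<Rightarrow> 'y" and F :: "'x \<times> 'c \<Rightarrow> 'y \<times> 'd" and g :: "'e \<Rightarrow> 'h"
  assumes E1: "pseudo_bundle E1" and E2: "pseudo_bundle E2"
    and gluing: "bundle_gluing E1 E2 Y f g"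
    and C1_stable: "stable_plots (plots C1)" and C2_stable: "stable_plots (plots C2)"
    and C1_points: "\<And>n U p u. plots C1 n U p \<Longrightarrow> u \<in> U \<Longrightarrow> p u \<in> points C1"
    and c1: "smooth_map C1 (end_dspace E1) c1" and c2: "smooth_map C2 (end_dspace E2) c2"
    and fst_c1: "\<And>v. v \<in> points C1 \<Longrightarrow> fst (c1 v) = fst v"
    and fst_c2: "\<And>v. v \<in> points C2 \<Longrightarrow> fst (c2 v) = fst v"
    and C2_points: "\<And>n U p u. plots C2 n U p \<Longrightarrow> u \<in> U \<Longrightarrow> p u \<in> points C2"
    and F_points: "\<And>v. v \<in> points C1 \<Longrightarrow> fst v \<in> Y \<Longrightarrow> F v \<in> points C2 \<and> fst (F v) = f (fst v)"
    and F_plots: "\<And>n U p. plots C1 n U p \<Longrightarrow> (\<And>u. u \<in> U \<Longrightarrow> fst (p u) \<in> Y) \<Longrightarrow> plots C2 n U (F \<circ> p)"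
    and compatible: "\<And>v e. v \<in> points C1 \<Longrightarrow> fst v \<in> Y \<Longrightarrow> e \<in> carrier (fibre E1 (fst v)) \<Longrightarrow>
      g (snd (c1 v) e) = snd (c2 (F v)) (g e)"
begin

abbreviation "SC \<equiv> over C1 fst Y"
abbreviation "SE \<equiv> over (total E1) (proj E1) Y"
abbreviation "C \<equiv> glue_dspace C1 SC F C2"
abbreviation "E \<equiv> glue_bundle E1 Y f g E2"
abbreviation "c \<equiv> induced_action C1 E1 c1 C2 E2 c2 Y f F g"
abbreviation "j1C \<equiv> glue_inj1 SC F"
abbreviation "j2C \<equiv> glue_inj2 SC F :: 'y \<times> 'd \<Rightarrow> ('x \<times> 'c + 'y \<times> 'd) set"
abbreviation "j1E \<equiv> glue_inj1 SE g"
abbreviation "j2E \<equiv> glue_inj2 SE g :: 'h \<Rightarrow> ('e + 'h) set"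
abbreviation "j1X \<equiv> glue_inj1 Y f"
abbreviation "j2X \<equiv> glue_inj2 Y f :: 'y \<Rightarrow> ('x + 'y) set"

abbreviation "chartC \<equiv> glue_chart C1 SC F C2"
abbreviation "chartE \<equiv> glue_chart (total E1) SE g (total E2)"

lemma f_inj: "inj_on f Y"
proof -
  have "bij_betw f (points (base E1) \<inter> Y) (points (base E2) \<inter> f ` Y)" "Y \<subseteq> points (base E1)"
    using gluing by (simp_all add: bundle_gluing_def diffeomorphism_def sub_dspace_def)
  then show ?thesis by (simp add: bij_betw_def Int_absorb1)
qed

lemma mem_SC: "v \<in> SC \<longleftrightarrow> v \<in> points C1 \<and> fst v \<in> Y" and mem_SE: "e \<in> SE \<longleftrightarrow> e \<in> points (total E1) \<and> proj E1 e \<in> Y"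
  by (auto simp: over_def)

lemma g_points: "e \<in> SE \<Longrightarrow> g e \<in> points (total E2) \<and> proj E2 (g e) = f (proj E1 e)"
  using gluing by (force simp: bundle_gluing_def smooth_map_def sub_dspace_def over_def)

lemma g_plots: "plots (total E1) n U p \<Longrightarrow> (\<And>u. u \<in> U \<Longrightarrow> p u \<in> SE) \<Longrightarrow> plots (total E2) n U (g \<circ> p)"
  using gluing by (simp add: bundle_gluing_def smooth_map_def sub_dspace_def image_subset_iff)

lemma total_E: "total E = glue_dspace (total E1) SE g (total E2)"
  and base_E: "base E = glue_dspace (base E1) Y f (base E2)"
  by (simp_all add: glue_bundle_def Let_def)

lemma points_E: "points (total E) = j1E ` points (total E1) \<union> j2E ` points (total E2)"
  by (simp add: total_E points_glue_dspace)

lemma points_E_cases [consumes 1]: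
  assumes "D \<in> points (total E)"
  obtains (1) e where "e \<in> points (total E1)" "D = j1E e" | (2) h where "h \<in> points (total E2)" "D = j2E h"
  using assms unfolding points_E by blast

lemma proj_E1: "proj E (j1E e) = j1X (proj E1 e)" and proj_E2: "proj E (j2E h) = j2X (proj E2 h)"
proof -
  have "proj E (glue_class SE g z) = glue_class Y f (map_sum (proj E1) (proj E2) z)" for z
    unfolding glue_bundle_def Let_def vbundle.simps
    by (rule glue_proj_class) (use g_points mem_SE in auto)
  then show "proj E (j1E e) = j1X (proj E1 e)" "proj E (j2E h) = j2X (proj E2 h)"
    by (simp_all add: glue_inj1_def glue_inj2_def)
qed

lemma fst_c: "fst (c (j1C v)) = j1X (fst v)" "fst (c (j2C w)) = j2X (fst w)"
proof -
  have "glue_proj Y f fst fst (glue_class SC F z) = glue_class Y f (map_sum fst fst z)" for z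
    by (rule glue_proj_class) (use F_points mem_SC in auto)
  then show "fst (c (j1C v)) = j1X (fst v)" "fst (c (j2C w)) = j2X (fst w)"
    by (simp_all add: induced_action_def Let_def glue_inj1_def glue_inj2_def)
qed

lemma c1_end: "v \<in> points C1 \<Longrightarrow> snd (c1 v) \<in> smooth_end E1 (fst v) \<and> fst v \<in> points (base E1)"
  and c2_end: "w \<in> points C2 \<Longrightarrow> snd (c2 w) \<in> smooth_end E2 (fst w) \<and> fst w \<in> points (base E2)"
  using action_values[OF c1 fst_c1] action_values[OF c2 fst_c2] by blast+

lemma c_j2:
  assumes v: "v \<in> points C2" and e: "e \<in> points (total E2)" "proj E2 e = fst v"
  shows "snd (c (j2C v)) (j2E e) = j2E (snd (c2 v) e)"
proof -
  have "j2E e \<in> carrier (fibre E (fst (c (j2C v))))"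
    using e by (auto simp: carrier_fibre points_E proj_E2 fst_c)
  then show ?thesis
    using v e(1) by (simp add: induced_action_def Let_def glue_inj2_notin_image inv_glue_inj2)
qed

text \<open>Over \<open>Y\<close> the action is computed in the second piece, and the compatibility condition says that
  the first piece gives the same result.\<close>

lemma c_j1:
  assumes v: "v \<in> points C1" and e: "e \<in> points (total E1)" "proj E1 e = fst v"
  shows "snd (c (j1C v)) (j1E e) = j1E (snd (c1 v) e)"
proof (cases "fst v \<in> Y")
  case True
  then have vS: "v \<in> SC" and eS: "e \<in> SE" using v e by (auto simp: mem_SC mem_SE)
  have "snd (c1 v) e \<in> SE"
    using smooth_end_apply[of "snd (c1 v)" E1 "fst v" e] c1_end[OF v] e True by (auto simp: mem_SE)
  then have "j1E (snd (c1 v) e) = j2E (snd (c2 (F v)) (g e))"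
    using compatible[OF v True] e by (simp add: glue_inj1_glued carrier_fibre)
  also have "\<dots> = snd (c (j2C (F v))) (j2E (g e))"
    using F_points[OF v True] g_points[OF eS] e by (intro c_j2[symmetric]) auto
  also have "\<dots> = snd (c (j1C v)) (j1E e)"
    using vS eS by (simp add: glue_inj1_glued)
  finally show ?thesis by simp
next
  case False
  then have vS: "v \<in> points C1 - SC" and eS: "e \<in> points (total E1) - SE" using v e by (auto simp: mem_SC mem_SE)
  have "j1E e \<in> carrier (fibre E (fst (c (j1C v))))"
    using e by (auto simp: carrier_fibre points_E proj_E1 fst_c)
  then show ?thesis
    using vS eS by (simp add: induced_action_def Let_def inv_glue_inj1[OF vS] inv_glue_inj1[OF eS])
qed

lemma stable_E: "stable_plots (plots (total E))"
  unfolding total_E by (intro stable_glue_dspace pseudo_bundleD(4)[OF E1] pseudo_bundleD(4)[OF E2])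

lemma plots_E_iff: "plots (total E) n U p \<longleftrightarrow> open_dom n U \<and>
    (\<forall>u\<in>U. \<exists>W. open_dom n W \<and> u \<in> W \<and> W \<subseteq> U \<and>
      chartE n W p)"
  unfolding total_E by (rule plots_glue_dspace_iff[OF pseudo_bundleD(4)[OF E1] pseudo_bundleD(4)[OF E2]])

lemma plots_C_iff: "plots C n U p \<longleftrightarrow> open_dom n U \<and>
    (\<forall>u\<in>U. \<exists>W. open_dom n W \<and> u \<in> W \<and> W \<subseteq> U \<and> chartC n W p)"
  by (rule plots_glue_dspace_iff[OF C1_stable C2_stable])

lemma glue_chart_subset:
  assumes "glue_chart A S k B n W p" "stable_plots (plots A)" "stable_plots (plots B)"
    "open_dom n W'" "W' \<subseteq> W"
  shows "glue_chart A S k B n W' p"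
  using assms(1) unfolding glue_chart_def
  using stable_plots_restrict[OF assms(2) _ assms(4,5)] stable_plots_restrict[OF assms(3) _ assms(4,5)] assms(5)
  by blast

lemma eval_chart2:
  assumes q: "plots C2 n W q" "\<And>w. w \<in> W \<Longrightarrow> P w = j2C (q w)"
    and r: "plots (total E2) n W r" "\<And>w. w \<in> W \<Longrightarrow> e w = j2E (r w)"
    and base: "\<And>w. w \<in> W \<Longrightarrow> fst (c (P w)) = proj E (e w)"
  shows "chartE n W (\<lambda>w. snd (c (P w)) (e w))"
proof -
  have b: "fst (q w) = proj E2 (r w)" if "w \<in> W" for w
    using base[OF that] by (simp add: q(2)[OF that] r(2)[OF that] fst_c proj_E2 glue_inj2_eq_inj2)
  have "snd (c (P w)) (e w) = j2E (snd (c2 (q w)) (r w))" if "w \<in> W" for w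
    unfolding q(2)[OF that] r(2)[OF that]
    using C2_points[OF q(1) that] pseudo_bundleD(6)[OF E2 r(1) that] b[OF that] by (intro c_j2) auto
  then show ?thesis
    unfolding glue_chart_def using action_plot_eval[OF E2 c2 fst_c2[OF C2_points[OF q(1)]] q(1) r(1) b] by blast
qed

text \<open>A plot \<open>P\<close> of the glued family and a plot \<open>e\<close> of the glued bundle may come from different
  pieces. As they lie over the same points, they then both lie over the glued part of the base,
  where \<open>F\<close> or \<open>g\<close> moves the one that comes from the first piece to the second.\<close>

lemma eval_chart:
  assumes P: "chartC n W P" and e: "chartE n W e"
    and base: "\<And>w. w \<in> W \<Longrightarrow> fst (c (P w)) = proj E (e w)"
  shows "chartE n W (\<lambda>w. snd (c (P w)) (e w))"
proof -
  consider (11) q r where "plots C1 n W q" "\<And>w. w \<in> W \<Longrightarrow> P w = j1C (q w)"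
      "plots (total E1) n W r" "\<And>w. w \<in> W \<Longrightarrow> e w = j1E (r w)"
    | (12) q r where "plots C1 n W q" "\<And>w. w \<in> W \<Longrightarrow> P w = j1C (q w)"
      "plots (total E2) n W r" "\<And>w. w \<in> W \<Longrightarrow> e w = j2E (r w)"
    | (21) q r where "plots C2 n W q" "\<And>w. w \<in> W \<Longrightarrow> P w = j2C (q w)"
      "plots (total E1) n W r" "\<And>w. w \<in> W \<Longrightarrow> e w = j1E (r w)"
    | (22) q r where "plots C2 n W q" "\<And>w. w \<in> W \<Longrightarrow> P w = j2C (q w)"
      "plots (total E2) n W r" "\<And>w. w \<in> W \<Longrightarrow> e w = j2E (r w)"
    using P e unfolding glue_chart_def by meson
  then show ?thesis
  proof cases
    case 11
    have b: "fst (q w) = proj E1 (r w)" if "w \<in> W" for w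
      using base[OF that] by (simp add: 11(2)[OF that] 11(4)[OF that] fst_c proj_E1 glue_inj1_eq_inj1_inj[OF f_inj])
    have "snd (c (P w)) (e w) = j1E (snd (c1 (q w)) (r w))" if "w \<in> W" for w
      unfolding 11(2)[OF that] 11(4)[OF that]
      using C1_points[OF 11(1) that] pseudo_bundleD(6)[OF E1 11(3) that] b[OF that] by (intro c_j1) auto
    then show ?thesis
      unfolding glue_chart_def using action_plot_eval[OF E1 c1 fst_c1[OF C1_points[OF 11(1)]] 11(1) 11(3) b] by blast
  next
    case 12
    have q: "fst (q w) \<in> Y" if "w \<in> W" for w
      using base[OF that] by (simp add: 12(2)[OF that] 12(4)[OF that] fst_c proj_E2 glue_inj1_eq_inj2)
    show ?thesis
    proof (rule eval_chart2[OF F_plots[OF 12(1) q] _ 12(3,4) base])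
      show "P w = j2C ((F \<circ> q) w)" if "w \<in> W" for w
        using 12(2)[OF that] q[OF that] C1_points[OF 12(1) that] by (simp add: glue_inj1_glued mem_SC)
    qed
  next
    case 21
    have r: "r w \<in> SE" if "w \<in> W" for w
    proof -
      have "j1X (proj E1 (r w)) = j2X (fst (q w))"
        using base[OF that] by (simp add: 21(2)[OF that] 21(4)[OF that] fst_c proj_E1)
      then show ?thesis
        using pseudo_bundleD(6)[OF E1 21(3) that] by (simp add: glue_inj1_eq_inj2 mem_SE)
    qed
    show ?thesis
    proof (rule eval_chart2[OF 21(1,2) g_plots[OF 21(3) r] _ base])
      show "e w = j2E ((g \<circ> r) w)" if "w \<in> W" for w
        using 21(4)[OF that] r[OF that] by (simp add: glue_inj1_glued)
    qed
  next
    case 22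
    show ?thesis by (rule eval_chart2[OF 22 base])
  qed
qed

lemma eval_plots:
  assumes P: "plots C n U P" and e: "plots (total E) n U e"
    and base: "\<And>u. u \<in> U \<Longrightarrow> fst (c (P u)) = proj E (e u)"
  shows "plots (total E) n U (\<lambda>u. snd (c (P u)) (e u))"
  unfolding plots_E_iff
proof (intro conjI ballI)
  show "open_dom n U" using P by (simp add: plots_C_iff)
  fix u assume u: "u \<in> U"
  obtain W1 where W1: "open_dom n W1" "u \<in> W1" "W1 \<subseteq> U" "chartC n W1 P"
    using P u unfolding plots_C_iff by blast
  obtain W2 where W2: "open_dom n W2" "u \<in> W2" "W2 \<subseteq> U"
    "chartE n W2 e"
    using e u unfolding plots_E_iff by blast
  have W: "open_dom n (W1 \<inter> W2)" using W1(1) W2(1) by (rule openin_Int)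
  have "chartE n (W1 \<inter> W2) (\<lambda>w. snd (c (P w)) (e w))"
    by (rule eval_chart[OF glue_chart_subset[OF W1(4) C1_stable C2_stable W]
          glue_chart_subset[OF W2(4) pseudo_bundleD(4)[OF E1] pseudo_bundleD(4)[OF E2] W]])
      (use base W1 in auto)
  then show "\<exists>W. open_dom n W \<and> u \<in> W \<and> W \<subseteq> U \<and>
      chartE n W (\<lambda>w. snd (c (P w)) (e w))"
    using W W1 W2 by blast
qed

subsection \<open>The values of the induced action\<close>

lemma fibre_E1:
  assumes "x \<notin> Y" shows "carrier (fibre E (j1X x)) = j1E ` carrier (fibre E1 x)"
proof (intro equalityI subsetI)
  fix D assume "D \<in> carrier (fibre E (j1X x))"
  then have D: "D \<in> points (total E)" "proj E D = j1X x" by (simp_all add: carrier_fibre)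
  from D(1) show "D \<in> j1E ` carrier (fibre E1 x)"
  proof (cases rule: points_E_cases)
    case (1 e)
    then have "proj E1 e = x" using D(2) by (simp add: proj_E1 glue_inj1_eq_inj1_inj[OF f_inj])
    with 1 show ?thesis by (auto simp: carrier_fibre)
  next
    case (2 h)
    then have "j1X x = j2X (proj E2 h)" using D(2) by (simp add: proj_E2)
    with assms show ?thesis by (simp add: glue_inj1_eq_inj2)
  qed
qed (auto simp: carrier_fibre points_E proj_E1)

lemma fibre_E2: "carrier (fibre E (j2X x)) = j2E ` carrier (fibre E2 x)"
proof (intro equalityI subsetI)
  fix D assume "D \<in> carrier (fibre E (j2X x))"
  then have D: "D \<in> points (total E)" "proj E D = j2X x" by (simp_all add: carrier_fibre)
  from D(1) show "D \<in> j2E ` carrier (fibre E2 x)"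
  proof (cases rule: points_E_cases)
    case (1 e)
    then have "j1X (proj E1 e) = j2X x" using D(2) by (simp add: proj_E1)
    then have e: "e \<in> SE" "f (proj E1 e) = x" using 1 by (simp_all add: glue_inj1_eq_inj2 mem_SE)
    then have "D = j2E (g e)" "g e \<in> carrier (fibre E2 x)"
      using 1 g_points[OF e(1)] by (simp_all add: glue_inj1_glued carrier_fibre)
    then show ?thesis by blast
  next
    case (2 h)
    then have "proj E2 h = x" using D(2) by (simp add: proj_E2 glue_inj2_eq_inj2)
    with 2 show ?thesis by (auto simp: carrier_fibre)
  qed
qed (auto simp: carrier_fibre points_E proj_E2)

lemma vadd_E1: "\<lbrakk>e \<in> points (total E1) - SE; e' \<in> points (total E1) - SE\<rbrakk>
    \<Longrightarrow> vadd E (j1E e) (j1E e') = j1E (vadd E1 e e')"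
  and vscale_E1: "e \<in> points (total E1) - SE \<Longrightarrow> vscale E a (j1E e) = j1E (vscale E1 a e)"
  and vadd_E2: "\<lbrakk>h \<in> points (total E2); h' \<in> points (total E2)\<rbrakk>
    \<Longrightarrow> vadd E (j2E h) (j2E h') = j2E (vadd E2 h h')"
  and vscale_E2: "h \<in> points (total E2) \<Longrightarrow> vscale E a (j2E h) = j2E (vscale E2 a h)"
  by (simp_all add: glue_bundle_def Let_def inv_glue_inj1 inv_glue_inj2 glue_inj2_notin_image)

lemma c_extensional: "snd (c v) \<in> extensional (carrier (fibre E (fst (c v))))"
  by (simp add: induced_action_def Let_def)

lemma plots_E_local: "local_plot (plots (total E)) n U p \<Longrightarrow> plots (total E) n U p"
  by (simp add: total_E glue_dspace_def quot_dspace_def local_plot_idem)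

lemma plots_E1: "plots (total E1) n U r \<Longrightarrow> plots (total E) n U (j1E \<circ> r)"
  and plots_E2: "plots (total E2) n U r' \<Longrightarrow> plots (total E) n U (j2E \<circ> r')"
  unfolding plots_E_iff glue_chart_def
  using stable_plots_open[OF pseudo_bundleD(4)[OF E1]] stable_plots_open[OF pseudo_bundleD(4)[OF E2]]
  by fastforce+

lemma smooth_end_j2:
  assumes v: "v \<in> points C2"
  shows "snd (c (j2C v)) \<in> smooth_end E (fst (c (j2C v)))"
  unfolding fst_c
proof (rule smooth_end_transport)
  show "snd (c2 v) \<in> smooth_end E2 (fst v)" "module real_alg (fibre E2 (fst v))"
    using c2_end[OF v] pseudo_bundleD(7)[OF E2] by blast+
  show "carrier (fibre E (j2X (fst v))) = j2E ` carrier (fibre E2 (fst v))" by (rule fibre_E2)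
  show "snd (c (j2C v)) \<in> extensional (carrier (fibre E (j2X (fst v))))"
    using c_extensional[of "j2C v"] by (simp only: fst_c)
  show "snd (c (j2C v)) (j2E e) = j2E (snd (c2 v) e)" if "e \<in> carrier (fibre E2 (fst v))" for e
    using that v by (intro c_j2) (auto simp: carrier_fibre)
  show "vadd E (j2E e) (j2E e') = j2E (vadd E2 e e')"
    if "e \<in> carrier (fibre E2 (fst v))" "e' \<in> carrier (fibre E2 (fst v))" for e e'
    using that by (simp add: vadd_E2 carrier_fibre)
  show "vscale E a (j2E e) = j2E (vscale E2 a e)" if "e \<in> carrier (fibre E2 (fst v))" for a e
    using that by (simp add: vscale_E2 carrier_fibre)
  show "plots (total E) n U p" if "local_plot (plots (total E)) n U p" for n U p
    using that by (rule plots_E_local)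
  show "open_dom n U" if "plots (total E) n U p" for n U p
    using that by (rule stable_plots_open[OF stable_E])
  show "plots (total E) n U (j2E \<circ> r)" if "plots (total E2) n U r" for n U r
    using that by (rule plots_E2)
  fix n U p u
  assume p: "plots (total E) n U p" "p ` U \<subseteq> carrier (fibre E (j2X (fst v)))" and u: "u \<in> U"
  then obtain W where W: "open_dom n W" "u \<in> W" "W \<subseteq> U"
    "chartE n W p"
    unfolding plots_E_iff by blast
  have pW: "p w \<in> carrier (fibre E (j2X (fst v)))" if "w \<in> W" for w
    using p(2) W(3) that by blast
  have "\<exists>r. plots (total E2) n W r \<and> (\<forall>w\<in>W. p w = j2E (r w))"
    using W(4) unfolding glue_chart_def
  proof (elim disjE exE conjE)
    fix r assume r: "plots (total E1) n W r" "\<forall>w\<in>W. p w = j1E (r w)"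
    have rS: "r w \<in> SE" if "w \<in> W" for w
    proof -
      have "j1X (proj E1 (r w)) = j2X (fst v)"
        using pW[OF that] r(2) that by (simp add: carrier_fibre proj_E1)
      then show ?thesis
        using pseudo_bundleD(6)[OF E1 r(1) that] by (simp add: glue_inj1_eq_inj2 mem_SE)
    qed
    have "plots (total E2) n W (g \<circ> r)" by (rule g_plots[OF r(1) rS])
    moreover have "\<forall>w\<in>W. p w = j2E ((g \<circ> r) w)" using r(2) rS by (simp add: glue_inj1_glued)
    ultimately show ?thesis by blast
  qed blast
  then obtain r where r: "plots (total E2) n W r" "\<And>w. w \<in> W \<Longrightarrow> p w = j2E (r w)" by blast
  have "r w \<in> carrier (fibre E2 (fst v))" if "w \<in> W" for w
    using pW[OF that] pseudo_bundleD(6)[OF E2 r(1) that]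
    by (simp add: r(2)[OF that] carrier_fibre proj_E2 glue_inj2_eq_inj2)
  then show "\<exists>W r. open_dom n W \<and> u \<in> W \<and> W \<subseteq> U \<and> plots (total E2) n W r \<and>
      r ` W \<subseteq> carrier (fibre E2 (fst v)) \<and> (\<forall>w\<in>W. p w = j2E (r w))"
    using W r by blast
qed

lemma smooth_end_j1:
  assumes v: "v \<in> points C1" and vY: "fst v \<notin> Y"
  shows "snd (c (j1C v)) \<in> smooth_end E (fst (c (j1C v)))"
  unfolding fst_c
proof (rule smooth_end_transport)
  show "snd (c1 v) \<in> smooth_end E1 (fst v)" "module real_alg (fibre E1 (fst v))"
    using c1_end[OF v] pseudo_bundleD(7)[OF E1] by blast+
  show "carrier (fibre E (j1X (fst v))) = j1E ` carrier (fibre E1 (fst v))" by (rule fibre_E1[OF vY])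
  show "snd (c (j1C v)) \<in> extensional (carrier (fibre E (j1X (fst v))))"
    using c_extensional[of "j1C v"] by (simp only: fst_c)
  show "snd (c (j1C v)) (j1E e) = j1E (snd (c1 v) e)" if "e \<in> carrier (fibre E1 (fst v))" for e
    using that v by (intro c_j1) (auto simp: carrier_fibre)
  show "vadd E (j1E e) (j1E e') = j1E (vadd E1 e e')"
    if "e \<in> carrier (fibre E1 (fst v))" "e' \<in> carrier (fibre E1 (fst v))" for e e'
    using that vY by (simp add: vadd_E1 carrier_fibre mem_SE)
  show "vscale E a (j1E e) = j1E (vscale E1 a e)" if "e \<in> carrier (fibre E1 (fst v))" for a e
    using that vY by (simp add: vscale_E1 carrier_fibre mem_SE)
  show "plots (total E) n U p" if "local_plot (plots (total E)) n U p" for n U p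
    using that by (rule plots_E_local)
  show "open_dom n U" if "plots (total E) n U p" for n U p
    using that by (rule stable_plots_open[OF stable_E])
  show "plots (total E) n U (j1E \<circ> r)" if "plots (total E1) n U r" for n U r
    using that by (rule plots_E1)
  fix n U p u
  assume p: "plots (total E) n U p" "p ` U \<subseteq> carrier (fibre E (j1X (fst v)))" and u: "u \<in> U"
  then obtain W where W: "open_dom n W" "u \<in> W" "W \<subseteq> U"
    "chartE n W p"
    unfolding plots_E_iff by blast
  have pW: "p w \<in> carrier (fibre E (j1X (fst v)))" if "w \<in> W" for w
    using p(2) W(3) that by blast
  have "\<exists>r. plots (total E1) n W r \<and> (\<forall>w\<in>W. p w = j1E (r w))"
    using W(4) unfolding glue_chart_def
  proof (elim disjE exE conjE)
    fix r assume r: "plots (total E2) n W r" "\<forall>w\<in>W. p w = j2E (r w)"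
    have "j1X (fst v) = j2X (proj E2 (r u))"
      using pW[OF W(2)] r(2) W(2) by (simp add: carrier_fibre proj_E2)
    then show ?thesis using vY by (simp add: glue_inj1_eq_inj2)
  qed blast
  then obtain r where r: "plots (total E1) n W r" "\<And>w. w \<in> W \<Longrightarrow> p w = j1E (r w)" by blast
  have "r w \<in> carrier (fibre E1 (fst v))" if "w \<in> W" for w
    using pW[OF that] pseudo_bundleD(6)[OF E1 r(1) that]
    by (simp add: r(2)[OF that] carrier_fibre proj_E1 glue_inj1_eq_inj1_inj[OF f_inj])
  then show "\<exists>W r. open_dom n W \<and> u \<in> W \<and> W \<subseteq> U \<and> plots (total E1) n W r \<and>
      r ` W \<subseteq> carrier (fibre E1 (fst v)) \<and> (\<forall>w\<in>W. p w = j1E (r w))"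
    using W r by blast
qed

lemma c_values:
  assumes "v \<in> points C"
  shows "c v \<in> (SIGMA x : points (base E). smooth_end E x)"
proof -
  consider (1) w where "w \<in> points C1" "fst w \<notin> Y" "v = j1C w" | (2) w where "w \<in> points C2" "v = j2C w"
  proof -
    from assms have "(\<exists>w\<in>points C1. v = j1C w) \<or> (\<exists>w\<in>points C2. v = j2C w)"
      by (auto simp: points_glue_dspace)
    then show thesis
    proof (elim disjE bexE)
      fix w assume w: "w \<in> points C1" "v = j1C w"
      show thesis
      proof (cases "fst w \<in> Y")
        case True
        then show thesis
          using that(2)[of "F w"] F_points[OF w(1) True] w by (simp add: glue_inj1_glued mem_SC)
      qed (use that(1) w in blast)
    qed (use that(2) in blast)
  qed
  then have "fst (c v) \<in> points (base E) \<and> snd (c v) \<in> smooth_end E (fst (c v))"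
  proof cases
    case 1
    then show ?thesis
      using smooth_end_j1[OF 1(1,2)] c1_end[OF 1(1)] by (simp add: fst_c base_E points_glue_dspace)
  next
    case 2
    then show ?thesis
      using smooth_end_j2[OF 2(1)] c2_end[OF 2(1)] by (simp add: fst_c base_E points_glue_dspace)
  qed
  then show ?thesis by (metis mem_Sigma_iff prod.collapse)
qed

lemma points_plots_C: "plots C n U P \<Longrightarrow> u \<in> U \<Longrightarrow> P u \<in> points C"
  unfolding plots_C_iff points_glue_dspace glue_chart_def using C1_points C2_points by blast

lemma points_plots_E: "plots (total E) n U P \<Longrightarrow> u \<in> U \<Longrightarrow> P u \<in> points (total E)"
  unfolding plots_E_iff points_E glue_chart_def
  using pseudo_bundleD(6)[OF E1] pseudo_bundleD(6)[OF E2] by blast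

lemma smooth_induced_action: "smooth_map C (end_dspace E) c"
  unfolding smooth_map_def points_end_dspace
proof (intro conjI allI impI)
  show "c ` points C \<subseteq> (SIGMA x : points (base E). smooth_end E x)" using c_values by blast
  fix n U P assume P: "plots C n U P"
  have U: "open_dom n U" using P by (simp add: plots_C_iff)
  have vals: "c (P u) \<in> (SIGMA x : points (base E). smooth_end E x)" if "u \<in> U" for u
    by (rule c_values[OF points_plots_C[OF P that]])
  have "smooth_map (same_base E n U (c \<circ> P) m W q) (total E) (\<lambda>(u, w). snd ((c \<circ> P) u) (q w))"
    if q: "plots (total E) m W q" for m W q
    unfolding smooth_map_def
  proof (intro conjI allI impI)
    show "(\<lambda>(u, w). snd ((c \<circ> P) u) (q w)) ` points (same_base E n U (c \<circ> P) m W q) \<subseteq> points (total E)"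
    proof (rule image_subsetI, clarify)
      fix u w assume "(u, w) \<in> points (same_base E n U (c \<circ> P) m W q)"
      then have uw: "u \<in> U" "w \<in> W" "fst (c (P u)) = proj E (q w)"
        by (simp_all add: same_base_def sub_dspace_def)
      have "snd (c (P u)) \<in> smooth_end E (fst (c (P u)))" using vals[OF uw(1)] by force
      then show "snd ((c \<circ> P) u) (q w) \<in> points (total E)"
        using smooth_end_apply(1)[OF _ points_plots_E[OF q uw(2)]] uw(3) by simp
    qed
    fix k Z r assume "plots (same_base E n U (c \<circ> P) m W q) k Z r"
    note r = plots_same_baseD[OF this]
    have "plots C k Z (P \<circ> (fst \<circ> r))"
      by (rule stable_plots_compose[OF stable_glue_dspace[OF C1_stable C2_stable] P r(1,2)])
    moreover have "plots (total E) k Z (q \<circ> (snd \<circ> r))"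
      by (rule stable_plots_compose[OF stable_E q r(1,3)])
    ultimately have "plots (total E) k Z (\<lambda>z. snd (c ((P \<circ> (fst \<circ> r)) z)) ((q \<circ> (snd \<circ> r)) z))"
      by (rule eval_plots) (use r(4) in simp)
    then show "plots (total E) k Z ((\<lambda>(u, w). snd ((c \<circ> P) u) (q w)) \<circ> r)"
      by (simp add: o_def split_beta)
  qed
  moreover have "(c \<circ> P) ` U \<subseteq> (SIGMA x : points (base E). smooth_end E x)"
    by (rule image_subsetI) (simp only: o_apply vals)
  ultimately show "plots (end_dspace E) n U (c \<circ> P)"
    using U by (intro end_dspace_plotI) (simp add: end_generator_def)
qed

end

section \<open>The algebra of formal combinations of words\<close>

text \<open>With lists as a monoid under concatenation, the ring structure of \<^typ>\<open>'k \<Rightarrow>\<^sub>0 real\<close> for a monoid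
  of exponents becomes the free associative algebra of words; its product is \<^const>\<open>concat_mult\<close>,
  and \<open>single [] c\<close> is the scalar \<open>c\<close>.\<close>

alias single = Poly_Mapping.single
alias keys = Poly_Mapping.keys
alias lookup = Poly_Mapping.lookup

instantiation list :: (type) monoid_add
begin
definition zero_list :: "'a list" where "zero_list = []"
definition plus_list :: "'a list \<Rightarrow> 'a list \<Rightarrow> 'a list" where "plus_list = (@)"
instance by standard (simp_all add: zero_list_def plus_list_def)
end

lemma map_scale: "Poly_Mapping.map ((*) c) p = single [] c * (p :: 'v list \<Rightarrow>\<^sub>0 real)"
  by (simp add: mult_map_scale_conv_mult zero_list_def)

lemma single_mult_single:
  "single k a * single l b
     = single (k @ l) (a * b :: real)"
  by (simp add: mult_single plus_list_def)

lemma one_eq_single: "(1 :: 'v list \<Rightarrow>\<^sub>0 real) = single [] 1"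
  by (metis single_one zero_list_def)

lemma lookup_scale: "lookup (single [] c * p) k = c * lookup (p :: 'v list \<Rightarrow>\<^sub>0 real) k"
  by (simp flip: map_scale add: Poly_Mapping.map.rep_eq when_def)

lemma poly_mapping_as_sum:
  "p = (\<Sum>k\<in>keys p. single k (lookup p k))"
proof (rule poly_mapping_eqI)
  fix k
  show "lookup p k = lookup (\<Sum>k\<in>keys p. single k (lookup p k)) k"
    by (simp add: lookup_sum lookup_single when_def in_keys_iff)
qed

lemma concat_mult_eq: "concat_mult p q = p * q"
proof -
  have "p * q = (\<Sum>k\<in>keys p. single k (lookup p k))
      * (\<Sum>k\<in>keys q. single k (lookup q k))"
    by (rule arg_cong2[where f = "(*)"]; rule poly_mapping_as_sum)
  then show ?thesis
    by (simp add: concat_mult_def sum_product single_mult_single)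
qed

text \<open>Induction over combinations of words from a given set.\<close>

lemma combination_induct [consumes 1, case_names zero single add]:
  assumes "keys p \<subseteq> S"
    and "P 0"
    and "\<And>k c. k \<in> S \<Longrightarrow> P (single k c)"
    and "\<And>p q. \<lbrakk>keys p \<subseteq> S; keys q \<subseteq> S; P p; P q\<rbrakk> \<Longrightarrow> P (p + q)"
  shows "P (p :: 'v \<Rightarrow>\<^sub>0 real)"
proof -
  have "P (\<Sum>k\<in>A. single k (lookup p k)) \<and>
      keys (\<Sum>k\<in>A. single k (lookup p k)) \<subseteq> S"
    if "finite A" "A \<subseteq> S" for A
    using that
  proof (induction A rule: finite_induct)
    case (insert a A)
    have s: "keys (single a (lookup p a)) \<subseteq> S"
      using insert.prems by simp
    have "a \<in> S" and IH: "P (\<Sum>k\<in>A. single k (lookup p k))"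
        "keys (\<Sum>k\<in>A. single k (lookup p k)) \<subseteq> S"
      using insert by auto
    then show ?case
      using insert.hyps s assms(4)[OF s IH(2) assms(3) IH(1)]
        subset_trans[OF keys_add Un_least[OF s IH(2)]] by simp
  qed (simp add: assms(2))
  from this[of "keys p"] show ?thesis
    using assms(1) by (simp flip: poly_mapping_as_sum)
qed

lemma scale_central:
  "single [] c * (p * q) = p * (single [] c * (q :: 'v list \<Rightarrow>\<^sub>0 real))"
proof -
  have "keys p \<subseteq> UNIV" by simp
  then have "p * single [] c = single [] c * p"
    by (induction p rule: combination_induct)
      (simp_all add: single_mult_single distrib_left distrib_right mult.commute)
  then show ?thesis
    by (metis mult.assoc)
qed

text \<open>The homogeneous component of degree \<open>r\<close>, i.e. the part consisting of words of length \<open>r\<close>.\<close>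

lift_definition word_part :: "nat \<Rightarrow> ('v list \<Rightarrow>\<^sub>0 real) \<Rightarrow> ('v list \<Rightarrow>\<^sub>0 real)"
  is "\<lambda>r f k. if length k = r then f k else 0"
  by (rule finite_subset) auto

lemma word_part_add: "word_part r (p + q) = word_part r p + word_part r q"
  by (rule poly_mapping_eqI) (simp add: word_part.rep_eq lookup_add)

lemma word_part_zero [simp]: "word_part r 0 = 0"
  by (rule poly_mapping_eqI) (simp add: word_part.rep_eq)

lemma word_part_sum: "word_part r (sum g A) = (\<Sum>a\<in>A. word_part r (g a))"
  by (induction A rule: infinite_finite_induct) (simp_all add: word_part_add)

lemma word_part_single:
  "word_part r (single k c) = (if length k = r then single k c else 0)"
  by (rule poly_mapping_eqI) (simp add: word_part.rep_eq lookup_single when_def)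

lemma word_part_scale: "word_part r (single [] c * p) = single [] c * word_part r p"
  by (rule poly_mapping_eqI) (simp add: word_part.rep_eq lookup_scale)

lemma keys_word_part: "keys (word_part r p) = {k \<in> keys p. length k = r}"
  by (auto simp: in_keys_iff word_part.rep_eq split: if_splits)

lemma word_part_homogeneous:
  assumes "keys p \<subseteq> {l. length l = s}"
  shows "word_part r p = (if r = s then p else 0)"
proof (rule poly_mapping_eqI)
  fix k
  show "lookup (word_part r p) k = lookup (if r = s then p else 0) k"
    using assms by (auto simp: word_part.rep_eq in_keys_iff subset_iff)
qed

lemma word_part_mult:
  "word_part r (p * q) = (\<Sum>i\<le>r. word_part i p * word_part (r - i) q)"
proof -
  have "keys p \<subseteq> UNIV" by simp
  then show ?thesis
  proof (induction p rule: combination_induct)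
    case (single k c)
    have "keys q \<subseteq> UNIV" by simp
    then show ?case
    proof (induction q rule: combination_induct)
      case (single l d)
      have "(\<Sum>i\<le>r. word_part i (single k c) * word_part (r - i) (single l d))
         = (\<Sum>i\<le>r. if i = length k then if length k + length l = r then single (k @ l) (c * d) else 0 else 0)"
        by (rule sum.cong) (auto simp: word_part_single single_mult_single)
      also have "\<dots> = (if length k + length l = r then single (k @ l) (c * d) else 0)"
        by (simp add: sum.delta)
      finally show ?case
        by (simp add: single_mult_single word_part_single)
    qed (simp_all add: distrib_left word_part_add sum.distrib)
  qed (simp_all add: distrib_right word_part_add sum.distrib)
qed

section \<open>Free modules and tensor powers\<close>

lemma free_module_simps [simp]:
  "carrier (free_module S) = {p. keys p \<subseteq> S}"
  "zero (free_module S) = 0" "add (free_module S) = (+)"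
  "smult (free_module S) = (\<lambda>c. Poly_Mapping.map ((*) c))"
  by (simp_all add: free_module_def)

lemma keys_scale: "keys (single [] c * p) \<subseteq> keys (p :: 'v list \<Rightarrow>\<^sub>0 real)"
  by (auto simp: in_keys_iff lookup_scale)

lemma uminus_scale: "- p = single [] (-1) * (p :: 'v list \<Rightarrow>\<^sub>0 real)"
  by (rule poly_mapping_eqI) (simp add: lookup_scale)

lemma submodule_free_iff:
  fixes S :: "'v list set"
  shows "submodule H real_alg (free_module S) \<longleftrightarrow>
    H \<subseteq> {p. keys p \<subseteq> S} \<and> 0 \<in> H \<and> (\<forall>p\<in>H. \<forall>q\<in>H. p + q \<in> H) \<and>
    (\<forall>c. \<forall>p\<in>H. single [] c * p \<in> H)" (is "?L \<longleftrightarrow> ?R")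
proof
  assume ?L
  then interpret submodule H real_alg "free_module S" .
  show ?R
  proof (intro conjI ballI allI)
    show "H \<subseteq> {p. keys p \<subseteq> S}" using subset by simp
    show "0 \<in> H" using one_closed by simp
    show "p + q \<in> H" if "p \<in> H" "q \<in> H" for p q
      using m_closed[OF that] by simp
    show "single [] c * p \<in> H" if "p \<in> H" for c p
      using smult_closed[of c p] that by (simp add: real_alg_def map_scale)
  qed
next
  assume R: ?R
  let ?G = "add_monoid (free_module S)"
  have inv: "inv\<^bsub>?G\<^esub> p = - p" if "p \<in> H" for p
  proof -
    have "- p \<in> H" using R that uminus_scale by metis
    then have k: "keys p \<subseteq> S" "keys (- p) \<subseteq> S"
      using R that by auto
    have "(THE q. q \<in> carrier ?G \<and> p \<otimes>\<^bsub>?G\<^esub> q = \<one>\<^bsub>?G\<^esub> \<and> q \<otimes>\<^bsub>?G\<^esub> p = \<one>\<^bsub>?G\<^esub>) = - p"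
      by (rule the_equality) (use k in \<open>auto simp: eq_neg_iff_add_eq_0\<close>)
    then show ?thesis by (simp add: m_inv_def)
  qed
  have "- p \<in> H" if "p \<in> H" for p
    using R that uminus_scale by metis
  with R inv show ?L
    by unfold_locales (auto simp: real_alg_def map_scale)
qed

lemma multilinear_relatorsE [consumes 1, case_names add scale]:
  assumes "x \<in> multilinear_relators W r"
  obtains l i v w where "l \<in> words W r" "i < r" "v \<in> carrier W" "w \<in> carrier W"
      "x = single (l[i := v \<oplus>\<^bsub>W\<^esub> w]) 1
        - single (l[i := v]) 1 - single (l[i := w]) 1"
    | l i a v where "l \<in> words W r" "i < r" "v \<in> carrier W"
      "x = single (l[i := a \<odot>\<^bsub>W\<^esub> v]) 1 - single (l[i := v]) a"
  using assms unfolding multilinear_relators_def by blast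

lemma multilinear_relators_subset:
  assumes "module real_alg W"
  shows "multilinear_relators W r \<subseteq> {p. keys p \<subseteq> words W r}"
proof -
  interpret module real_alg W by fact
  have w: "l[i := v] \<in> words W r" if "l \<in> words W r" "v \<in> carrier W" for l i v
    using that set_update_subset_insert[of l i v] by (auto simp: words_def)
  have plus: "v \<oplus>\<^bsub>W\<^esub> w \<in> carrier W" if "v \<in> carrier W" "w \<in> carrier W" for v w
    using that by simp
  have smult: "a \<odot>\<^bsub>W\<^esub> v \<in> carrier W" if "v \<in> carrier W" for a v
    using that by (simp add: real_alg_def)
  have diff: "keys (p - q) \<subseteq> S"
    if "keys p \<subseteq> S" "keys q \<subseteq> S" for p q :: "'a list \<Rightarrow>\<^sub>0 real" and S
    using that keys_diff[of p q] by blast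
  have single: "keys (single l a) \<subseteq> words W r" if "l \<in> words W r"
    for l and a :: real
    using that by simp
  show ?thesis
  proof
    fix x assume "x \<in> multilinear_relators W r"
    then have "keys x \<subseteq> words W r"
    proof (cases rule: multilinear_relatorsE)
      case add
      then show ?thesis by (metis diff single w plus)
    next
      case scale
      then show ?thesis by (metis diff single w smult)
    qed
    then show "x \<in> {p. keys p \<subseteq> words W r}" by simp
  qed
qed

lemma submodule_freeI:
  fixes S :: "'v list set"
  assumes "H \<subseteq> {p. keys p \<subseteq> S}" "0 \<in> H"
    "\<And>p q. p \<in> H \<Longrightarrow> q \<in> H \<Longrightarrow> p + q \<in> H"
    "\<And>c p. p \<in> H \<Longrightarrow> single [] c * p \<in> H"
  shows "submodule H real_alg (free_module S)"
  unfolding submodule_free_iff using assms by blast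

lemma tensor_null_least:
  assumes "H \<subseteq> {p. keys p \<subseteq> words W r}" "0 \<in> H"
    "\<And>p q. p \<in> H \<Longrightarrow> q \<in> H \<Longrightarrow> p + q \<in> H"
    "\<And>c p. p \<in> H \<Longrightarrow> single [] c * p \<in> H"
    "multilinear_relators W r \<subseteq> H"
  shows "tensor_null W r \<subseteq> H"
  unfolding tensor_null_def by (rule Inter_lower) (use submodule_freeI[OF assms(1-4)] assms(5) in simp)

context
  fixes W :: "(real, 'v, 'm) module_scheme"
  assumes W: "module real_alg W"
begin

lemma tensor_null_submodule: "submodule (tensor_null W r) real_alg (free_module (words W r))"
proof -
  let ?\<H> = "{H. submodule H real_alg (free_module (words W r)) \<and> multilinear_relators W r \<subseteq> H}"
  have "submodule {p. keys p \<subseteq> words W r} real_alg (free_module (words W r))"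
  proof (rule submodule_freeI)
    fix p q :: "'v list \<Rightarrow>\<^sub>0 real"
    assume "p \<in> {p. keys p \<subseteq> words W r}" "q \<in> {p. keys p \<subseteq> words W r}"
    then show "p + q \<in> {p. keys p \<subseteq> words W r}"
      using keys_add[of p q] by auto
  next
    fix c and p :: "'v list \<Rightarrow>\<^sub>0 real"
    assume "p \<in> {p. keys p \<subseteq> words W r}"
    then show "single [] c * p \<in> {p. keys p \<subseteq> words W r}"
      using keys_scale[of c p] by auto
  qed auto
  then have all: "{p. keys p \<subseteq> words W r} \<in> ?\<H>"
    using multilinear_relators_subset[OF W] by simp
  show ?thesis
    unfolding tensor_null_def
  proof (rule submodule_freeI)
    show "\<Inter>?\<H> \<subseteq> {p. keys p \<subseteq> words W r}" using all by (rule Inter_lower)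
  qed (simp_all add: submodule_free_iff)
qed

lemma tensor_null_keys: "p \<in> tensor_null W r \<Longrightarrow> keys p \<subseteq> words W r"
  and tensor_null_zero: "0 \<in> tensor_null W r"
  and tensor_null_add: "p \<in> tensor_null W r \<Longrightarrow> q \<in> tensor_null W r \<Longrightarrow> p + q \<in> tensor_null W r"
  and tensor_null_scale: "p \<in> tensor_null W r \<Longrightarrow> single [] c * p \<in> tensor_null W r"
  using tensor_null_submodule[of r] unfolding submodule_free_iff by auto

lemma tensor_null_uminus: "p \<in> tensor_null W r \<Longrightarrow> - p \<in> tensor_null W r"
  using tensor_null_scale uminus_scale by metis

lemma relators_tensor_null: "multilinear_relators W r \<subseteq> tensor_null W r"
  unfolding tensor_null_def by auto

lemma relator_add_null:
  assumes "l \<in> words W r" "i < r" "v \<in> carrier W" "w \<in> carrier W"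
  shows "single (l[i := v \<oplus>\<^bsub>W\<^esub> w]) c
    - single (l[i := v]) c - single (l[i := w]) c \<in> tensor_null W r"
proof -
  have "single (l[i := v \<oplus>\<^bsub>W\<^esub> w]) 1
    - single (l[i := v]) 1 - single (l[i := w]) 1 \<in> multilinear_relators W r"
    unfolding multilinear_relators_def using assms by blast
  then show ?thesis
    using relators_tensor_null tensor_null_scale[of _ r c]
    by (force simp: right_diff_distrib single_mult_single)
qed

lemma relator_scale_null:
  assumes "l \<in> words W r" "i < r" "v \<in> carrier W"
  shows "single (l[i := a \<odot>\<^bsub>W\<^esub> v]) c - single (l[i := v]) (c * a)
    \<in> tensor_null W r"
proof -
  have "single (l[i := a \<odot>\<^bsub>W\<^esub> v]) 1 - single (l[i := v]) a
    \<in> multilinear_relators W r"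
    unfolding multilinear_relators_def using assms by blast
  then show ?thesis
    using relators_tensor_null tensor_null_scale[of _ r c]
    by (force simp: right_diff_distrib single_mult_single)
qed

text \<open>A linear map sending the multilinearity relators into \<^const>\<open>tensor_null\<close> sends all of
  \<^const>\<open>tensor_null\<close> there.\<close>

lemma tensor_null_image:
  assumes add: "\<And>p q. T (p + q) = T p + T q"
    and scale: "\<And>c p. T (single [] c * p) = single [] c * T p"
    and relators: "\<And>x. x \<in> multilinear_relators W' i \<Longrightarrow> T x \<in> tensor_null W r"
    and p: "p \<in> tensor_null W' i" and W': "module real_alg W'"
  shows "T p \<in> tensor_null W r"
proof -
  let ?H = "{p. keys p \<subseteq> words W' i \<and> T p \<in> tensor_null W r}"
  have "T 0 = 0" using add[of 0 0] by simp
  then have "tensor_null W' i \<subseteq> ?H"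
  proof (intro tensor_null_least)
    show "multilinear_relators W' i \<subseteq> ?H"
      using multilinear_relators_subset[OF W', of i] relators by auto
    fix p q assume "p \<in> ?H" "q \<in> ?H" then show "p + q \<in> ?H"
      using keys_add[of p q] by (auto simp: add tensor_null_add)
  next
    fix c p assume "p \<in> ?H" then show "single [] c * p \<in> ?H"
      using keys_scale[of c p] by (auto simp: scale tensor_null_scale)
  qed (auto simp: tensor_null_zero)
  with p show ?thesis by blast
qed

lemma tensor_null_mult_right:
  assumes "p \<in> tensor_null W i" "keys q \<subseteq> words W j"
  shows "p * q \<in> tensor_null W (i + j)"
  using assms(2)
proof (induction q rule: combination_induct)
  case (single m b)
  have app: "l @ m \<in> words W (i + j)" if "l \<in> words W i" for l
    using that single by (auto simp: words_def)
  have upd: "(l[k := v]) @ m = (l @ m)[k := v]" if "l \<in> words W i" "k < i" for l k v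
    using that single by (simp add: words_def list_update_append)
  show ?case
  proof (rule tensor_null_image[OF _ _ _ assms(1) W, where T = "\<lambda>p. p * single m b"])
    fix x assume "x \<in> multilinear_relators W i"
    then show "x * single m b \<in> tensor_null W (i + j)"
    proof (cases rule: multilinear_relatorsE)
      case (add l k v w)
      then show ?thesis
        using relator_add_null[OF app[OF add(1)], of "k" v w b]
        by (simp add: left_diff_distrib single_mult_single upd)
    next
      case (scale l k a v)
      then show ?thesis
        using relator_scale_null[OF app[OF scale(1)], of "k" v a b]
        by (simp add: left_diff_distrib single_mult_single upd mult.commute)
    qed
  qed (simp_all add: distrib_right mult.assoc)
qed (simp_all add: tensor_null_zero distrib_left tensor_null_add)

lemma tensor_null_mult_left:
  assumes "p \<in> tensor_null W i" "keys q \<subseteq> words W j"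
  shows "q * p \<in> tensor_null W (j + i)"
  using assms(2)
proof (induction q rule: combination_induct)
  case (single m b)
  have app: "m @ l \<in> words W (j + i)" if "l \<in> words W i" for l
    using that single by (auto simp: words_def)
  have upd: "m @ (l[k := v]) = (m @ l)[j + k := v]" if "l \<in> words W i" "k < i" for l k v
    using that single by (simp add: words_def list_update_append)
  show ?case
  proof (rule tensor_null_image[OF _ _ _ assms(1) W, where T = "\<lambda>p. single m b * p"])
    fix x assume "x \<in> multilinear_relators W i"
    then show "single m b * x \<in> tensor_null W (j + i)"
    proof (cases rule: multilinear_relatorsE)
      case (add l k v w)
      then show ?thesis
        using relator_add_null[OF app[OF add(1)], of "j + k" v w b]
        by (simp add: right_diff_distrib single_mult_single upd)
    next
      case (scale l k a v)
      then show ?thesis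
        using relator_scale_null[OF app[OF scale(1)], of "j + k" v a b]
        by (simp add: right_diff_distrib single_mult_single upd mult.commute)
    qed
  qed (simp_all add: distrib_left scale_central)
qed (simp_all add: tensor_null_zero distrib_right tensor_null_add)

lemma tensor_coset_eq: "tensor_coset W r p = {n + p | n. n \<in> tensor_null W r}"
  by (auto simp: tensor_coset_def a_r_coset_def')

lemma tensor_coset_eq_iff:
  "tensor_coset W r p = tensor_coset W r q \<longleftrightarrow> p - q \<in> tensor_null W r"
proof
  assume "tensor_coset W r p = tensor_coset W r q"
  moreover have "p \<in> tensor_coset W r p"
    unfolding tensor_coset_eq using tensor_null_zero by force
  ultimately show "p - q \<in> tensor_null W r"
    unfolding tensor_coset_eq by auto
next
  have sub: "tensor_coset W r p \<subseteq> tensor_coset W r q" if "p - q \<in> tensor_null W r" for p q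
  proof
    fix x assume "x \<in> tensor_coset W r p"
    then obtain n where n: "x = n + p" "n \<in> tensor_null W r" unfolding tensor_coset_eq by auto
    have "x = (n + (p - q)) + q" using n by simp
    then show "x \<in> tensor_coset W r q"
      unfolding tensor_coset_eq using n(2) that tensor_null_add by blast
  qed
  assume "p - q \<in> tensor_null W r"
  moreover from this have "q - p \<in> tensor_null W r" using tensor_null_uminus by fastforce
  ultimately show "tensor_coset W r p = tensor_coset W r q" using sub by blast
qed

lemma mem_tensor_coset_iff: "q \<in> tensor_coset W r p \<longleftrightarrow> q - p \<in> tensor_null W r"
  unfolding tensor_coset_eq by (auto intro!: exI[of _ "q - p"])

lemma carrier_tensor_power:
  "carrier (tensor_power W r) = tensor_coset W r ` {p. keys p \<subseteq> words W r}"
  by (auto simp: tensor_power_def quot_alg_def FactRing_def A_RCOSETS_def' tensor_coset_def)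

lemma zero_tensor_power: "\<zero>\<^bsub>tensor_power W r\<^esub> = tensor_coset W r 0"
proof -
  have "tensor_coset W r 0 = tensor_null W r" by (simp add: tensor_coset_eq)
  then show ?thesis by (simp add: tensor_power_def quot_alg_def FactRing_def)
qed

lemma add_tensor_power:
  "tensor_coset W r p \<oplus>\<^bsub>tensor_power W r\<^esub> tensor_coset W r q = tensor_coset W r (p + q)"
proof -
  have "{x + y | x y. x \<in> tensor_coset W r p \<and> y \<in> tensor_coset W r q} = tensor_coset W r (p + q)"
    (is "?A = ?B")
  proof
    show "?A \<subseteq> ?B"
    proof
      fix z assume "z \<in> ?A"
      then obtain x y where "z = x + y" "x - p \<in> tensor_null W r" "y - q \<in> tensor_null W r"
        by (auto simp: mem_tensor_coset_iff)
      then show "z \<in> ?B"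
        using tensor_null_add[of "x - p" r "y - q"] by (simp add: mem_tensor_coset_iff algebra_simps)
    qed
    show "?B \<subseteq> ?A"
    proof
      fix z assume "z \<in> ?B"
      then obtain n where n: "z = (n + p) + q" "n \<in> tensor_null W r"
        by (auto simp: tensor_coset_eq algebra_simps)
      moreover have "n + p \<in> tensor_coset W r p" "q \<in> tensor_coset W r q"
        using n tensor_null_zero by (simp_all add: mem_tensor_coset_iff)
      ultimately show "z \<in> ?A" by blast
    qed
  qed
  moreover have "tensor_coset W r p <+>\<^bsub>free_module (words W r)\<^esub> tensor_coset W r q
      = {x + y | x y. x \<in> tensor_coset W r p \<and> y \<in> tensor_coset W r q}"
    by (auto simp: set_add_def')
  ultimately show ?thesis
    by (simp add: tensor_power_def quot_alg_def FactRing_def)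
qed

lemma smult_tensor_power:
  "c \<odot>\<^bsub>tensor_power W r\<^esub> tensor_coset W r p = tensor_coset W r (single [] c * p)"
proof -
  have eq: "tensor_coset W r (single [] c * v) = tensor_coset W r (single [] c * p)"
    if "v \<in> tensor_coset W r p" for v
    using that tensor_null_scale[of "v - p" r c]
    by (simp add: mem_tensor_coset_iff tensor_coset_eq_iff right_diff_distrib)
  have ne: "tensor_coset W r p \<noteq> {}"
    using tensor_null_zero by (auto simp: tensor_coset_eq)
  have "c \<odot>\<^bsub>tensor_power W r\<^esub> tensor_coset W r p
      = (\<Union>v\<in>tensor_coset W r p. tensor_coset W r (single [] c * v))"
    by (simp add: tensor_power_def quot_alg_def tensor_coset_def map_scale)
  also have "\<dots> = (\<Union>v\<in>tensor_coset W r p. tensor_coset W r (single [] c * p))"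
    by (rule SUP_cong[OF refl eq])
  finally show ?thesis
    using ne by simp
qed

lemma tensor_mult_coset:
  assumes "keys p \<subseteq> words W i" "keys q \<subseteq> words W j" "r = i + j"
  shows "tensor_mult W r (tensor_coset W i p) (tensor_coset W j q) = tensor_coset W r (p * q)"
proof -
  have "tensor_coset W r (p' * q') = tensor_coset W r (p * q)"
    if "p' \<in> tensor_coset W i p" "q' \<in> tensor_coset W j q" for p' q'
  proof -
    have n: "p' - p \<in> tensor_null W i" "q' - q \<in> tensor_null W j"
      using that by (simp_all add: mem_tensor_coset_iff)
    have "keys q' \<subseteq> words W j"
      using tensor_null_keys[OF n(2)] assms(2) keys_add[of "q' - q" q] by auto
    then have "(p' - p) * q' \<in> tensor_null W r" "p * (q' - q) \<in> tensor_null W r"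
      using tensor_null_mult_right[OF n(1)] tensor_null_mult_left[OF n(2) assms(1)] assms(3)
      by auto
    then have "(p' - p) * q' + p * (q' - q) \<in> tensor_null W r" by (rule tensor_null_add)
    then show ?thesis by (simp add: tensor_coset_eq_iff algebra_simps)
  qed
  moreover have "p \<in> tensor_coset W i p" "q \<in> tensor_coset W j q"
    by (simp_all add: mem_tensor_coset_iff tensor_null_zero)
  ultimately show ?thesis
    unfolding tensor_mult_def concat_mult_eq by blast
qed

lemma abelian_group_tensor_power: "abelian_group (tensor_power W r)"
proof (rule abelian_groupI)
  fix x assume "x \<in> carrier (tensor_power W r)"
  then obtain p where p: "x = tensor_coset W r p" "keys p \<subseteq> words W r"
    by (auto simp: carrier_tensor_power)
  then have "tensor_coset W r (- p) \<in> carrier (tensor_power W r)"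
    by (auto simp: carrier_tensor_power)
  then show "\<exists>y\<in>carrier (tensor_power W r). y \<oplus>\<^bsub>tensor_power W r\<^esub> x = \<zero>\<^bsub>tensor_power W r\<^esub>"
    using p(1) by (auto intro!: bexI simp: add_tensor_power zero_tensor_power)
next
  fix x y assume "x \<in> carrier (tensor_power W r)" "y \<in> carrier (tensor_power W r)"
  then show "x \<oplus>\<^bsub>tensor_power W r\<^esub> y \<in> carrier (tensor_power W r)"
    unfolding carrier_tensor_power using keys_add by (fastforce simp: add_tensor_power)
qed (auto simp: carrier_tensor_power add_tensor_power zero_tensor_power algebra_simps)

lemma finsum_tensor_power:
  assumes "\<And>i. i \<in> A \<Longrightarrow> keys (g i) \<subseteq> words W r" "finite A"
  shows "finsum (tensor_power W r) (\<lambda>i. tensor_coset W r (g i)) A = tensor_coset W r (sum g A)"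
proof -
  interpret abelian_group "tensor_power W r" by (rule abelian_group_tensor_power)
  show ?thesis
    using assms(2,1)
  proof (induction A rule: finite_induct)
    case (insert a A)
    then have "(\<lambda>i. tensor_coset W r (g i)) \<in> insert a A \<rightarrow> carrier (tensor_power W r)"
      by (auto simp: carrier_tensor_power)
    with insert show ?case by (simp add: add_tensor_power Pi_iff)
  qed (simp add: zero_tensor_power)
qed

end

section \<open>The tensor algebra\<close>

text \<open>The element of the tensor algebra represented by a formal combination of words of arbitrary
  lengths. This map from the free associative algebra is surjective and compatible with all
  operations, so that the ring axioms need not be checked on cosets.\<close>

definition tensor_class :: "(real, 'v, 'm) module_scheme \<Rightarrow> ('v list \<Rightarrow>\<^sub>0 real) \<Rightarrow> nat \<Rightarrow> 'v tensor" where
  "tensor_class W p = (\<lambda>r. tensor_coset W r (word_part r p))"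

text \<open>The elements of the free associative algebra: combinations of words with letters in \<open>W\<close>.\<close>

abbreviation formal_tensors :: "(real, 'v, 'm) module_scheme \<Rightarrow> ('v list \<Rightarrow>\<^sub>0 real) set" where
  "formal_tensors W \<equiv> {p. keys p \<subseteq> lists (carrier W)}"

lemma formal_tensors_add: "p \<in> formal_tensors W \<Longrightarrow> q \<in> formal_tensors W \<Longrightarrow> p + q \<in> formal_tensors W"
  using keys_add[of p q] by blast

lemma formal_tensors_scale: "p \<in> formal_tensors W \<Longrightarrow> single [] c * p \<in> formal_tensors W"
  using keys_scale[of c p] by blast

lemma formal_tensors_uminus: "p \<in> formal_tensors W \<Longrightarrow> - p \<in> formal_tensors W"
  by simp

lemma formal_tensors_single: "set l \<subseteq> carrier W \<Longrightarrow> single l c \<in> formal_tensors W"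
  by (auto simp: in_lists_conv_set)

lemma formal_tensors_mult: "p \<in> formal_tensors W \<Longrightarrow> q \<in> formal_tensors W \<Longrightarrow> p * q \<in> formal_tensors W"
  using keys_mult[of p q] by (force simp: plus_list_def)

lemma keys_word_part_words: "p \<in> formal_tensors W \<Longrightarrow> keys (word_part r p) \<subseteq> words W r"
  by (auto simp: keys_word_part words_def in_lists_conv_set subset_iff)

lemma words_formal_tensors: "keys p \<subseteq> words W r \<Longrightarrow> p \<in> formal_tensors W"
  by (auto simp: words_def in_lists_conv_set subset_iff)

lemma word_part_words: "keys p \<subseteq> words W s \<Longrightarrow> word_part r p = (if r = s then p else 0)"
  by (rule word_part_homogeneous) (auto simp: words_def)

context
  fixes W :: "(real, 'v, 'm) module_scheme"
  assumes W: "module real_alg W"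
begin

lemma tensor_class_in_carrier:
  assumes "p \<in> formal_tensors W" shows "tensor_class W p \<in> carrier (tensor_algebra W)"
proof -
  have "{r. tensor_class W p r \<noteq> \<zero>\<^bsub>tensor_power W r\<^esub>} \<subseteq> length ` keys p"
  proof
    fix r assume "r \<in> {r. tensor_class W p r \<noteq> \<zero>\<^bsub>tensor_power W r\<^esub>}"
    then have "word_part r p \<noteq> 0"
      by (auto simp: tensor_class_def zero_tensor_power[OF W])
    then obtain k where "k \<in> keys (word_part r p)"
      by (metis all_not_in_conv keys_eq_empty)
    then show "r \<in> length ` keys p" by (auto simp: keys_word_part)
  qed
  then have "finite {r. tensor_class W p r \<noteq> \<zero>\<^bsub>tensor_power W r\<^esub>}"
    by (rule finite_subset) simp
  then show ?thesis
    using keys_word_part_words[OF assms]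
    by (auto simp: tensor_algebra_def carrier_tensor_power[OF W] tensor_class_def)
qed

lemma carrier_tensor_algebra: "carrier (tensor_algebra W) = tensor_class W ` formal_tensors W"
proof
  show "carrier (tensor_algebra W) \<subseteq> tensor_class W ` formal_tensors W"
  proof
    fix t assume t: "t \<in> carrier (tensor_algebra W)"
    define S where "S = {r. t r \<noteq> \<zero>\<^bsub>tensor_power W r\<^esub>}"
    have fin: "finite S" using t by (simp add: tensor_algebra_def S_def)
    have "\<forall>r. \<exists>p. keys p \<subseteq> words W r \<and> t r = tensor_coset W r p"
    proof
      fix r
      have "t r \<in> tensor_coset W r ` {p. keys p \<subseteq> words W r}"
        using t by (simp add: tensor_algebra_def carrier_tensor_power[OF W])
      then show "\<exists>p. keys p \<subseteq> words W r \<and> t r = tensor_coset W r p" by blast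
    qed
    then obtain g where g: "\<And>r. keys (g r) \<subseteq> words W r" "\<And>r. t r = tensor_coset W r (g r)"
      by metis
    have part: "word_part r (sum g S) = (if r \<in> S then g r else 0)" for r
    proof -
      have "word_part r (sum g S) = (\<Sum>s\<in>S. if r = s then g s else 0)"
        unfolding word_part_sum by (rule sum.cong) (simp_all add: word_part_words[OF g(1)])
      then show ?thesis using fin by simp
    qed
    have "sum g S \<in> formal_tensors W"
      using keys_sum[of g S] words_formal_tensors[OF g(1)] by blast
    moreover have "t = tensor_class W (sum g S)"
    proof
      fix r
      show "t r = tensor_class W (sum g S) r"
        unfolding tensor_class_def part
        using g(2)[of r] by (simp add: S_def zero_tensor_power[OF W])
    qed
    ultimately show "t \<in> tensor_class W ` formal_tensors W" by blast
  qed
qed (use tensor_class_in_carrier in blast)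

lemma tensor_class_add:
  "tensor_class W p \<oplus>\<^bsub>tensor_algebra W\<^esub> tensor_class W q = tensor_class W (p + q)"
  by (simp add: tensor_algebra_def tensor_class_def add_tensor_power[OF W] word_part_add)

lemma tensor_class_scale:
  "c \<odot>\<^bsub>tensor_algebra W\<^esub> tensor_class W p = tensor_class W (single [] c * p)"
  by (simp add: tensor_algebra_def tensor_class_def smult_tensor_power[OF W] word_part_scale)

lemma tensor_class_zero: "\<zero>\<^bsub>tensor_algebra W\<^esub> = tensor_class W 0"
  by (simp add: tensor_algebra_def tensor_class_def zero_tensor_power[OF W])

lemma tensor_class_one: "\<one>\<^bsub>tensor_algebra W\<^esub> = tensor_class W 1"
  by (auto simp: tensor_algebra_def tensor_class_def zero_tensor_power[OF W] pure_tensor_def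
      one_eq_single word_part_single fun_eq_iff)

lemma tensor_class_incl: "tensor_incl W v = tensor_class W (single [v] 1)"
  by (auto simp: tensor_incl_def tensor_class_def zero_tensor_power[OF W] pure_tensor_def
      word_part_single fun_eq_iff)

lemma tensor_class_mult:
  assumes "p \<in> formal_tensors W" "q \<in> formal_tensors W"
  shows "tensor_class W p \<otimes>\<^bsub>tensor_algebra W\<^esub> tensor_class W q = tensor_class W (p * q)"
proof
  fix r
  have keys: "keys (word_part i p * word_part (r - i) q) \<subseteq> words W r" if "i \<le> r" for i
    using keys_mult[of "word_part i p" "word_part (r - i) q"] that
      keys_word_part_words[OF assms(1), of i] keys_word_part_words[OF assms(2), of "r - i"]
    by (force simp: words_def plus_list_def)
  have "(tensor_class W p \<otimes>\<^bsub>tensor_algebra W\<^esub> tensor_class W q) r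
    = finsum (tensor_power W r) (\<lambda>i. tensor_mult W r (tensor_coset W i (word_part i p))
        (tensor_coset W (r - i) (word_part (r - i) q))) {..r}"
    by (simp add: tensor_algebra_def tensor_class_def)
  also have "\<dots> = finsum (tensor_power W r) (\<lambda>i. tensor_coset W r (word_part i p * word_part (r - i) q)) {..r}"
  proof -
    interpret abelian_group "tensor_power W r" by (rule abelian_group_tensor_power[OF W])
    show ?thesis
    proof (rule finsum_cong')
      fix i assume "i \<in> {..r}"
      then show "tensor_mult W r (tensor_coset W i (word_part i p)) (tensor_coset W (r - i) (word_part (r - i) q))
         = tensor_coset W r (word_part i p * word_part (r - i) q)"
        by (intro tensor_mult_coset[OF W] keys_word_part_words assms) simp
    qed (use keys in \<open>auto simp: carrier_tensor_power[OF W]\<close>)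
  qed
  also have "\<dots> = tensor_coset W r (\<Sum>i\<le>r. word_part i p * word_part (r - i) q)"
    by (rule finsum_tensor_power[OF W]) (use keys in auto)
  finally show "(tensor_class W p \<otimes>\<^bsub>tensor_algebra W\<^esub> tensor_class W q) r = tensor_class W (p * q) r"
    by (simp add: tensor_class_def word_part_mult)
qed

lemma ring_tensor_algebra: "ring (tensor_algebra W)" (is "ring ?T")
proof (rule ringI)
  show "abelian_group ?T"
  proof (rule abelian_groupI)
    fix x y assume "x \<in> carrier ?T" "y \<in> carrier ?T"
    then obtain p q where p: "p \<in> formal_tensors W" "x = tensor_class W p"
      and q: "q \<in> formal_tensors W" "y = tensor_class W q"
      unfolding carrier_tensor_algebra by blast
    show "x \<oplus>\<^bsub>?T\<^esub> y \<in> carrier ?T"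
      unfolding p(2) q(2) tensor_class_add
      by (intro tensor_class_in_carrier formal_tensors_add p(1) q(1))
  next
    show "\<zero>\<^bsub>?T\<^esub> \<in> carrier ?T"
      unfolding tensor_class_zero by (rule tensor_class_in_carrier) simp
  next
    fix x assume "x \<in> carrier ?T"
    then obtain p where p: "p \<in> formal_tensors W" "x = tensor_class W p"
      by (auto simp: carrier_tensor_algebra)
    show "\<zero>\<^bsub>?T\<^esub> \<oplus>\<^bsub>?T\<^esub> x = x"
      by (simp add: p(2) tensor_class_zero tensor_class_add)
    have "tensor_class W (- p) \<oplus>\<^bsub>?T\<^esub> x = \<zero>\<^bsub>?T\<^esub>"
      by (simp add: p(2) tensor_class_zero tensor_class_add)
    then show "\<exists>y\<in>carrier ?T. y \<oplus>\<^bsub>?T\<^esub> x = \<zero>\<^bsub>?T\<^esub>"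
      using tensor_class_in_carrier[OF formal_tensors_uminus[OF p(1)]] by blast
  qed (auto simp: carrier_tensor_algebra tensor_class_add algebra_simps)
  show "Group.monoid ?T"
  proof (rule monoidI)
    fix x y assume "x \<in> carrier ?T" "y \<in> carrier ?T"
    then obtain p q where p: "p \<in> formal_tensors W" "x = tensor_class W p"
      and q: "q \<in> formal_tensors W" "y = tensor_class W q"
      unfolding carrier_tensor_algebra by blast
    show "x \<otimes>\<^bsub>?T\<^esub> y \<in> carrier ?T"
      unfolding p(2) q(2) tensor_class_mult[OF p(1) q(1)]
      by (intro tensor_class_in_carrier formal_tensors_mult p(1) q(1))
  next
    show "\<one>\<^bsub>?T\<^esub> \<in> carrier ?T"
      unfolding tensor_class_one one_eq_single by (intro tensor_class_in_carrier formal_tensors_single) simp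
  next
    fix x y z
    assume "x \<in> carrier ?T" "y \<in> carrier ?T" "z \<in> carrier ?T"
    then obtain p q s where
      p: "p \<in> formal_tensors W" "x = tensor_class W p" and
      q: "q \<in> formal_tensors W" "y = tensor_class W q" and
      s: "s \<in> formal_tensors W" "z = tensor_class W s"
      unfolding carrier_tensor_algebra by blast
    show "x \<otimes>\<^bsub>?T\<^esub> y \<otimes>\<^bsub>?T\<^esub> z
        = x \<otimes>\<^bsub>?T\<^esub> (y \<otimes>\<^bsub>?T\<^esub> z)"
      unfolding p(2) q(2) s(2)
      by (simp only: tensor_class_mult p(1) q(1) s(1) formal_tensors_mult mult.assoc)
  next
    fix x assume "x \<in> carrier ?T"
    then obtain p where p: "p \<in> formal_tensors W" "x = tensor_class W p"
      unfolding carrier_tensor_algebra by blast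
    have one: "1 \<in> formal_tensors W"
      unfolding one_eq_single by (rule formal_tensors_single) simp
    show "\<one>\<^bsub>?T\<^esub> \<otimes>\<^bsub>?T\<^esub> x = x" "x \<otimes>\<^bsub>?T\<^esub> \<one>\<^bsub>?T\<^esub> = x"
      unfolding p(2) tensor_class_one
      by (simp_all only: tensor_class_mult p(1) one mult_1_left mult_1_right)
  qed
next
  fix x y z
  assume "x \<in> carrier ?T" "y \<in> carrier ?T" "z \<in> carrier ?T"
  then obtain p q s where
    p: "p \<in> formal_tensors W" "x = tensor_class W p" and
    q: "q \<in> formal_tensors W" "y = tensor_class W q" and
    s: "s \<in> formal_tensors W" "z = tensor_class W s"
    unfolding carrier_tensor_algebra by blast
  show "(x \<oplus>\<^bsub>?T\<^esub> y) \<otimes>\<^bsub>?T\<^esub> z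
    = x \<otimes>\<^bsub>?T\<^esub> z \<oplus>\<^bsub>?T\<^esub> y \<otimes>\<^bsub>?T\<^esub> z"
    "z \<otimes>\<^bsub>?T\<^esub> (x \<oplus>\<^bsub>?T\<^esub> y)
    = z \<otimes>\<^bsub>?T\<^esub> x \<oplus>\<^bsub>?T\<^esub> z \<otimes>\<^bsub>?T\<^esub> y"
    unfolding p(2) q(2) s(2)
    by (simp_all only: tensor_class_add tensor_class_mult p(1) q(1) s(1) formal_tensors_add
        distrib_left distrib_right)
qed

lemma smult_tensor_algebra:
  assumes "t \<in> carrier (tensor_algebra W)"
  shows "c \<odot>\<^bsub>tensor_algebra W\<^esub> t = (c \<odot>\<^bsub>tensor_algebra W\<^esub> \<one>\<^bsub>tensor_algebra W\<^esub>) \<otimes>\<^bsub>tensor_algebra W\<^esub> t"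
    and "c \<odot>\<^bsub>tensor_algebra W\<^esub> t \<in> carrier (tensor_algebra W)"
proof -
  obtain p where p: "p \<in> formal_tensors W" "t = tensor_class W p"
    using assms unfolding carrier_tensor_algebra by blast
  have c: "single [] c \<in> formal_tensors W"
    by (rule formal_tensors_single) simp
  show "c \<odot>\<^bsub>tensor_algebra W\<^esub> t = (c \<odot>\<^bsub>tensor_algebra W\<^esub> \<one>\<^bsub>tensor_algebra W\<^esub>) \<otimes>\<^bsub>tensor_algebra W\<^esub> t"
    unfolding p(2) tensor_class_one
    by (simp only: tensor_class_scale mult_1_right tensor_class_mult[OF c p(1)])
  show "c \<odot>\<^bsub>tensor_algebra W\<^esub> t \<in> carrier (tensor_algebra W)"
    unfolding p(2) tensor_class_scale
    by (intro tensor_class_in_carrier formal_tensors_scale p(1))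
qed

end

section \<open>Homomorphisms of algebras\<close>

lemma
  assumes "h \<in> alg_hom A B"
  shows alg_hom_closed: "x \<in> carrier A \<Longrightarrow> h x \<in> carrier B"
    and alg_hom_add: "x \<in> carrier A \<Longrightarrow> y \<in> carrier A \<Longrightarrow> h (x \<oplus>\<^bsub>A\<^esub> y) = h x \<oplus>\<^bsub>B\<^esub> h y"
    and alg_hom_mult: "x \<in> carrier A \<Longrightarrow> y \<in> carrier A \<Longrightarrow> h (x \<otimes>\<^bsub>A\<^esub> y) = h x \<otimes>\<^bsub>B\<^esub> h y"
    and alg_hom_one: "h \<one>\<^bsub>A\<^esub> = \<one>\<^bsub>B\<^esub>"
    and alg_hom_scale: "x \<in> carrier A \<Longrightarrow> h (c \<odot>\<^bsub>A\<^esub> x) = c \<odot>\<^bsub>B\<^esub> h x"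
  using assms by (auto simp: alg_hom_def ring_hom_def linear_map_def)

lemma alg_homI:
  assumes "\<And>x. x \<in> carrier A \<Longrightarrow> h x \<in> carrier B"
    and "\<And>x y. x \<in> carrier A \<Longrightarrow> y \<in> carrier A \<Longrightarrow> h (x \<oplus>\<^bsub>A\<^esub> y) = h x \<oplus>\<^bsub>B\<^esub> h y"
    and "\<And>x y. x \<in> carrier A \<Longrightarrow> y \<in> carrier A \<Longrightarrow> h (x \<otimes>\<^bsub>A\<^esub> y) = h x \<otimes>\<^bsub>B\<^esub> h y"
    and "h \<one>\<^bsub>A\<^esub> = \<one>\<^bsub>B\<^esub>"
    and "\<And>c x. x \<in> carrier A \<Longrightarrow> h (c \<odot>\<^bsub>A\<^esub> x) = c \<odot>\<^bsub>B\<^esub> h x"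
  shows "h \<in> alg_hom A B"
  using assms unfolding alg_hom_def linear_map_def by (auto intro!: ring_hom_memI)

section \<open>Functoriality of tensor algebras\<close>

text \<open>The linear extension of letterwise application of \<open>\<phi>\<close> to words.\<close>

definition word_map :: "('v \<Rightarrow> 'w) \<Rightarrow> ('v list \<Rightarrow>\<^sub>0 real) \<Rightarrow> ('w list \<Rightarrow>\<^sub>0 real)" where
  "word_map \<phi> p = (\<Sum>k\<in>keys p. single (map \<phi> k) (lookup p k))"

lemma word_map_zero [simp]: "word_map \<phi> 0 = 0"
  by (simp add: word_map_def)

lemma word_map_add: "word_map \<phi> (p + q) = word_map \<phi> p + word_map \<phi> q"
  unfolding word_map_def by (rule setsum_keys_plus_distrib) (simp_all add: single_add)

lemma word_map_single: "word_map \<phi> (single k c) = single (map \<phi> k) c"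
  by (simp add: word_map_def)

lemma word_map_diff: "word_map \<phi> (p - q) = word_map \<phi> p - word_map \<phi> q"
  using word_map_add[of \<phi> "p - q" q] by simp

lemma word_map_sum: "word_map \<phi> (sum g A) = (\<Sum>a\<in>A. word_map \<phi> (g a))"
  by (induction A rule: infinite_finite_induct) (simp_all add: word_map_add)

lemma word_map_mult: "word_map \<phi> (p * q) = word_map \<phi> p * word_map \<phi> q"
proof -
  have "keys p \<subseteq> UNIV" by simp
  then show ?thesis
  proof (induction p rule: combination_induct)
    case (single k c)
    have "keys q \<subseteq> UNIV" by simp
    then show ?case
      by (induction q rule: combination_induct)
        (simp_all add: single_mult_single word_map_single distrib_left word_map_add)
  qed (simp_all add: distrib_right word_map_add)
qed

lemma word_map_scale: "word_map \<phi> (single [] c * p) = single [] c * word_map \<phi> p"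
  by (simp add: word_map_mult word_map_single)

lemma word_part_word_map: "word_part r (word_map \<phi> p) = word_map \<phi> (word_part r p)"
proof -
  have "keys p \<subseteq> UNIV" by simp
  then show ?thesis
    by (induction p rule: combination_induct)
      (simp_all add: word_map_single word_part_single word_map_add word_part_add)
qed

lemma keys_word_map: "keys (word_map \<phi> p) \<subseteq> map \<phi> ` keys p"
  unfolding word_map_def
  using keys_sum[of "\<lambda>k. single (map \<phi> k) (lookup p k)" "keys p"]
  by (auto split: if_splits)

text \<open>The map \<open>\<phi>\<^sup>\<otimes>\<^sup>r\<close> on tensors, computed on an arbitrary representative, and the map induced on tensor
  algebras. Both are meaningful for linear \<open>\<phi>\<close> only.\<close>

definition tensor_power_map ::
  "(real, 'w, 'n) module_scheme \<Rightarrow> ('v \<Rightarrow> 'w) \<Rightarrow> nat \<Rightarrow> 'v tensor \<Rightarrow> 'w tensor" where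
  "tensor_power_map W2 \<phi> r s = tensor_coset W2 r (word_map \<phi> (SOME p. p \<in> s))"

definition tensor_algebra_map ::
  "(real, 'w, 'n) module_scheme \<Rightarrow> ('v \<Rightarrow> 'w) \<Rightarrow> (nat \<Rightarrow> 'v tensor) \<Rightarrow> (nat \<Rightarrow> 'w tensor)" where
  "tensor_algebra_map W2 \<phi> t = (\<lambda>r. tensor_power_map W2 \<phi> r (t r))"

context
  fixes W1 :: "(real, 'v, 'm) module_scheme" and W2 :: "(real, 'w, 'n) module_scheme"
    and \<phi> :: "'v \<Rightarrow> 'w"
  assumes W1: "module real_alg W1" and W2: "module real_alg W2" and \<phi>: "linear_map W1 W2 \<phi>"
begin

lemma map_words: "l \<in> words W1 r \<Longrightarrow> map \<phi> l \<in> words W2 r"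
  using \<phi> by (auto simp: words_def linear_map_def)

lemma word_map_formal_tensors: "p \<in> formal_tensors W1 \<Longrightarrow> word_map \<phi> p \<in> formal_tensors W2"
  using keys_word_map[of \<phi> p] \<phi> by (fastforce simp: linear_map_def in_lists_conv_set)

lemma word_map_null:
  assumes "p \<in> tensor_null W1 r" shows "word_map \<phi> p \<in> tensor_null W2 r"
proof (rule tensor_null_image[OF W2 _ _ _ assms W1])
  fix x assume "x \<in> multilinear_relators W1 r"
  then show "word_map \<phi> x \<in> tensor_null W2 r"
  proof (cases rule: multilinear_relatorsE)
    case (add l k v w)
    then have c: "\<phi> v \<in> carrier W2" "\<phi> w \<in> carrier W2" "\<phi> (v \<oplus>\<^bsub>W1\<^esub> w) = \<phi> v \<oplus>\<^bsub>W2\<^esub> \<phi> w"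
      using \<phi> by (auto simp: linear_map_def)
    show ?thesis
      unfolding add(5) word_map_diff word_map_single map_update c(3)
      by (rule relator_add_null[OF W2 map_words[OF add(1)] add(2) c(1,2)])
  next
    case (scale l k a v)
    then have c: "\<phi> v \<in> carrier W2" "\<phi> (a \<odot>\<^bsub>W1\<^esub> v) = a \<odot>\<^bsub>W2\<^esub> \<phi> v"
      using \<phi> by (auto simp: linear_map_def)
    show ?thesis
      unfolding scale(4) word_map_diff word_map_single map_update c(2)
      using relator_scale_null[OF W2 map_words[OF scale(1)] scale(2) c(1), of a 1] by simp
  qed
qed (simp_all add: word_map_add word_map_scale)

lemma tensor_power_map_coset:
  "tensor_power_map W2 \<phi> r (tensor_coset W1 r p) = tensor_coset W2 r (word_map \<phi> p)"
proof -
  have "(SOME p'. p' \<in> tensor_coset W1 r p) \<in> tensor_coset W1 r p"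
    by (rule someI[of _ p]) (simp add: mem_tensor_coset_iff[OF W1] tensor_null_zero[OF W1])
  then have "word_map \<phi> ((SOME p'. p' \<in> tensor_coset W1 r p) - p) \<in> tensor_null W2 r"
    using word_map_null by (simp add: mem_tensor_coset_iff[OF W1])
  then show ?thesis
    by (simp add: tensor_power_map_def tensor_coset_eq_iff[OF W2] word_map_diff)
qed

lemma tensor_algebra_map_class:
  "tensor_algebra_map W2 \<phi> (tensor_class W1 p) = tensor_class W2 (word_map \<phi> p)"
  by (simp add: tensor_algebra_map_def tensor_class_def tensor_power_map_coset word_part_word_map)

lemma tensor_algebra_map_hom:
  "tensor_algebra_map W2 \<phi> \<in> alg_hom (tensor_algebra W1) (tensor_algebra W2)"
proof -
  let ?h = "tensor_algebra_map W2 \<phi>"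
  have closed: "?h x \<in> carrier (tensor_algebra W2)" if "x \<in> carrier (tensor_algebra W1)" for x
    using that unfolding carrier_tensor_algebra[OF W1]
    by (auto simp: tensor_algebra_map_class intro!: tensor_class_in_carrier[OF W2] word_map_formal_tensors[simplified])
  have add: "?h (x \<oplus>\<^bsub>tensor_algebra W1\<^esub> y) = ?h x \<oplus>\<^bsub>tensor_algebra W2\<^esub> ?h y"
    and mult: "?h (x \<otimes>\<^bsub>tensor_algebra W1\<^esub> y) = ?h x \<otimes>\<^bsub>tensor_algebra W2\<^esub> ?h y"
    if xy: "x \<in> carrier (tensor_algebra W1)" "y \<in> carrier (tensor_algebra W1)" for x y
  proof -
    obtain p q where p: "p \<in> formal_tensors W1" "x = tensor_class W1 p" and
      q: "q \<in> formal_tensors W1" "y = tensor_class W1 q"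
      using xy unfolding carrier_tensor_algebra[OF W1] by blast
    show "?h (x \<oplus>\<^bsub>tensor_algebra W1\<^esub> y) = ?h x \<oplus>\<^bsub>tensor_algebra W2\<^esub> ?h y"
      unfolding p(2) q(2)
      by (simp only: tensor_algebra_map_class tensor_class_add[OF W1] tensor_class_add[OF W2] word_map_add)
    show "?h (x \<otimes>\<^bsub>tensor_algebra W1\<^esub> y) = ?h x \<otimes>\<^bsub>tensor_algebra W2\<^esub> ?h y"
      unfolding p(2) q(2)
      by (simp only: tensor_algebra_map_class tensor_class_mult[OF W1 p(1) q(1)]
          tensor_class_mult[OF W2 word_map_formal_tensors[OF p(1)] word_map_formal_tensors[OF q(1)]] word_map_mult)
  qed
  have scale: "?h (c \<odot>\<^bsub>tensor_algebra W1\<^esub> x) = c \<odot>\<^bsub>tensor_algebra W2\<^esub> ?h x"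
    if x: "x \<in> carrier (tensor_algebra W1)" for c x
  proof -
    obtain p where p: "p \<in> formal_tensors W1" "x = tensor_class W1 p"
      using x unfolding carrier_tensor_algebra[OF W1] by blast
    show ?thesis
      unfolding p(2)
      by (simp only: tensor_algebra_map_class tensor_class_scale[OF W1] tensor_class_scale[OF W2] word_map_scale)
  qed
  have one: "?h \<one>\<^bsub>tensor_algebra W1\<^esub> = \<one>\<^bsub>tensor_algebra W2\<^esub>"
    unfolding tensor_class_one[OF W1] tensor_class_one[OF W2] tensor_algebra_map_class
    by (simp add: one_eq_single word_map_single)
  show ?thesis
    by (rule alg_homI) (fact closed add mult one scale)+
qed

end

section \<open>Clifford algebras\<close>

context
  fixes W :: "(real, 'v, 'm) module_scheme" and q :: "'v \<Rightarrow> 'v \<Rightarrow> real"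
  assumes W: "module real_alg W"
begin

lemma clifford_relator_eq:
  assumes "v \<in> carrier W" "w \<in> carrier W"
  shows "tensor_incl W v \<otimes>\<^bsub>tensor_algebra W\<^esub> tensor_incl W w
      \<oplus>\<^bsub>tensor_algebra W\<^esub> tensor_incl W w \<otimes>\<^bsub>tensor_algebra W\<^esub> tensor_incl W v
      \<oplus>\<^bsub>tensor_algebra W\<^esub> c \<odot>\<^bsub>tensor_algebra W\<^esub> \<one>\<^bsub>tensor_algebra W\<^esub>
    = tensor_class W (single [v, w] 1 + single [w, v] 1
        + single [] c)"
proof -
  have "single [v] 1 \<in> formal_tensors W" "single [w] 1 \<in> formal_tensors W"
    using assms by (auto intro!: formal_tensors_single[simplified])
  then show ?thesis
    by (simp add: tensor_class_incl[OF W] tensor_class_one[OF W] tensor_class_mult[OF W]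
        tensor_class_add[OF W] tensor_class_scale[OF W] single_mult_single)
qed

lemma clifford_relators_eq:
  "clifford_relators W q = {tensor_class W (single [v, w] 1
      + single [w, v] 1 + single [] (4 * q v w))
    | v w. v \<in> carrier W \<and> w \<in> carrier W}"
  unfolding clifford_relators_def Let_def
  by (intro Collect_cong ex_cong1 rev_conj_cong refl) (simp only: clifford_relator_eq)

lemma clifford_relators_subset: "clifford_relators W q \<subseteq> carrier (tensor_algebra W)"
proof
  fix x assume "x \<in> clifford_relators W q"
  then obtain v w where vw: "v \<in> carrier W" "w \<in> carrier W"
    "x = tensor_class W (single [v, w] 1
      + single [w, v] 1 + single [] (4 * q v w))"
    unfolding clifford_relators_eq by blast
  show "x \<in> carrier (tensor_algebra W)"
    unfolding vw(3)
    by (intro tensor_class_in_carrier[OF W] formal_tensors_add formal_tensors_single) (use vw in auto)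
qed

lemma ideal_clifford_ideal: "ideal (clifford_ideal W q) (tensor_algebra W)"
  unfolding clifford_ideal_def
  by (rule ring.genideal_ideal[OF ring_tensor_algebra[OF W] clifford_relators_subset])

lemma clifford_coset_eq_iff:
  assumes "s \<in> carrier (tensor_algebra W)" "t \<in> carrier (tensor_algebra W)"
  shows "clifford_coset W q s = clifford_coset W q t
    \<longleftrightarrow> s \<ominus>\<^bsub>tensor_algebra W\<^esub> t \<in> clifford_ideal W q"
  unfolding clifford_coset_def
  using ring.quotient_eq_iff_same_a_r_cos[OF ring_tensor_algebra[OF W] ideal_clifford_ideal assms]
  by simp

lemma mem_clifford_cosetD:
  assumes "t \<in> carrier (tensor_algebra W)" "s \<in> clifford_coset W q t"
  shows "s \<in> carrier (tensor_algebra W)" "clifford_coset W q s = clifford_coset W q t"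
proof -
  interpret ideal "clifford_ideal W q" "tensor_algebra W" by (rule ideal_clifford_ideal)
  show "s \<in> carrier (tensor_algebra W)"
    using assms a_r_coset_subset_G[OF a_subset] unfolding clifford_coset_def by blast
  show "clifford_coset W q s = clifford_coset W q t"
    using a_repr_independence'[OF assms(2)[unfolded clifford_coset_def] assms(1)]
    unfolding clifford_coset_def by simp
qed

lemma clifford_coset_self:
  assumes "t \<in> carrier (tensor_algebra W)" shows "t \<in> clifford_coset W q t"
proof -
  interpret ideal "clifford_ideal W q" "tensor_algebra W" by (rule ideal_clifford_ideal)
  show ?thesis unfolding clifford_coset_def using a_rcos_self[OF assms] .
qed

lemma carrier_clifford_algebra:
  "carrier (clifford_algebra W q) = clifford_coset W q ` carrier (tensor_algebra W)"
  by (auto simp: clifford_algebra_def quot_alg_def FactRing_def A_RCOSETS_def' clifford_coset_def)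

lemma clifford_coset_hom:
  "clifford_coset W q \<in> alg_hom (tensor_algebra W) (clifford_algebra W q)"
proof -
  interpret ideal "clifford_ideal W q" "tensor_algebra W" by (rule ideal_clifford_ideal)
  let ?T = "tensor_algebra W" and ?I = "clifford_ideal W q"
  have hom: "(+>\<^bsub>?T\<^esub>) ?I \<in> ring_hom ?T (?T Quot ?I)" by (rule rcos_ring_hom)
  then have ring: "clifford_coset W q \<in> ring_hom ?T (clifford_algebra W q)"
    by (simp add: ring_hom_def clifford_coset_def clifford_algebra_def quot_alg_def Pi_iff)
  have scale: "clifford_coset W q (c \<odot>\<^bsub>?T\<^esub> t) = c \<odot>\<^bsub>clifford_algebra W q\<^esub> clifford_coset W q t"
    if t: "t \<in> carrier ?T" for c t
  proof -
    let ?s = "c \<odot>\<^bsub>?T\<^esub> \<one>\<^bsub>?T\<^esub>"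
    have s: "?s \<in> carrier ?T" by (rule smult_tensor_algebra(2)[OF W one_closed])
    have "?I +>\<^bsub>?T\<^esub> (c \<odot>\<^bsub>?T\<^esub> v) = clifford_coset W q (c \<odot>\<^bsub>?T\<^esub> t)" if "v \<in> clifford_coset W q t" for v
    proof -
      note v = mem_clifford_cosetD[OF t that]
      have "clifford_coset W q (?s \<otimes>\<^bsub>?T\<^esub> v) = clifford_coset W q (?s \<otimes>\<^bsub>?T\<^esub> t)"
        using ring_hom_mult[OF ring s v(1)] ring_hom_mult[OF ring s t] v(2) by simp
      then show ?thesis
        using smult_tensor_algebra(1)[OF W t, of c] smult_tensor_algebra(1)[OF W v(1), of c]
        by (simp add: clifford_coset_def)
    qed
    moreover have "c \<odot>\<^bsub>clifford_algebra W q\<^esub> clifford_coset W q t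
        = (\<Union>v\<in>clifford_coset W q t. ?I +>\<^bsub>?T\<^esub> (c \<odot>\<^bsub>?T\<^esub> v))"
      by (simp add: clifford_algebra_def quot_alg_def)
    ultimately show ?thesis
      using clifford_coset_self[OF t] by auto
  qed
  show ?thesis
    unfolding alg_hom_def linear_map_def
    using ring ring_hom_add[OF ring] scale by (auto simp: ring_hom_def)
qed

text \<open>A unital homomorphism on a Clifford algebra is determined by its values on vectors.\<close>

lemma alg_hom_clifford_unique:
  assumes h: "h \<in> alg_hom (clifford_algebra W q) B" and h': "h' \<in> alg_hom (clifford_algebra W q) B"
    and gen: "\<And>v. v \<in> carrier W \<Longrightarrow>
      h (clifford_coset W q (tensor_incl W v)) = h' (clifford_coset W q (tensor_incl W v))"
    and a: "a \<in> carrier (clifford_algebra W q)"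
  shows "h a = h' a"
proof -
  let ?T = "tensor_algebra W" and ?C = "clifford_algebra W q"
  let ?k = "\<lambda>p. clifford_coset W q (tensor_class W p)"
  have k_closed: "?k p \<in> carrier ?C" if "p \<in> formal_tensors W" for p
    unfolding carrier_clifford_algebra using tensor_class_in_carrier[OF W that] by blast
  have k: "?k (p + r) = ?k p \<oplus>\<^bsub>?C\<^esub> ?k r" "?k (p * r) = ?k p \<otimes>\<^bsub>?C\<^esub> ?k r"
    "?k (single [] c * p) = c \<odot>\<^bsub>?C\<^esub> ?k p"
    if "p \<in> formal_tensors W" "r \<in> formal_tensors W" for p r c
  proof -
    note c = tensor_class_in_carrier[OF W that(1)] tensor_class_in_carrier[OF W that(2)]
    show "?k (p + r) = ?k p \<oplus>\<^bsub>?C\<^esub> ?k r"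
      using alg_hom_add[OF clifford_coset_hom c] by (simp only: tensor_class_add[OF W])
    show "?k (p * r) = ?k p \<otimes>\<^bsub>?C\<^esub> ?k r"
      using alg_hom_mult[OF clifford_coset_hom c] by (simp only: tensor_class_mult[OF W that])
    show "?k (single [] c * p) = c \<odot>\<^bsub>?C\<^esub> ?k p"
      using alg_hom_scale[OF clifford_coset_hom c(1)] by (simp only: tensor_class_scale[OF W])
  qed
  have k1: "?k (single [] 1) = \<one>\<^bsub>?C\<^esub>"
    using alg_hom_one[OF clifford_coset_hom] by (simp only: tensor_class_one[OF W] one_eq_single)
  have word: "h (?k (single l 1)) = h' (?k (single l 1))"
    if "set l \<subseteq> carrier W" for l
    using that
  proof (induction l)
    case Nil
    then show ?case by (simp only: k1 alg_hom_one[OF h] alg_hom_one[OF h'])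
  next
    case (Cons v l)
    have m: "single [v] 1 \<in> formal_tensors W" "single l 1 \<in> formal_tensors W"
      using Cons.prems by (intro formal_tensors_single; simp)+
    have "single (v # l) 1 = single [v] (1::real) * single l 1"
      by (simp add: single_mult_single)
    then have "?k (single (v # l) 1)
        = clifford_coset W q (tensor_incl W v) \<otimes>\<^bsub>?C\<^esub> ?k (single l 1)"
      by (simp only: k(2)[OF m] tensor_class_incl[OF W])
    moreover have "clifford_coset W q (tensor_incl W v) \<in> carrier ?C"
      using k_closed[OF m(1)] by (simp only: tensor_class_incl[OF W])
    ultimately show ?case
      using Cons gen[of v] k_closed[OF m(2)] by (simp add: alg_hom_mult[OF h] alg_hom_mult[OF h'])
  qed
  obtain p where p: "keys p \<subseteq> lists (carrier W)" "a = ?k p"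
    using a unfolding carrier_clifford_algebra carrier_tensor_algebra[OF W] by blast
  have scalar_word: "h (?k (single l c)) = h' (?k (single l c))"
    if "set l \<subseteq> carrier W" for l c
  proof -
    have m: "single l 1 \<in> formal_tensors W" by (rule formal_tensors_single[OF that])
    have eq: "single l c = single [] c * single l 1"
      by (simp add: single_mult_single)
    show ?thesis
      unfolding eq k(3)[OF m m]
      using word[OF that] k_closed[OF m] by (simp add: alg_hom_scale[OF h] alg_hom_scale[OF h'])
  qed
  have "h (?k p) = h' (?k p)"
    using p(1)
  proof (induction p rule: combination_induct)
    case zero
    show ?case using scalar_word[of "[]" 0] by simp
  next
    case (single k c)
    then show ?case using scalar_word[of k c] by auto
  next
    case (add p r)
    then have m: "p \<in> formal_tensors W" "r \<in> formal_tensors W" by auto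
    show ?case
      unfolding k(1)[OF m] using add.IH k_closed[OF m(1)] k_closed[OF m(2)]
      by (simp add: alg_hom_add[OF h] alg_hom_add[OF h'])
  qed
  then show ?thesis by (simp add: p(2))
qed

end

text \<open>The homomorphism of Clifford algebras extending a form-preserving linear map \<open>\<phi>\<close>. The last
  property describes it on classes of tensors; it is what makes it smooth in families.\<close>

lemma clifford_extension:
  fixes W1 :: "(real, 'v, 'm) module_scheme" and W2 :: "(real, 'w, 'n) module_scheme"
  assumes W1: "module real_alg W1" and W2: "module real_alg W2" and \<phi>: "linear_map W1 W2 \<phi>"
    and q: "\<And>v w. v \<in> carrier W1 \<Longrightarrow> w \<in> carrier W1 \<Longrightarrow> q1 v w = q2 (\<phi> v) (\<phi> w)"
  obtains h where "h \<in> extensional (carrier (clifford_algebra W1 q1))"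
    "h \<in> alg_hom (clifford_algebra W1 q1) (clifford_algebra W2 q2)"
    "\<And>v. v \<in> carrier W1 \<Longrightarrow> h (clifford_coset W1 q1 (tensor_incl W1 v))
      = clifford_coset W2 q2 (tensor_incl W2 (\<phi> v))"
    "\<And>t. t \<in> carrier (tensor_algebra W1) \<Longrightarrow>
      h (clifford_coset W1 q1 t) = clifford_coset W2 q2 (tensor_algebra_map W2 \<phi> t)"
proof -
  let ?T1 = "tensor_algebra W1" and ?T2 = "tensor_algebra W2" and ?m = "tensor_algebra_map W2 \<phi>"
  let ?C1 = "clifford_algebra W1 q1" and ?C2 = "clifford_algebra W2 q2"
  have m_alg: "?m \<in> alg_hom ?T1 ?T2" by (rule tensor_algebra_map_hom[OF W1 W2 \<phi>])
  have m_ring: "?m \<in> ring_hom ?T1 ?T2" using m_alg by (simp add: alg_hom_def)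
  interpret T: ring_hom_ring ?T1 ?T2 ?m
    by (rule ring_hom_ringI2[OF ring_tensor_algebra[OF W1] ring_tensor_algebra[OF W2] m_ring])
  \<comment> \<open>the preimage of the second Clifford ideal is an ideal containing the relators of the first\<close>
  have "ideal {r \<in> carrier ?T1. ?m r \<in> clifford_ideal W2 q2} ?T1"
    by (rule T.ideal_vimage[OF ideal_clifford_ideal[OF W2]])
  moreover have "clifford_relators W1 q1 \<subseteq> {r \<in> carrier ?T1. ?m r \<in> clifford_ideal W2 q2}"
  proof
    fix x assume x: "x \<in> clifford_relators W1 q1"
    then obtain v w where vw: "v \<in> carrier W1" "w \<in> carrier W1"
      "x = tensor_class W1 (single [v, w] 1
        + single [w, v] 1 + single [] (4 * q1 v w))"
      unfolding clifford_relators_eq[OF W1] by blast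
    have "?m x = tensor_class W2 (single [\<phi> v, \<phi> w] 1
        + single [\<phi> w, \<phi> v] 1 + single [] (4 * q2 (\<phi> v) (\<phi> w)))"
      unfolding vw(3) tensor_algebra_map_class[OF W1 W2 \<phi>]
      by (simp add: word_map_add word_map_single q[OF vw(1,2)])
    moreover have "\<phi> v \<in> carrier W2" "\<phi> w \<in> carrier W2"
      using vw \<phi> by (auto simp: linear_map_def)
    ultimately have "?m x \<in> clifford_relators W2 q2"
      unfolding clifford_relators_eq[OF W2] by blast
    then have "?m x \<in> clifford_ideal W2 q2"
      unfolding clifford_ideal_def using T.S.genideal_self[OF clifford_relators_subset[OF W2]] by blast
    then show "x \<in> {r \<in> carrier ?T1. ?m r \<in> clifford_ideal W2 q2}"
      using x clifford_relators_subset[OF W1] by blast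
  qed
  ultimately have ideal: "clifford_ideal W1 q1 \<subseteq> {r \<in> carrier ?T1. ?m r \<in> clifford_ideal W2 q2}"
    unfolding clifford_ideal_def[of W1] by (rule T.R.genideal_minimal)
  have well: "clifford_coset W2 q2 (?m s) = clifford_coset W2 q2 (?m t)"
    if "s \<in> carrier ?T1" "t \<in> carrier ?T1" "clifford_coset W1 q1 s = clifford_coset W1 q1 t" for s t
  proof -
    have "s \<ominus>\<^bsub>?T1\<^esub> t \<in> clifford_ideal W1 q1"
      using that clifford_coset_eq_iff[OF W1] by blast
    then have "?m (s \<ominus>\<^bsub>?T1\<^esub> t) \<in> clifford_ideal W2 q2" using ideal by blast
    then have "?m s \<ominus>\<^bsub>?T2\<^esub> ?m t \<in> clifford_ideal W2 q2"
      using that by (simp add: a_minus_def)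
    then show ?thesis
      using that clifford_coset_eq_iff[OF W2] T.hom_closed by blast
  qed
  define h where "h = restrict (\<lambda>a. clifford_coset W2 q2 (?m (SOME t. t \<in> a))) (carrier ?C1)"
  have h: "h (clifford_coset W1 q1 t) = clifford_coset W2 q2 (?m t)" if t: "t \<in> carrier ?T1" for t
  proof -
    have "(SOME s. s \<in> clifford_coset W1 q1 t) \<in> clifford_coset W1 q1 t"
      by (rule someI[of _ t]) (rule clifford_coset_self[OF W1 t])
    note s = mem_clifford_cosetD[OF W1 t this]
    have "clifford_coset W1 q1 t \<in> carrier ?C1"
      unfolding carrier_clifford_algebra[OF W1] using t by blast
    then show ?thesis
      using well[OF s(1) t s(2)] by (simp add: h_def)
  qed
  have k1: "clifford_coset W1 q1 \<in> alg_hom ?T1 ?C1" and k2: "clifford_coset W2 q2 \<in> alg_hom ?T2 ?C2"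
    by (rule clifford_coset_hom[OF W1] clifford_coset_hom[OF W2])+
  have "h \<in> alg_hom ?C1 ?C2"
  proof -
    have closed: "h a \<in> carrier ?C2" if "a \<in> carrier ?C1" for a
      using that h T.hom_closed unfolding carrier_clifford_algebra[OF W1] carrier_clifford_algebra[OF W2]
      by auto
    have add: "h (a \<oplus>\<^bsub>?C1\<^esub> b) = h a \<oplus>\<^bsub>?C2\<^esub> h b"
      and mult: "h (a \<otimes>\<^bsub>?C1\<^esub> b) = h a \<otimes>\<^bsub>?C2\<^esub> h b"
      if ab: "a \<in> carrier ?C1" "b \<in> carrier ?C1" for a b
    proof -
      obtain s t where s: "s \<in> carrier ?T1" "a = clifford_coset W1 q1 s"
        and t: "t \<in> carrier ?T1" "b = clifford_coset W1 q1 t"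
        using ab unfolding carrier_clifford_algebra[OF W1] by blast
      have "a \<oplus>\<^bsub>?C1\<^esub> b = clifford_coset W1 q1 (s \<oplus>\<^bsub>?T1\<^esub> t)"
        "a \<otimes>\<^bsub>?C1\<^esub> b = clifford_coset W1 q1 (s \<otimes>\<^bsub>?T1\<^esub> t)"
        using s t by (simp_all add: alg_hom_add[OF k1] alg_hom_mult[OF k1])
      moreover have "clifford_coset W2 q2 (?m s \<oplus>\<^bsub>?T2\<^esub> ?m t) = h a \<oplus>\<^bsub>?C2\<^esub> h b"
        "clifford_coset W2 q2 (?m s \<otimes>\<^bsub>?T2\<^esub> ?m t) = h a \<otimes>\<^bsub>?C2\<^esub> h b"
        using s t h by (simp_all add: alg_hom_add[OF k2] alg_hom_mult[OF k2])
      ultimately show "h (a \<oplus>\<^bsub>?C1\<^esub> b) = h a \<oplus>\<^bsub>?C2\<^esub> h b" "h (a \<otimes>\<^bsub>?C1\<^esub> b) = h a \<otimes>\<^bsub>?C2\<^esub> h b"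
        using s t h by simp_all
    qed
    have scale: "h (c \<odot>\<^bsub>?C1\<^esub> a) = c \<odot>\<^bsub>?C2\<^esub> h a" if a: "a \<in> carrier ?C1" for a c
    proof -
      obtain s where s: "s \<in> carrier ?T1" "a = clifford_coset W1 q1 s"
        using a unfolding carrier_clifford_algebra[OF W1] by blast
      have "c \<odot>\<^bsub>?C1\<^esub> a = clifford_coset W1 q1 (c \<odot>\<^bsub>?T1\<^esub> s)"
        using s by (simp add: alg_hom_scale[OF k1])
      moreover have "?m (c \<odot>\<^bsub>?T1\<^esub> s) = c \<odot>\<^bsub>?T2\<^esub> ?m s"
        by (rule alg_hom_scale[OF m_alg s(1)])
      moreover have "clifford_coset W2 q2 (c \<odot>\<^bsub>?T2\<^esub> ?m s) = c \<odot>\<^bsub>?C2\<^esub> h a"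
        using s h by (simp add: alg_hom_scale[OF k2])
      ultimately show ?thesis
        using s h smult_tensor_algebra(2)[OF W1 s(1), of c] by simp
    qed
    have "h \<one>\<^bsub>?C1\<^esub> = \<one>\<^bsub>?C2\<^esub>"
    proof -
      have "\<one>\<^bsub>?C1\<^esub> = clifford_coset W1 q1 \<one>\<^bsub>?T1\<^esub>" "\<one>\<^bsub>?C2\<^esub> = clifford_coset W2 q2 \<one>\<^bsub>?T2\<^esub>"
        by (simp_all add: alg_hom_one[OF k1] alg_hom_one[OF k2])
      then show ?thesis by (simp add: h)
    qed
    with closed add mult scale show ?thesis by (intro alg_homI)
  qed
  moreover have "h (clifford_coset W1 q1 (tensor_incl W1 v)) = clifford_coset W2 q2 (tensor_incl W2 (\<phi> v))"
    if v: "v \<in> carrier W1" for v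
  proof -
    have "tensor_incl W1 v \<in> carrier ?T1"
      unfolding tensor_class_incl[OF W1]
      by (intro tensor_class_in_carrier[OF W1] formal_tensors_single) (use v in auto)
    moreover have "?m (tensor_incl W1 v) = tensor_incl W2 (\<phi> v)"
      unfolding tensor_class_incl[OF W1] tensor_class_incl[OF W2] tensor_algebra_map_class[OF W1 W2 \<phi>]
      by (simp add: word_map_single)
    ultimately show ?thesis by (simp add: h)
  qed
  moreover have "h \<in> extensional (carrier ?C1)" by (simp add: h_def)
  ultimately show thesis using that h by blast
qed

section \<open>Smoothness of the map between Clifford algebra bundles\<close>

text \<open>The sum of \<open>k\<close> pure tensors of degree \<open>r\<close>, the \<open>i\<close>-th one with factors \<open>t i j\<close>.\<close>

abbreviation pure_sum ::
  "(real, 'v, 'm) module_scheme \<Rightarrow> nat \<Rightarrow> nat \<Rightarrow> (nat \<Rightarrow> nat \<Rightarrow> 'v) \<Rightarrow> 'v tensor" where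
  "pure_sum W r k t \<equiv> finsum (tensor_power W r) (\<lambda>i. pure_tensor W (map (t i) [0..<r])) {..<k}"

context
  fixes W1 :: "(real, 'v, 'm) module_scheme" and W2 :: "(real, 'w, 'n) module_scheme"
    and \<phi> :: "'v \<Rightarrow> 'w"
  assumes W1: "module real_alg W1" and W2: "module real_alg W2" and \<phi>: "linear_map W1 W2 \<phi>"
begin

lemma tensor_power_map_zero: "tensor_power_map W2 \<phi> r \<zero>\<^bsub>tensor_power W1 r\<^esub> = \<zero>\<^bsub>tensor_power W2 r\<^esub>"
  by (simp add: zero_tensor_power[OF W1] zero_tensor_power[OF W2] tensor_power_map_coset[OF W1 W2 \<phi>])

lemma tensor_power_map_scalar:
  "tensor_power_map W2 \<phi> 0 (a \<odot>\<^bsub>tensor_power W1 0\<^esub> pure_tensor W1 []) = a \<odot>\<^bsub>tensor_power W2 0\<^esub> pure_tensor W2 []"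
  by (simp add: pure_tensor_def smult_tensor_power[OF W1] smult_tensor_power[OF W2]
      tensor_power_map_coset[OF W1 W2 \<phi>] word_map_scale word_map_single)

lemma tensor_power_map_sum:
  assumes t: "\<And>i j. i < k \<Longrightarrow> j < r \<Longrightarrow> t i j \<in> carrier W1"
  shows "tensor_power_map W2 \<phi> r (pure_sum W1 r k t) = pure_sum W2 r k (\<lambda>i j. \<phi> (t i j))"
proof -
  let ?l = "\<lambda>i. map (t i) [0..<r]" and ?l' = "\<lambda>i. map (\<lambda>j. \<phi> (t i j)) [0..<r]"
  have l: "keys (single (?l i) (1::real)) \<subseteq> words W1 r" if "i \<in> {..<k}" for i
    using t that by (auto simp: words_def)
  have l': "keys (single (?l' i) (1::real)) \<subseteq> words W2 r" if "i \<in> {..<k}" for i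
    using t that \<phi> by (auto simp: words_def linear_map_def)
  have "pure_sum W1 r k t = tensor_coset W1 r (\<Sum>i<k. single (?l i) 1)"
    using finsum_tensor_power[where A = "{..<k}" and g = "\<lambda>i. single (?l i) 1", OF W1 l]
    by (simp add: pure_tensor_def)
  moreover have "pure_sum W2 r k (\<lambda>i j. \<phi> (t i j)) = tensor_coset W2 r (\<Sum>i<k. single (?l' i) 1)"
    using finsum_tensor_power[where A = "{..<k}" and g = "\<lambda>i. single (?l' i) 1", OF W2 l']
    by (simp add: pure_tensor_def)
  ultimately show ?thesis
    by (simp add: tensor_power_map_coset[OF W1 W2 \<phi>] word_map_sum word_map_single o_def)
qed

end

text \<open>The plots of tensor powers before localization: finite sums of pure tensors of plots over a
  common plot of the base for positive degree, and plots of \<open>X \<times> \<real>\<close> in degree \<open>0\<close>.\<close>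

definition tensor_sum_plot :: "('x, 'v) vbundle \<Rightarrow> nat \<Rightarrow> ('x \<times> 'v tensor) plot_pred" where
  "tensor_sum_plot B r n U p \<longleftrightarrow> (\<exists>\<xi> k s. plots (base B) n U \<xi> \<and>
     (\<forall>i<k. \<forall>j<r. plots (total B) n U (s i j) \<and> (\<forall>u\<in>U. proj B (s i j u) = \<xi> u)) \<and>
     (\<forall>u\<in>U. p u = (\<xi> u,
        pure_sum (fibre B (\<xi> u)) r k (\<lambda>i j. s i j u))))"

definition scalar_plot :: "('x, 'v) vbundle \<Rightarrow> ('x \<times> 'v tensor) plot_pred" where
  "scalar_plot B n U p \<longleftrightarrow> plots (base B) n U (fst \<circ> p) \<and>
     (\<exists>a. smooth_real n U a \<and> (\<forall>u\<in>U. snd (p u) =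
        a u \<odot>\<^bsub>tensor_power (fibre B (fst (p u))) 0\<^esub> pure_tensor (fibre B (fst (p u))) []))"

lemma plots_tensor_power_dspace:
  "plots (tensor_power_dspace B r) = (if r = 0 then scalar_plot B else local_plot (tensor_sum_plot B r))"
  by (simp add: tensor_power_dspace_def scalar_plot_def[abs_def] tensor_sum_plot_def[abs_def])

text \<open>The plots of the tensor algebra bundle before localization.\<close>

definition tensor_chart :: "('x, 'v) vbundle \<Rightarrow> ('x \<times> (nat \<Rightarrow> 'v tensor)) plot_pred" where
  "tensor_chart B n U p \<longleftrightarrow>
     (\<forall>r. plots (tensor_power_dspace B r) n U (\<lambda>u. (fst (p u), snd (p u) r))) \<and>
     (\<exists>N. \<forall>u\<in>U. \<forall>r>N. snd (p u) r = \<zero>\<^bsub>tensor_power (fibre B (fst (p u))) r\<^esub>)"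

lemma plots_tensor_algebra_dspace: "plots (tensor_algebra_dspace B) = local_plot (tensor_chart B)"
  by (simp add: tensor_algebra_dspace_def tensor_chart_def[abs_def])

lemma tensor_chart_components:
  assumes "tensor_chart B n U p"
  shows "scalar_plot B n U (\<lambda>u. (fst (p u), snd (p u) 0))"
    and "r \<noteq> 0 \<Longrightarrow> local_plot (tensor_sum_plot B r) n U (\<lambda>u. (fst (p u), snd (p u) r))"
proof -
  have c: "plots (tensor_power_dspace B r) n U (\<lambda>u. (fst (p u), snd (p u) r))" for r
    using assms by (simp add: tensor_chart_def)
  show "scalar_plot B n U (\<lambda>u. (fst (p u), snd (p u) 0))"
    using c[of 0] by (simp add: plots_tensor_power_dspace)
  show "local_plot (tensor_sum_plot B r) n U (\<lambda>u. (fst (p u), snd (p u) r))" if "r \<noteq> 0"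
    using c[of r] that by (simp add: plots_tensor_power_dspace)
qed

lemma stable_tensor_sum_plot:
  assumes B: "stable_plots (plots (base B))" and T: "stable_plots (plots (total B))"
  shows "stable_plots (tensor_sum_plot B r)"
  unfolding stable_plots_def
proof (intro allI impI conjI)
  fix n U p assume "tensor_sum_plot B r n U p"
  then obtain \<xi> k s where \<xi>: "plots (base B) n U \<xi>"
    and s: "\<And>i j. i < k \<Longrightarrow> j < r \<Longrightarrow> plots (total B) n U (s i j)"
      "\<And>i j u. i < k \<Longrightarrow> j < r \<Longrightarrow> u \<in> U \<Longrightarrow> proj B (s i j u) = \<xi> u"
    and p: "\<And>u. u \<in> U \<Longrightarrow> p u = (\<xi> u, pure_sum (fibre B (\<xi> u)) r k (\<lambda>i j. s i j u))"
    unfolding tensor_sum_plot_def by blast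
  show "open_dom n U" by (rule stable_plots_open[OF B \<xi>])
  fix m W h assume W: "open_dom m W" and h: "smooth_into m W n U h"
  have hU: "h w \<in> U" if "w \<in> W" for w using h that by (auto simp: smooth_into_def)
  show "tensor_sum_plot B r m W (p \<circ> h)"
    unfolding tensor_sum_plot_def
  proof (intro exI conjI allI impI ballI)
    show "plots (base B) m W (\<xi> \<circ> h)" by (rule stable_plots_compose[OF B \<xi> W h])
    show "plots (total B) m W (s i j \<circ> h)" if "i < k" "j < r" for i j
      by (rule stable_plots_compose[OF T s(1)[OF that] W h])
  qed (use hU s(2) p in auto)
qed

lemma stable_scalar_plot:
  assumes B: "stable_plots (plots (base B))"
  shows "stable_plots (scalar_plot B)"
  unfolding stable_plots_def
proof (intro allI impI conjI)
  fix n U p assume "scalar_plot B n U p"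
  then obtain a where p: "plots (base B) n U (fst \<circ> p)" and a: "smooth_real n U a"
    "\<And>u. u \<in> U \<Longrightarrow> snd (p u) =
        a u \<odot>\<^bsub>tensor_power (fibre B (fst (p u))) 0\<^esub> pure_tensor (fibre B (fst (p u))) []"
    unfolding scalar_plot_def by blast
  show U: "open_dom n U" by (rule stable_plots_open[OF B p])
  fix m W h assume W: "open_dom m W" and h: "smooth_into m W n U h"
  have hU: "h w \<in> U" if "w \<in> W" for w using h that by (auto simp: smooth_into_def)
  show "scalar_plot B m W (p \<circ> h)"
    unfolding scalar_plot_def
  proof (intro exI conjI ballI)
    show "plots (base B) m W (fst \<circ> (p \<circ> h))"
      using stable_plots_compose[OF B p W h] by (simp only: comp_assoc)
    show "smooth_real m W (a \<circ> h)" by (rule smooth_real_compose[OF U W h a(1)])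
  qed (use hU a(2) in auto)
qed

lemma stable_tensor_power_dspace:
  "stable_plots (plots (base B)) \<Longrightarrow> stable_plots (plots (total B)) \<Longrightarrow>
    stable_plots (plots (tensor_power_dspace B r))"
  by (simp add: plots_tensor_power_dspace stable_scalar_plot stable_local_plot stable_tensor_sum_plot)

lemma stable_tensor_chart:
  assumes "stable_plots (plots (base B))" "stable_plots (plots (total B))"
  shows "stable_plots (tensor_chart B)"
  unfolding stable_plots_def
proof (intro allI impI conjI)
  note st = stable_tensor_power_dspace[OF assms]
  fix n U p assume "tensor_chart B n U p"
  then obtain N where p: "\<And>r. plots (tensor_power_dspace B r) n U (\<lambda>u. (fst (p u), snd (p u) r))"
    "\<And>u r. u \<in> U \<Longrightarrow> r > N \<Longrightarrow> snd (p u) r = \<zero>\<^bsub>tensor_power (fibre B (fst (p u))) r\<^esub>"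
    unfolding tensor_chart_def by blast
  show "open_dom n U" by (rule stable_plots_open[OF st p(1)])
  fix m W h assume W: "open_dom m W" and h: "smooth_into m W n U h"
  have hU: "h w \<in> U" if "w \<in> W" for w using h that by (auto simp: smooth_into_def)
  have "plots (tensor_power_dspace B r) m W (\<lambda>w. (fst ((p \<circ> h) w), snd ((p \<circ> h) w) r))" for r
    using stable_plots_compose[OF st p(1) W h] by (simp add: o_def)
  moreover have "\<forall>w\<in>W. \<forall>r>N. snd ((p \<circ> h) w) r = \<zero>\<^bsub>tensor_power (fibre B (fst ((p \<circ> h) w))) r\<^esub>"
    using hU p(2) by simp
  ultimately show "tensor_chart B m W (p \<circ> h)" unfolding tensor_chart_def by blast
qed

lemma stable_clifford_dspace:
  assumes "pseudo_bundle B" shows "stable_plots (plots (clifford_dspace B g))"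
  unfolding clifford_dspace_def
  by (rule stable_quot_dspace)
    (simp add: plots_tensor_algebra_dspace stable_local_plot stable_tensor_chart pseudo_bundleD[OF assms])

lemma tensor_chart_points:
  assumes B: "pseudo_bundle B" and p: "tensor_chart B n U p" and u: "u \<in> U"
  shows "fst (p u) \<in> points (base B)" "snd (p u) \<in> carrier (tensor_algebra (fibre B (fst (p u))))"
proof -
  let ?W = "fibre B (fst (p u))"
  obtain a where a: "plots (base B) n U (fst \<circ> (\<lambda>u. (fst (p u), snd (p u) 0)))"
    "snd (p u) 0 = a u \<odot>\<^bsub>tensor_power ?W 0\<^esub> pure_tensor ?W []"
    using tensor_chart_components(1)[OF p] u unfolding scalar_plot_def by auto
  show x: "fst (p u) \<in> points (base B)"
    using diffeology.plot_range[OF pseudo_bundleD(1)[OF B] a(1)] u by auto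
  have W: "module real_alg ?W" by (rule pseudo_bundleD(7)[OF B x])
  have "snd (p u) r \<in> carrier (tensor_power ?W r)" for r
  proof (cases "r = 0")
    case True
    have "keys (single [] (a u)) \<subseteq> words ?W 0"
      by (simp add: words_def)
    then have "snd (p u) 0 \<in> carrier (tensor_power ?W 0)"
      unfolding a(2) by (auto simp: pure_tensor_def smult_tensor_power[OF W] single_mult_single carrier_tensor_power[OF W])
    then show ?thesis using True by simp
  next
    case False
    then have "local_plot (tensor_sum_plot B r) n U (\<lambda>u. (fst (p u), snd (p u) r))"
      by (rule tensor_chart_components(2)[OF p])
    then obtain V q where V: "u \<in> V" "tensor_sum_plot B r n V q" "\<forall>v\<in>V. (fst (p v), snd (p v) r) = q v"
      using u unfolding local_plot_def by blast
    then obtain \<xi> k s where s: "\<And>i j. i < k \<Longrightarrow> j < r \<Longrightarrow> plots (total B) n V (s i j)"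
        "\<And>i j u. i < k \<Longrightarrow> j < r \<Longrightarrow> u \<in> V \<Longrightarrow> proj B (s i j u) = \<xi> u"
      and q: "\<And>u. u \<in> V \<Longrightarrow> q u = (\<xi> u, pure_sum (fibre B (\<xi> u)) r k (\<lambda>i j. s i j u))"
      unfolding tensor_sum_plot_def by blast
    have eq: "(fst (p u), snd (p u) r) = q u" using V(1,3) by blast
    then have \<xi>: "\<xi> u = fst (p u)" using q[OF V(1)] by simp
    then have snd_eq: "snd (p u) r = finsum (tensor_power ?W r)
        (\<lambda>i. pure_tensor ?W (map (\<lambda>j. s i j u) [0..<r])) {..<k}"
      using q[OF V(1)] eq by simp
    interpret abelian_group "tensor_power ?W r" by (rule abelian_group_tensor_power[OF W])
    have "pure_tensor ?W (map (\<lambda>j. s i j u) [0..<r]) \<in> carrier (tensor_power ?W r)" if i: "i < k" for i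
    proof -
      have "s i j u \<in> carrier ?W" if "j < r" for j
        using pseudo_bundleD(6)[OF B s(1)[OF i that] V(1)] s(2)[OF i that V(1)] \<xi>
        by (simp add: carrier_fibre)
      then have "keys (single (map (\<lambda>j. s i j u) [0..<r]) (1::real)) \<subseteq> words ?W r"
        by (auto simp: words_def)
      then show ?thesis
        unfolding carrier_tensor_power[OF W] pure_tensor_def by simp
    qed
    then show ?thesis unfolding snd_eq by (intro finsum_closed) auto
  qed
  moreover have "finite {r. snd (p u) r \<noteq> \<zero>\<^bsub>tensor_power ?W r\<^esub>}"
  proof -
    obtain N where "\<forall>u\<in>U. \<forall>r>N. snd (p u) r = \<zero>\<^bsub>tensor_power (fibre B (fst (p u))) r\<^esub>"
      using p unfolding tensor_chart_def by blast
    then have "{r. snd (p u) r \<noteq> \<zero>\<^bsub>tensor_power ?W r\<^esub>} \<subseteq> {..N}"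
      using u by (auto simp: not_less[symmetric])
    then show ?thesis by (rule finite_subset) simp
  qed
  ultimately show "snd (p u) \<in> carrier (tensor_algebra ?W)"
    by (simp add: tensor_algebra_def)
qed

abbreviation clifford_class ::
  "('x, 'v) vbundle \<Rightarrow> ('x, 'v) metric \<Rightarrow> 'x \<Rightarrow> (nat \<Rightarrow> 'v tensor) \<Rightarrow> (nat \<Rightarrow> 'v tensor) set" where
  "clifford_class B g x \<equiv> clifford_coset (fibre B x) (metric_form g x)"

lemma plots_clifford_dspaceE:
  assumes "plots (clifford_dspace B g) n U p" "u \<in> U"
  obtains W q where "open_dom n W" "u \<in> W" "W \<subseteq> U" "tensor_chart B n W q"
    "\<And>w. w \<in> W \<Longrightarrow> p w = (fst (q w), clifford_class B g (fst (q w)) (snd (q w)))"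
proof -
  let ?\<pi> = "\<lambda>(x, t). (x, clifford_class B g x t)"
  have "local_plot (\<lambda>n U p. \<exists>q. local_plot (tensor_chart B) n U q \<and> p = ?\<pi> \<circ> q) n U p"
    using assms(1) by (simp add: clifford_dspace_def quot_dspace_def plots_tensor_algebra_dspace)
  then obtain V p' where V: "u \<in> V" "V \<subseteq> U" "\<exists>q. local_plot (tensor_chart B) n V q \<and> p' = ?\<pi> \<circ> q"
    "\<forall>v\<in>V. p v = p' v"
    using assms(2) unfolding local_plot_def[of "\<lambda>n U p. \<exists>q. local_plot (tensor_chart B) n U q \<and> p = ?\<pi> \<circ> q"]
    by blast
  then obtain q where q: "local_plot (tensor_chart B) n V q" "\<And>v. v \<in> V \<Longrightarrow> p v = ?\<pi> (q v)"
    by auto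
  then obtain W r where W: "open_dom n W" "u \<in> W" "W \<subseteq> V" "tensor_chart B n W r"
    "\<forall>w\<in>W. q w = r w"
    using V(1) unfolding local_plot_def by blast
  have "p w = (fst (r w), clifford_class B g (fst (r w)) (snd (r w)))"
    if "w \<in> W" for w
    using q(2)[of w] W(3,5) that by (auto simp: split_beta)
  then show thesis using that W V(2) by (meson subset_trans)
qed

lemma plots_clifford_dspaceI:
  assumes U: "open_dom n U"
    and loc: "\<And>u. u \<in> U \<Longrightarrow> \<exists>W q. open_dom n W \<and> u \<in> W \<and> W \<subseteq> U \<and> tensor_chart B n W q \<and>
      (\<forall>w\<in>W. p w = (fst (q w), clifford_class B g (fst (q w)) (snd (q w))))"
  shows "plots (clifford_dspace B g) n U p"
proof -
  let ?\<pi> = "\<lambda>(x, t). (x, clifford_class B g x t)"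
  have "local_plot (\<lambda>n U p. \<exists>q. local_plot (tensor_chart B) n U q \<and> p = ?\<pi> \<circ> q) n U p"
    unfolding local_plot_def[of "\<lambda>n U p. \<exists>q. local_plot (tensor_chart B) n U q \<and> p = ?\<pi> \<circ> q"]
  proof (intro conjI U ballI)
    fix u assume "u \<in> U"
    then obtain W q where W: "open_dom n W" "u \<in> W" "W \<subseteq> U" "tensor_chart B n W q"
      "\<forall>w\<in>W. p w = (fst (q w), clifford_class B g (fst (q w)) (snd (q w)))"
      using loc by metis
    have "local_plot (tensor_chart B) n W q" using W(4,1) by (rule local_plotI)
    moreover have "\<forall>w\<in>W. p w = (?\<pi> \<circ> q) w" using W(5) by (simp add: split_beta)
    ultimately show "\<exists>W p'. open_dom n W \<and> u \<in> W \<and> W \<subseteq> U \<and>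
        (\<exists>q. local_plot (tensor_chart B) n W q \<and> p' = ?\<pi> \<circ> q) \<and> (\<forall>w\<in>W. p w = p' w)"
      using W(1-3) by blast
  qed
  then show ?thesis by (simp add: clifford_dspace_def quot_dspace_def plots_tensor_algebra_dspace)
qed

lemma points_clifford_dspace:
  "points (clifford_dspace B g) = {(x, clifford_class B g x t) | x t.
    x \<in> points (base B) \<and> t \<in> carrier (tensor_algebra (fibre B x))}"
  by (auto simp: clifford_dspace_def quot_dspace_def tensor_algebra_dspace_def image_iff)

lemma points_plots_clifford:
  assumes "pseudo_bundle B" "plots (clifford_dspace B g) n U p" "u \<in> U"
  shows "p u \<in> points (clifford_dspace B g)"
proof -
  obtain W q where "u \<in> W" "tensor_chart B n W q"
    "\<And>w. w \<in> W \<Longrightarrow> p w = (fst (q w), clifford_class B g (fst (q w)) (snd (q w)))"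
    using plots_clifford_dspaceE[OF assms(2,3)] by metis
  then show ?thesis
    using tensor_chart_points[OF assms(1)] unfolding points_clifford_dspace by blast
qed

text \<open>Existence (by extension) and uniqueness identify the homomorphism in the definition of
  \<^const>\<open>clifford_map\<close> with the one induced by \<open>ft\<close> on tensors.\<close>

lemma clifford_map_eq:
  assumes V1: "pseudo_bundle V1" and V2: "pseudo_bundle V2" and gl: "bundle_gluing V1 V2 Y f ft"
    and comp: "compatible_metrics V1 Y f ft g1 g2" and y: "y \<in> Y"
    and t: "t \<in> carrier (tensor_algebra (fibre V1 y))"
  shows "clifford_map V1 g1 V2 g2 f ft (y, clifford_class V1 g1 y t)
    = (f y, clifford_class V2 g2 (f y) (tensor_algebra_map (fibre V2 (f y)) ft t))"
proof -
  let ?A1 = "clifford_fibre V1 g1 y" and ?A2 = "clifford_fibre V2 g2 (f y)"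
  have yf: "y \<in> points (base V1)" "f y \<in> points (base V2)" and lin: "linear_map (fibre V1 y) (fibre V2 (f y)) ft"
    using gl y by (auto simp: bundle_gluing_def)
  have W1: "module real_alg (fibre V1 y)" and W2: "module real_alg (fibre V2 (f y))"
    using pseudo_bundleD(7)[OF V1 yf(1)] pseudo_bundleD(7)[OF V2 yf(2)] .
  obtain h where h: "h \<in> extensional (carrier ?A1)" "h \<in> alg_hom ?A1 ?A2"
    "\<And>v. v \<in> carrier (fibre V1 y) \<Longrightarrow> h (clifford_incl V1 g1 y v) = clifford_incl V2 g2 (f y) (ft v)"
    and ht: "\<And>t. t \<in> carrier (tensor_algebra (fibre V1 y)) \<Longrightarrow>
      h (clifford_class V1 g1 y t)
        = clifford_class V2 g2 (f y) (tensor_algebra_map (fibre V2 (f y)) ft t)"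
    unfolding clifford_fibre_def clifford_incl_def
    using clifford_extension[OF W1 W2 lin, of "metric_form g1 y" "metric_form g2 (f y)"] comp y
    unfolding compatible_metrics_def by blast
  have "(THE h. h \<in> extensional (carrier ?A1) \<and> h \<in> alg_hom ?A1 ?A2 \<and>
      (\<forall>v\<in>carrier (fibre V1 y). h (clifford_incl V1 g1 y v) = clifford_incl V2 g2 (f y) (ft v))) = h"
  proof (rule the_equality)
    fix h' assume h': "h' \<in> extensional (carrier ?A1) \<and> h' \<in> alg_hom ?A1 ?A2 \<and>
      (\<forall>v\<in>carrier (fibre V1 y). h' (clifford_incl V1 g1 y v) = clifford_incl V2 g2 (f y) (ft v))"
    show "h' = h"
    proof (rule extensionalityI)
      show "h' \<in> extensional (carrier ?A1)" "h \<in> extensional (carrier ?A1)" using h h' by blast+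
      show "h' a = h a" if "a \<in> carrier ?A1" for a
      proof (rule alg_hom_clifford_unique[OF W1])
        show "h' \<in> alg_hom (clifford_algebra (fibre V1 y) (metric_form g1 y)) ?A2"
          "h \<in> alg_hom (clifford_algebra (fibre V1 y) (metric_form g1 y)) ?A2"
          using h h' by (simp_all add: clifford_fibre_def)
        show "h' (clifford_class V1 g1 y (tensor_incl (fibre V1 y) v))
            = h (clifford_class V1 g1 y (tensor_incl (fibre V1 y) v))"
          if "v \<in> carrier (fibre V1 y)" for v
          using h(3)[OF that] h' that by (simp add: clifford_incl_def)
        show "a \<in> carrier (clifford_algebra (fibre V1 y) (metric_form g1 y))"
          using that by (simp add: clifford_fibre_def)
      qed
    qed
  qed (use h in blast)
  then show ?thesis using ht[OF t] by (simp add: clifford_map_def)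
qed

text \<open>The algebra homomorphisms of the fibres send tensor plots over \<open>Y\<close> to tensor plots.\<close>

lemma tensor_chart_map:
  assumes V1: "pseudo_bundle V1" and V2: "pseudo_bundle V2" and gl: "bundle_gluing V1 V2 Y f ft"
    and p: "tensor_chart V1 n U p" and Y: "\<And>u. u \<in> U \<Longrightarrow> fst (p u) \<in> Y"
  shows "tensor_chart V2 n U (\<lambda>u. (f (fst (p u)), tensor_algebra_map (fibre V2 (f (fst (p u)))) ft (snd (p u))))"
    (is "tensor_chart V2 n U ?q")
proof -
  have f_plots: "plots (base V2) m W (f \<circ> \<xi>)" if "plots (base V1) m W \<xi>" "\<xi> ` W \<subseteq> Y" for m W \<xi>
    using gl that by (simp add: bundle_gluing_def diffeomorphism_def smooth_map_def sub_dspace_def)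
  have ft_plots: "plots (total V2) m W (ft \<circ> s)"
    if "plots (total V1) m W s" "\<And>w. w \<in> W \<Longrightarrow> proj V1 (s w) \<in> Y" for m W s
  proof -
    have "s ` W \<subseteq> over (total V1) (proj V1) Y"
      using that pseudo_bundleD(6)[OF V1 that(1)] by (auto simp: over_def)
    then show ?thesis
      using gl that(1) by (simp add: bundle_gluing_def smooth_map_def sub_dspace_def)
  qed
  have ft_proj: "proj V2 (ft v) = f (proj V1 v)" if "v \<in> points (total V1)" "proj V1 v \<in> Y" for v
    using gl that by (simp add: bundle_gluing_def over_def)
  have lin: "linear_map (fibre V1 y) (fibre V2 (f y)) ft"
    and W1: "module real_alg (fibre V1 y)" and W2: "module real_alg (fibre V2 (f y))" if "y \<in> Y" for y
    using gl that pseudo_bundleD(7)[OF V1, of y] pseudo_bundleD(7)[OF V2, of "f y"]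
    by (auto simp: bundle_gluing_def)
  have "plots (tensor_power_dspace V2 r) n U (\<lambda>u. (fst (?q u), snd (?q u) r))" for r
  proof (cases "r = 0")
    case True
    obtain a where a: "plots (base V1) n U (\<lambda>u. fst (p u))" "smooth_real n U a"
      "\<And>u. u \<in> U \<Longrightarrow> snd (p u) 0 = a u \<odot>\<^bsub>tensor_power (fibre V1 (fst (p u))) 0\<^esub> pure_tensor (fibre V1 (fst (p u))) []"
      using tensor_chart_components(1)[OF p] unfolding scalar_plot_def by (auto simp: o_def)
    have "plots (base V2) n U (f \<circ> (\<lambda>u. fst (p u)))" using Y by (intro f_plots[OF a(1)]) auto
    moreover have "snd (?q u) 0 = a u \<odot>\<^bsub>tensor_power (fibre V2 (fst (?q u))) 0\<^esub> pure_tensor (fibre V2 (fst (?q u))) []"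
      if "u \<in> U" for u
      using tensor_power_map_scalar[OF W1[OF Y[OF that]] W2[OF Y[OF that]] lin[OF Y[OF that]]]
      by (simp add: tensor_algebra_map_def a(3)[OF that])
    ultimately have "scalar_plot V2 n U (\<lambda>u. (fst (?q u), snd (?q u) 0))"
      unfolding scalar_plot_def using a(2) by (auto simp: o_def)
    then show ?thesis using True by (simp add: plots_tensor_power_dspace)
  next
    case False
    then have loc: "local_plot (tensor_sum_plot V1 r) n U (\<lambda>u. (fst (p u), snd (p u) r))"
      by (rule tensor_chart_components(2)[OF p])
    have "local_plot (tensor_sum_plot V2 r) n U (\<lambda>u. (fst (?q u), snd (?q u) r))"
      unfolding local_plot_def
    proof (intro conjI ballI)
      show "open_dom n U" using loc by (simp add: local_plot_def)
      fix u assume u: "u \<in> U"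
      then obtain V p' where V: "open_dom n V" "u \<in> V" "V \<subseteq> U" "tensor_sum_plot V1 r n V p'"
        "\<forall>v\<in>V. (fst (p v), snd (p v) r) = p' v"
        using loc unfolding local_plot_def by blast
      then obtain \<xi> k s where \<xi>: "plots (base V1) n V \<xi>"
        and s: "\<And>i j. i < k \<Longrightarrow> j < r \<Longrightarrow> plots (total V1) n V (s i j)"
          "\<And>i j u. i < k \<Longrightarrow> j < r \<Longrightarrow> u \<in> V \<Longrightarrow> proj V1 (s i j u) = \<xi> u"
        and p': "\<And>u. u \<in> V \<Longrightarrow> p' u = (\<xi> u, pure_sum (fibre V1 (\<xi> u)) r k (\<lambda>i j. s i j u))"
        unfolding tensor_sum_plot_def by blast
      have pv: "fst (p v) = \<xi> v" "snd (p v) r = pure_sum (fibre V1 (\<xi> v)) r k (\<lambda>i j. s i j v)" if "v \<in> V" for v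
        using V(5) p'[OF that] that by auto
      have \<xi>Y: "\<xi> v \<in> Y" if "v \<in> V" for v using Y[of v] pv(1)[OF that] V(3) that by auto
      have s_carr: "s i j v \<in> carrier (fibre V1 (\<xi> v))" if "i < k" "j < r" "v \<in> V" for i j v
        using pseudo_bundleD(6)[OF V1 s(1)[OF that(1,2)] that(3)] s(2)[OF that] by (simp add: carrier_fibre)
      have "tensor_sum_plot V2 r n V (\<lambda>u. (fst (?q u), snd (?q u) r))"
        unfolding tensor_sum_plot_def
      proof (intro exI conjI allI impI ballI)
        show "plots (base V2) n V (f \<circ> \<xi>)" using \<xi>Y by (intro f_plots[OF \<xi>]) auto
        show "plots (total V2) n V (ft \<circ> s i j)" if "i < k" "j < r" for i j
          by (rule ft_plots[OF s(1)[OF that]]) (simp add: s(2)[OF that] \<xi>Y)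
        show "proj V2 ((ft \<circ> s i j) v) = (f \<circ> \<xi>) v" if "i < k" "j < r" "v \<in> V" for i j v
          using s_carr[OF that] \<xi>Y[OF that(3)] by (simp add: carrier_fibre ft_proj)
        fix v assume v: "v \<in> V"
        have "tensor_power_map (fibre V2 (f (\<xi> v))) ft r (pure_sum (fibre V1 (\<xi> v)) r k (\<lambda>i j. s i j v))
          = pure_sum (fibre V2 (f (\<xi> v))) r k (\<lambda>i j. ft (s i j v))"
          using \<xi>Y[OF v] s_carr v
          by (intro tensor_power_map_sum W1 W2 lin) auto
        then show "(fst (?q v), snd (?q v) r) = ((f \<circ> \<xi>) v, 
            pure_sum (fibre V2 ((f \<circ> \<xi>) v)) r k (\<lambda>i j. (ft \<circ> s i j) v))"
          by (simp add: tensor_algebra_map_def pv[OF v] o_def)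
      qed
      then show "\<exists>V q. open_dom n V \<and> u \<in> V \<and> V \<subseteq> U \<and> tensor_sum_plot V2 r n V q \<and>
          (\<forall>w\<in>V. (fst (?q w), snd (?q w) r) = q w)"
        using V(1-3) by blast
    qed
    then show ?thesis using False by (simp add: plots_tensor_power_dspace)
  qed
  moreover have "\<exists>N. \<forall>u\<in>U. \<forall>r>N. snd (?q u) r = \<zero>\<^bsub>tensor_power (fibre V2 (fst (?q u))) r\<^esub>"
  proof -
    obtain N where N: "\<And>u r. u \<in> U \<Longrightarrow> r > N \<Longrightarrow> snd (p u) r = \<zero>\<^bsub>tensor_power (fibre V1 (fst (p u))) r\<^esub>"
      using p unfolding tensor_chart_def by blast
    have "snd (?q u) r = \<zero>\<^bsub>tensor_power (fibre V2 (fst (?q u))) r\<^esub>" if "u \<in> U" "r > N" for u r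
      using tensor_power_map_zero[OF W1[OF Y] W2[OF Y] lin[OF Y]] that
      by (simp add: tensor_algebra_map_def N)
    then show ?thesis by blast
  qed
  ultimately show ?thesis unfolding tensor_chart_def by blast
qed

section \<open>Smoothness of the induced Clifford action\<close>

theorem theorem6p2:
  fixes V1 :: "('x1, 'v1) vbundle" and V2 :: "('x2, 'v2) vbundle"
    and E1 :: "('x1, 'e1) vbundle" and E2 :: "('x2, 'e2) vbundle"
    and g1 :: "('x1, 'v1) metric" and g2 :: "('x2, 'v2) metric"
    and Y :: "'x1 set" and f :: "'x1 \<Rightarrow> 'x2"
    and ft :: "'v1 \<Rightarrow> 'v2" and ft' :: "'e1 \<Rightarrow> 'e2"
    and c1 :: "'x1 \<times> (nat \<Rightarrow> 'v1 tensor) set \<Rightarrow> 'x1 \<times> ('e1 \<Rightarrow> 'e1)"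
    and c2 :: "'x2 \<times> (nat \<Rightarrow> 'v2 tensor) set \<Rightarrow> 'x2 \<times> ('e2 \<Rightarrow> 'e2)"
  assumes "finite_dim_pseudo_bundle V1" and "finite_dim_pseudo_bundle V2"
    and "bundle_gluing V1 V2 Y f ft"
    and "pseudo_metric V1 g1" and "pseudo_metric V2 g2"
    and "compatible_metrics V1 Y f ft g1 g2"
    and "clifford_module V1 g1 E1 c1" and "clifford_module V2 g2 E2 c2"
    and "bundle_gluing E1 E2 Y f ft'"
    and "\<And>y a e. \<lbrakk>y \<in> Y; a \<in> carrier (clifford_fibre V1 g1 y); e \<in> carrier (fibre E1 y)\<rbrakk> \<Longrightarrow>
           ft' (snd (c1 (y, a)) e) = snd (c2 (clifford_map V1 g1 V2 g2 f ft (y, a))) (ft' e)"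
  shows "smooth_map
           (glue_dspace (clifford_dspace V1 g1) (over (clifford_dspace V1 g1) fst Y)
              (clifford_map V1 g1 V2 g2 f ft) (clifford_dspace V2 g2))
           (end_dspace (glue_bundle E1 Y f ft' E2))
           (induced_action (clifford_dspace V1 g1) E1 c1 (clifford_dspace V2 g2) E2 c2
              Y f (clifford_map V1 g1 V2 g2 f ft) ft')"
proof -
  let ?C1 = "clifford_dspace V1 g1" and ?C2 = "clifford_dspace V2 g2"
  let ?F = "clifford_map V1 g1 V2 g2 f ft"
  have V1: "pseudo_bundle V1" and V2: "pseudo_bundle V2"
    using assms(1,2) by (simp_all add: finite_dim_pseudo_bundle_def)
  have E1: "pseudo_bundle E1" and E2: "pseudo_bundle E2"
    and c1: "smooth_map ?C1 (end_dspace E1) c1" and c2: "smooth_map ?C2 (end_dspace E2) c2"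
    using assms(7,8) by (simp_all add: clifford_module_def finite_dim_pseudo_bundle_def)
  note F_eq = clifford_map_eq[OF V1 V2 assms(3) assms(6)]
  have carr: "clifford_class B g x t \<in> carrier (clifford_fibre B g x)"
    if "pseudo_bundle B" "x \<in> points (base B)" "t \<in> carrier (tensor_algebra (fibre B x))" for B g x t
    unfolding clifford_fibre_def carrier_clifford_algebra[OF pseudo_bundleD(7)[OF that(1,2)]]
    using that(3) by blast
  have fY: "f y \<in> points (base V2)" and W: "module real_alg (fibre V1 y)" "module real_alg (fibre V2 (f y))"
    and lin: "linear_map (fibre V1 y) (fibre V2 (f y)) ft" if "y \<in> Y" for y
    using assms(3) that pseudo_bundleD(7)[OF V1, of y] pseudo_bundleD(7)[OF V2, of "f y"]
    by (auto simp: bundle_gluing_def)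
  have "action_gluing ?C1 E1 c1 ?C2 E2 c2 Y f ?F ft'"
  proof
    show "pseudo_bundle E1" "pseudo_bundle E2" "bundle_gluing E1 E2 Y f ft'" by fact+
    show "stable_plots (plots ?C1)" "stable_plots (plots ?C2)"
      by (rule stable_clifford_dspace[OF V1] stable_clifford_dspace[OF V2])+
    show "p u \<in> points ?C1" if "plots ?C1 n U p" "u \<in> U" for n U p u
      by (rule points_plots_clifford[OF V1 that])
    show "p u \<in> points ?C2" if "plots ?C2 n U p" "u \<in> U" for n U p u
      by (rule points_plots_clifford[OF V2 that])
    show "smooth_map ?C1 (end_dspace E1) c1" "smooth_map ?C2 (end_dspace E2) c2" by fact+
    show "fst (c1 v) = fst v" if "v \<in> points ?C1" for v
      using that assms(7) carr[OF V1] by (auto simp: points_clifford_dspace clifford_module_def)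
    show "fst (c2 v) = fst v" if "v \<in> points ?C2" for v
      using that assms(8) carr[OF V2] by (auto simp: points_clifford_dspace clifford_module_def)
    show "?F v \<in> points ?C2 \<and> fst (?F v) = f (fst v)" if v: "v \<in> points ?C1" "fst v \<in> Y" for v
    proof -
      obtain t where t: "v = (fst v, clifford_class V1 g1 (fst v) t)"
        "t \<in> carrier (tensor_algebra (fibre V1 (fst v)))"
        using v(1) unfolding points_clifford_dspace by force
      have "?F v = (f (fst v), clifford_class V2 g2 (f (fst v))
          (tensor_algebra_map (fibre V2 (f (fst v))) ft t))"
        using F_eq[OF v(2) t(2)] t(1) by simp
      moreover have "tensor_algebra_map (fibre V2 (f (fst v))) ft t \<in> carrier (tensor_algebra (fibre V2 (f (fst v))))"
        by (rule alg_hom_closed[OF tensor_algebra_map_hom[OF W[OF v(2)] lin[OF v(2)]] t(2)])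
      ultimately show ?thesis
        using fY[OF v(2)] unfolding points_clifford_dspace by auto
    qed
    show "plots ?C2 n U (?F \<circ> p)" if p: "plots ?C1 n U p" "\<And>u. u \<in> U \<Longrightarrow> fst (p u) \<in> Y" for n U p
    proof (rule plots_clifford_dspaceI)
      show "open_dom n U"
        by (rule stable_plots_open[OF stable_clifford_dspace[OF V1] p(1)])
      fix u assume "u \<in> U"
      then obtain W q where W: "open_dom n W" "u \<in> W" "W \<subseteq> U" and q: "tensor_chart V1 n W q"
        "\<And>w. w \<in> W \<Longrightarrow> p w = (fst (q w), clifford_class V1 g1 (fst (q w)) (snd (q w)))"
        using plots_clifford_dspaceE[OF p(1)] by metis
      have qY: "fst (q w) \<in> Y" if "w \<in> W" for w
        using p(2)[of w] q(2)[OF that] W(3) that by auto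
      let ?q = "\<lambda>u. (f (fst (q u)), tensor_algebra_map (fibre V2 (f (fst (q u)))) ft (snd (q u)))"
      have "tensor_chart V2 n W ?q" by (rule tensor_chart_map[OF V1 V2 assms(3) q(1) qY])
      moreover have "(?F \<circ> p) w = (fst (?q w), clifford_class V2 g2 (fst (?q w)) (snd (?q w)))"
        if "w \<in> W" for w
        using F_eq[OF qY[OF that] tensor_chart_points(2)[OF V1 q(1) that]] q(2)[OF that] by simp
      ultimately show "\<exists>W q. open_dom n W \<and> u \<in> W \<and> W \<subseteq> U \<and> tensor_chart V2 n W q \<and>
          (\<forall>w\<in>W. (?F \<circ> p) w = (fst (q w), clifford_class V2 g2 (fst (q w)) (snd (q w))))"
        using W by blast
    qed
    show "ft' (snd (c1 v) e) = snd (c2 (?F v)) (ft' e)"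
      if v: "v \<in> points ?C1" "fst v \<in> Y" and e: "e \<in> carrier (fibre E1 (fst v))" for v e
    proof -
      have "snd v \<in> carrier (clifford_fibre V1 g1 (fst v))"
        using v(1) carr[OF V1] by (auto simp: points_clifford_dspace)
      then show ?thesis using assms(10)[OF v(2) _ e, of "snd v"] by simp
    qed
  qed
  then show ?thesis by (rule action_gluing.smooth_induced_action)
qed

end
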